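(* The class $\mathsf{CT}^{\mathit{rest}}_{\forall\forall}$ of all finite rule sets $\Sigma$ such that, for every database $D$, every restricted chase sequence of the knowledge base $\langle\Sigma,D\rangle$ is finite, is $\Pi^1_1$-complete.
   Context: Existential rules: a rule is a closed formula $\forall \vec x,\vec y.\, B[\vec x,\vec y]\to\exists \vec z.\, H[\vec y,\vec z]$ where $B,H$ are conjunctions of atoms without nulls, $H$ is non-empty, $B$ features exactly the variables $\vec x,\vec y$ and $H$ exactly $\vec y,\vec z$. Terms are variables, constants or nulls. A database is a finite set of variable-free, null-free atoms. A knowledge base is a pair $\langle\Sigma,D\rangle$ of a finite rule set and a database. A trigger $\langle R,\sigma\rangle$ consists of a rule $R$ and a substitution $\sigma$ defined exactly on the universally quantified variables of $R$ ($\Sigma$-trigger if $R\in\Sigma$). It is loaded for a fact set $F$ if $\sigma(\mathrm{body}(R))\subseteq F$, obsolete for $F$ if some extension $\sigma'$ of $\sigma$ to the existential variables satisfies $\sigma'(\mathrm{head}(R))\subseteq F$; its output is $\sigma'(\mathrm{head}(R))$ with $\sigma'$ mapping existential variables to fresh nulls. A restricted chase derivation for $\langle\Sigma,D\rangle$ is a sequence $F_0=D,F_1,\dots$ where $F_{i+1}=F_i\cup\mathrm{output}(\lambda)$ for a $\Sigma$-trigger $\lambda$ loaded and not obsolete for $F_i$. It is a restricted chase sequence if it is fair: for every $\Sigma$-trigger $\lambda$ and $i$ with $\lambda$ loaded for $F_i$, there is $j\ge i$ with $\lambda$ obsolete for $F_j$. *)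

theory Defs
  imports Complex_Main "HOL-Library.Nat_Bijection" "HOL-Library.Extended_Nat"
begin

section \<open>Existential rules and the restricted chase\<close>

datatype tm = Var nat | Const nat | Null nat

text \<open>A predicate symbol is a name together with an arity, the latter being the number of
  arguments: atoms with the same name but different numbers of arguments have different predicates.\<close>

datatype atom = Atom (pred: nat) (args: "tm list")

text \<open>Conjunctions are lists of atoms. The quantifier prefix is left implicit, as it is determined
  by the variables of body and head.\<close>

datatype rule = Rule (body: "atom list") (head: "atom list")

definition atom_vars :: "atom \<Rightarrow> nat set" where
  "atom_vars a = {v. Var v \<in> set (args a)}"

definition atom_nulls :: "atom \<Rightarrow> nat set" where
  "atom_nulls a = {n. Null n \<in> set (args a)}"

definition univ_vars :: "rule \<Rightarrow> nat set" where
  "univ_vars R = (\<Union>a\<in>set (body R). atom_vars a)"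

definition exist_vars :: "rule \<Rightarrow> nat set" where
  "exist_vars R = (\<Union>a\<in>set (head R). atom_vars a) - univ_vars R"

definition wf_rule :: "rule \<Rightarrow> bool" where
  "wf_rule R \<longleftrightarrow> head R \<noteq> [] \<and> (\<forall>a\<in>set (body R) \<union> set (head R). atom_nulls a = {})"

definition rule_set :: "rule set \<Rightarrow> bool" where
  "rule_set \<Sigma> \<longleftrightarrow> finite \<Sigma> \<and> (\<forall>R\<in>\<Sigma>. wf_rule R)"

definition database :: "atom set \<Rightarrow> bool" where
  "database D \<longleftrightarrow> finite D \<and> (\<forall>a\<in>D. atom_vars a = {} \<and> atom_nulls a = {})"

type_synonym substitution = "nat \<rightharpoonup> tm"

fun subst_tm :: "substitution \<Rightarrow> tm \<Rightarrow> tm" where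
  "subst_tm \<sigma> (Var v) = (case \<sigma> v of Some t \<Rightarrow> t | None \<Rightarrow> Var v)"
| "subst_tm \<sigma> (Const c) = Const c"
| "subst_tm \<sigma> (Null n) = Null n"

definition subst_atom :: "substitution \<Rightarrow> atom \<Rightarrow> atom" where
  "subst_atom \<sigma> a = Atom (pred a) (map (subst_tm \<sigma>) (args a))"

definition trigger :: "rule set \<Rightarrow> rule \<Rightarrow> substitution \<Rightarrow> bool" where
  "trigger \<Sigma> R \<sigma> \<longleftrightarrow> R \<in> \<Sigma> \<and> dom \<sigma> = univ_vars R"

definition loaded :: "rule \<Rightarrow> substitution \<Rightarrow> atom set \<Rightarrow> bool" where
  "loaded R \<sigma> F \<longleftrightarrow> subst_atom \<sigma> ` set (body R) \<subseteq> F"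

definition extends_to_exist :: "rule \<Rightarrow> substitution \<Rightarrow> substitution \<Rightarrow> bool" where
  "extends_to_exist R \<sigma> \<sigma>' \<longleftrightarrow> \<sigma> \<subseteq>\<^sub>m \<sigma>' \<and> dom \<sigma>' = dom \<sigma> \<union> exist_vars R"

definition obsolete :: "rule \<Rightarrow> substitution \<Rightarrow> atom set \<Rightarrow> bool" where
  "obsolete R \<sigma> F \<longleftrightarrow>
     (\<exists>\<sigma>'. extends_to_exist R \<sigma> \<sigma>' \<and> subst_atom \<sigma>' ` set (head R) \<subseteq> F)"

text \<open>The output of a trigger is unique only up to the choice of the fresh nulls, hence a relation:
  \<open>A\<close> is an output of the trigger on \<open>F\<close> if distinct existential variables are mapped to distinct
  nulls that do not occur in \<open>F\<close>.\<close>

definition is_output :: "rule \<Rightarrow> substitution \<Rightarrow> atom set \<Rightarrow> atom set \<Rightarrow> bool" where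
  "is_output R \<sigma> F A \<longleftrightarrow>
     (\<exists>\<sigma>'. extends_to_exist R \<sigma> \<sigma>' \<and>
           inj_on \<sigma>' (exist_vars R) \<and>
           (\<forall>z\<in>exist_vars R. \<exists>n. \<sigma>' z = Some (Null n) \<and> n \<notin> (\<Union>a\<in>F. atom_nulls a)) \<and>
           A = subst_atom \<sigma>' ` set (head R))"

text \<open>A finite or infinite sequence is given by \<open>F\<close> together with its length \<open>L\<close>; its members are
  the \<open>F i\<close> with \<open>i < L\<close>.\<close>

definition restricted_chase_derivation ::
  "rule set \<Rightarrow> atom set \<Rightarrow> (nat \<Rightarrow> atom set) \<Rightarrow> enat \<Rightarrow> bool" where
  "restricted_chase_derivation \<Sigma> D F L \<longleftrightarrow>
     0 < L \<and> F 0 = D \<and>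
     (\<forall>i. enat (Suc i) < L \<longrightarrow>
        (\<exists>R \<sigma> A. trigger \<Sigma> R \<sigma> \<and> loaded R \<sigma> (F i) \<and> \<not> obsolete R \<sigma> (F i) \<and>
                 is_output R \<sigma> (F i) A \<and> F (Suc i) = F i \<union> A))"

definition fair :: "rule set \<Rightarrow> (nat \<Rightarrow> atom set) \<Rightarrow> enat \<Rightarrow> bool" where
  "fair \<Sigma> F L \<longleftrightarrow>
     (\<forall>R \<sigma> i. trigger \<Sigma> R \<sigma> \<longrightarrow> enat i < L \<longrightarrow> loaded R \<sigma> (F i) \<longrightarrow>
        (\<exists>j\<ge>i. enat j < L \<and> obsolete R \<sigma> (F j)))"

definition restricted_chase_sequence ::
  "rule set \<Rightarrow> atom set \<Rightarrow> (nat \<Rightarrow> atom set) \<Rightarrow> enat \<Rightarrow> bool" where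
  "restricted_chase_sequence \<Sigma> D F L \<longleftrightarrow> restricted_chase_derivation \<Sigma> D F L \<and> fair \<Sigma> F L"

definition CT_rest_forall_forall :: "rule set set" where
  "CT_rest_forall_forall =
     {\<Sigma>. rule_set \<Sigma> \<and>
        (\<forall>D. database D \<longrightarrow> (\<forall>F L. restricted_chase_sequence \<Sigma> D F L \<longrightarrow> L < \<infinity>))}"

section \<open>Rule sets as natural numbers\<close>

fun tm_code :: "tm \<Rightarrow> nat" where
  "tm_code (Var v) = prod_encode (0, v)"
| "tm_code (Const c) = prod_encode (1, c)"
| "tm_code (Null n) = prod_encode (2, n)"

definition atom_code :: "atom \<Rightarrow> nat" where
  "atom_code a = prod_encode (pred a, list_encode (map tm_code (args a)))"

definition rule_code :: "rule \<Rightarrow> nat" where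
  "rule_code R = prod_encode (list_encode (map atom_code (body R)),
                              list_encode (map atom_code (head R)))"

definition rules_code :: "rule list \<Rightarrow> nat" where
  "rules_code Rs = list_encode (map rule_code Rs)"

text \<open>A finite rule set has one code for each list enumerating it.\<close>

definition codes :: "rule set set \<Rightarrow> nat set" where
  "codes C = {rules_code Rs | Rs. set Rs \<in> C}"

lemma inj_tm_code: "inj tm_code"
proof (rule injI)
  fix s t assume "tm_code s = tm_code t"
  then show "s = t" by (cases s; cases t) auto
qed

lemma inj_atom_code: "inj atom_code"
  by (rule injI) (auto simp: atom_code_def list_encode_eq inj_map_eq_map[OF inj_tm_code] intro: atom.expand)

lemma inj_rule_code: "inj rule_code"
  by (rule injI) (auto simp: rule_code_def list_encode_eq inj_map_eq_map[OF inj_atom_code] intro: rule.expand)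

lemma inj_rules_code: "inj rules_code"
  by (rule injI) (simp add: rules_code_def list_encode_eq inj_map_eq_map[OF inj_rule_code])

section \<open>Computable functions\<close>

datatype recf =
    Zero | Succ | Proj nat | Comp recf "recf list" | PrimRec recf recf | Mu recf

text \<open>Partial recursive functions: \<open>computes f xs y\<close> says that \<open>f\<close> is defined on the argument
  tuple \<open>xs\<close> with value \<open>y\<close>.\<close>

inductive computes :: "recf \<Rightarrow> nat list \<Rightarrow> nat \<Rightarrow> bool" where
  "computes Zero xs 0"
| "computes Succ [x] (Suc x)"
| "i < length xs \<Longrightarrow> computes (Proj i) xs (xs ! i)"
| "list_all2 (\<lambda>g y. computes g xs y) gs ys \<Longrightarrow> computes f ys z \<Longrightarrow> computes (Comp f gs) xs z"
| "computes f xs y \<Longrightarrow> computes (PrimRec f g) (0 # xs) y"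
| "computes (PrimRec f g) (n # xs) y \<Longrightarrow> computes g (n # y # xs) z \<Longrightarrow>
     computes (PrimRec f g) (Suc n # xs) z"
| "computes f (n # xs) 0 \<Longrightarrow> (\<forall>m<n. \<exists>y. computes f (m # xs) (Suc y)) \<Longrightarrow>
     computes (Mu f) xs n"

definition computable :: "(nat \<Rightarrow> nat) \<Rightarrow> bool" where
  "computable h \<longleftrightarrow> (\<exists>f. \<forall>x. computes f [x] (h x))"

definition many_one_reducible :: "nat set \<Rightarrow> nat set \<Rightarrow> bool" where
  "many_one_reducible B A \<longleftrightarrow> (\<exists>h. computable h \<and> (\<forall>n. n \<in> B \<longleftrightarrow> h n \<in> A))"

section \<open>The class $\Pi^1_1$\<close>

datatype arith_term =
    NumVar nat | NumZero | NumSuc arith_term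
  | NumAdd arith_term arith_term | NumMult arith_term arith_term

text \<open>Arithmetical formulas of second-order arithmetic: number quantifiers are allowed, set
  variables occur only free (in \<open>Mem t k\<close>, the \<open>k\<close>-th set variable contains \<open>t\<close>).\<close>

datatype arith_form =
    Eq arith_term arith_term | Less arith_term arith_term | Mem arith_term nat
  | Neg arith_form | Conj arith_form arith_form | ExNum nat arith_form

fun eval_term :: "(nat \<Rightarrow> nat) \<Rightarrow> arith_term \<Rightarrow> nat" where
  "eval_term e (NumVar v) = e v"
| "eval_term e NumZero = 0"
| "eval_term e (NumSuc t) = Suc (eval_term e t)"
| "eval_term e (NumAdd s t) = eval_term e s + eval_term e t"
| "eval_term e (NumMult s t) = eval_term e s * eval_term e t"

fun holds :: "(nat \<Rightarrow> nat set) \<Rightarrow> (nat \<Rightarrow> nat) \<Rightarrow> arith_form \<Rightarrow> bool" where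
  "holds X e (Eq s t) \<longleftrightarrow> eval_term e s = eval_term e t"
| "holds X e (Less s t) \<longleftrightarrow> eval_term e s < eval_term e t"
| "holds X e (Mem t k) \<longleftrightarrow> eval_term e t \<in> X k"
| "holds X e (Neg \<phi>) \<longleftrightarrow> \<not> holds X e \<phi>"
| "holds X e (Conj \<phi> \<psi>) \<longleftrightarrow> holds X e \<phi> \<and> holds X e \<psi>"
| "holds X e (ExNum v \<phi>) \<longleftrightarrow> (\<exists>n. holds X (e(v := n)) \<phi>)"

text \<open>Since only finitely many set variables occur in \<open>\<phi>\<close>, quantifying over all assignments \<open>X\<close>
  is the prefix \<open>\<forall>X\<^sub>0 \<dots> \<forall>X\<^sub>k\<close> of universal set quantifiers. The number defined is the value of
  variable 0; all other free number variables denote 0.\<close>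

definition Pi11 :: "nat set \<Rightarrow> bool" where
  "Pi11 A \<longleftrightarrow> (\<exists>\<phi>. \<forall>n. n \<in> A \<longleftrightarrow> (\<forall>X. holds X ((\<lambda>_. 0)(0 := n)) \<phi>))"

definition Pi11_complete :: "nat set \<Rightarrow> bool" where
  "Pi11_complete A \<longleftrightarrow> Pi11 A \<and> (\<forall>B. Pi11 B \<longrightarrow> many_one_reducible B A)"

end

theory Submission
  imports Defs "HOL-Library.Countable"
begin

text \<open>
  Membership: an infinite chase sequence is an infinite object whose steps and fairness are
  arithmetical, so non-termination is \<open>\<Sigma>\<^sup>1\<^sub>1\<close>. Set variables also hold the graphs of the recursive
  functions on codes, each fixed by its recursion equations.

  Hardness: the negation of a \<open>\<Pi>\<^sup>1\<^sub>1\<close> statement holds iff there is an infinite sequence of growing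
  finite approximations of a Hintikka set for it, i.e. an infinite descent of a primitive recursive
  relation on numbers. The rules simulate such a descent in stages. A stage \<open>w\<close> builds its own
  successor chain, evaluates the relation by Datalog rules on it, and may spawn a stage for a smaller
  number. The element \<open>w\<close> is at the same time an emergency brake: once the brake rule has been applied
  to \<open>w\<close>, this element satisfies the heads of all existential rules of the stage. Fairness forces the
  brake of every stage, so every stage is finite and, by Koenig's lemma, an infinite fair chase
  sequence contains an infinite descent. Every fresh stage starts from fresh nulls only, hence junk in
  the database affects at most the first two stages of the descent.
\<close>

section \<open>The chase with everywhere defined substitutions\<close>

text \<open>The brake makes stages finite but unbounded: fairness forces it eventually, yet it can
  be postponed until the chain is as long as a computation needs. A database may contain cyclic
  chains, several zeros or false graph atoms, and no rule can reject them; so all invariants speak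
  about stages that are nulls, where they hold vacuously at the start. Braking turns
  \<open>w\<close> into a number of its own chain, after which false facts can be derived there.
  Hence some invariants are tied to the absence of \<open>aN w w\<close>, and others are restricted
  to numbers different from \<open>w\<close>. A step of the descent is an equation
  \<open>f(n, a, b) = 0\<close> with \<open>f\<close> primitive recursive: positive Datalog rules
  derive the values of such an \<open>f\<close>, and reading a descent off a chase takes only the
  soundness of the derived graph atoms. A state of the descent approximates the truth of all signed
  subformulas at once, so that the guessed sets and the witnesses of the number quantifiers are
  found together, directly on the formula as given.\<close>

fun inst_tm :: "(nat \<Rightarrow> tm) \<Rightarrow> tm \<Rightarrow> tm" where
  "inst_tm \<tau> (Var v) = \<tau> v"
| "inst_tm \<tau> (Const c) = Const c"
| "inst_tm \<tau> (Null n) = Null n"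

definition inst :: "(nat \<Rightarrow> tm) \<Rightarrow> atom \<Rightarrow> atom" where
  "inst \<tau> a = Atom (pred a) (map (inst_tm \<tau>) (args a))"

lemma inst_Atom [simp]: "inst \<tau> (Atom p ts) = Atom p (map (inst_tm \<tau>) ts)"
  by (simp add: inst_def)

definition agree :: "rule \<Rightarrow> (nat \<Rightarrow> tm) \<Rightarrow> (nat \<Rightarrow> tm) \<Rightarrow> bool" where
  "agree R \<tau> \<tau>' \<longleftrightarrow> (\<forall>v\<in>univ_vars R. \<tau>' v = \<tau> v)"

definition ld :: "rule \<Rightarrow> (nat \<Rightarrow> tm) \<Rightarrow> atom set \<Rightarrow> bool" where
  "ld R \<tau> F \<longleftrightarrow> (\<forall>a\<in>set (body R). inst \<tau> a \<in> F)"

definition ob :: "rule \<Rightarrow> (nat \<Rightarrow> tm) \<Rightarrow> atom set \<Rightarrow> bool" where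
  "ob R \<tau> F \<longleftrightarrow> (\<exists>\<tau>'. agree R \<tau> \<tau>' \<and> (\<forall>a\<in>set (head R). inst \<tau>' a \<in> F))"

definition nulls :: "atom set \<Rightarrow> nat set" where
  "nulls F = (\<Union>a\<in>F. atom_nulls a)"

definition fresh_ext :: "rule \<Rightarrow> (nat \<Rightarrow> tm) \<Rightarrow> atom set \<Rightarrow> (nat \<Rightarrow> tm) \<Rightarrow> bool" where
  "fresh_ext R \<tau> F \<tau>' \<longleftrightarrow> agree R \<tau> \<tau>' \<and> inj_on \<tau>' (exist_vars R) \<and>
     (\<forall>z\<in>exist_vars R. \<exists>n. \<tau>' z = Null n \<and> n \<notin> nulls F)"

definition step_by :: "rule \<Rightarrow> (nat \<Rightarrow> tm) \<Rightarrow> (nat \<Rightarrow> tm) \<Rightarrow> atom set \<Rightarrow> atom set \<Rightarrow> bool" where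
  "step_by R \<tau> \<tau>' F F' \<longleftrightarrow> ld R \<tau> F \<and> \<not> ob R \<tau> F \<and> fresh_ext R \<tau> F \<tau>' \<and>
     F' = F \<union> inst \<tau>' ` set (head R)"

definition step :: "rule set \<Rightarrow> atom set \<Rightarrow> atom set \<Rightarrow> bool" where
  "step \<Sigma> F F' \<longleftrightarrow> (\<exists>R\<in>\<Sigma>. \<exists>\<tau> \<tau>'. step_by R \<tau> \<tau>' F F')"

definition inf_chase :: "rule set \<Rightarrow> (nat \<Rightarrow> atom set) \<Rightarrow> bool" where
  "inf_chase \<Sigma> F \<longleftrightarrow> database (F 0) \<and> (\<forall>i. step \<Sigma> (F i) (F (Suc i))) \<and>
     (\<forall>R\<in>\<Sigma>. \<forall>\<tau> i. ld R \<tau> (F i) \<longrightarrow> (\<exists>j\<ge>i. ob R \<tau> (F j)))"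

lemma inst_cong:
  "(\<And>v. v \<in> atom_vars a \<Longrightarrow> \<tau> v = \<tau>' v) \<Longrightarrow> inst \<tau> a = inst \<tau>' a"
proof (cases a)
  case (Atom p ts)
  assume *: "\<And>v. v \<in> atom_vars a \<Longrightarrow> \<tau> v = \<tau>' v"
  have "inst_tm \<tau> t = inst_tm \<tau>' t" if "t \<in> set ts" for t
  proof (cases t)
    case (Var v)
    then have "v \<in> atom_vars a" using that Atom by (simp add: atom_vars_def)
    then show ?thesis using * Var by simp
  qed simp_all
  then show ?thesis by (simp add: Atom)
qed

text \<open>The identity outside the domain is what \<open>subst_tm\<close> uses there. Together
  with \<open>restrict_subst\<close> this trades quantifiers over partial triggers for quantifiers
  over total maps, so that partial maps disappear from the rest of the proof.\<close>

definition total_subst :: "substitution \<Rightarrow> nat \<Rightarrow> tm" where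
  "total_subst \<sigma> v = (case \<sigma> v of Some t \<Rightarrow> t | None \<Rightarrow> Var v)"

lemma subst_atom_total: "subst_atom \<sigma> = inst (total_subst \<sigma>)"
proof (rule ext)
  fix a
  have "subst_tm \<sigma> t = inst_tm (total_subst \<sigma>) t" for t by (cases t) (auto simp: total_subst_def)
  then show "subst_atom \<sigma> a = inst (total_subst \<sigma>) a" by (simp add: subst_atom_def inst_def)
qed

definition restrict_subst :: "nat set \<Rightarrow> (nat \<Rightarrow> tm) \<Rightarrow> substitution" where
  "restrict_subst V \<tau> v = (if v \<in> V then Some (\<tau> v) else None)"

lemma dom_partial [simp]: "dom (restrict_subst V \<tau>) = V"
  by (auto simp: restrict_subst_def dom_def)

lemma total_partial [simp]: "v \<in> V \<Longrightarrow> total_subst (restrict_subst V \<tau>) v = \<tau> v"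
  by (simp add: total_subst_def restrict_subst_def)

lemma partial_total: "dom \<sigma> = V \<Longrightarrow> restrict_subst V (total_subst \<sigma>) = \<sigma>"
  by (rule ext) (auto simp: restrict_subst_def total_subst_def dom_def split: option.split)

lemma inst_total_partial:
  "atom_vars a \<subseteq> V \<Longrightarrow> inst (total_subst (restrict_subst V \<tau>)) a = inst \<tau> a"
  by (rule inst_cong) auto

lemma loaded_partial: "loaded R (restrict_subst (univ_vars R) \<tau>) F \<longleftrightarrow> ld R \<tau> F"
proof -
  have "inst (total_subst (restrict_subst (univ_vars R) \<tau>)) a = inst \<tau> a" if "a \<in> set (body R)" for a
    using that by (intro inst_total_partial) (auto simp: univ_vars_def)
  then show ?thesis by (auto simp: loaded_def ld_def subst_atom_total)
qed

lemma extends_partial: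
  "extends_to_exist R (restrict_subst (univ_vars R) \<tau>) \<sigma>' \<longleftrightarrow>
   (\<exists>\<tau>'. agree R \<tau> \<tau>' \<and> \<sigma>' = restrict_subst (univ_vars R \<union> exist_vars R) \<tau>')"
proof
  assume *: "extends_to_exist R (restrict_subst (univ_vars R) \<tau>) \<sigma>'"
  then have d: "dom \<sigma>' = univ_vars R \<union> exist_vars R" by (simp add: extends_to_exist_def)
  have "total_subst \<sigma>' v = \<tau> v" if "v \<in> univ_vars R" for v
  proof -
    have "restrict_subst (univ_vars R) \<tau> v = Some (\<tau> v)" using that by (simp add: restrict_subst_def)
    then have "\<sigma>' v = Some (\<tau> v)"
      using * by (metis domI extends_to_exist_def map_le_def)
    then show ?thesis by (simp add: total_subst_def)
  qed
  then show "\<exists>\<tau>'. agree R \<tau> \<tau>' \<and> \<sigma>' = restrict_subst (univ_vars R \<union> exist_vars R) \<tau>'"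
    using partial_total[OF d] by (auto simp: agree_def intro!: exI[of _ "total_subst \<sigma>'"])
next
  assume "\<exists>\<tau>'. agree R \<tau> \<tau>' \<and> \<sigma>' = restrict_subst (univ_vars R \<union> exist_vars R) \<tau>'"
  then show "extends_to_exist R (restrict_subst (univ_vars R) \<tau>) \<sigma>'"
    by (auto simp: extends_to_exist_def map_le_def agree_def restrict_subst_def dom_def split: if_splits)
qed

lemma head_inst_partial:
  "subst_atom (restrict_subst (univ_vars R \<union> exist_vars R) \<tau>') ` set (head R) = inst \<tau>' ` set (head R)"
proof (rule image_cong[OF refl])
  fix a assume "a \<in> set (head R)"
  then show "subst_atom (restrict_subst (univ_vars R \<union> exist_vars R) \<tau>') a = inst \<tau>' a"
    unfolding subst_atom_total by (intro inst_total_partial) (auto simp: exist_vars_def)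
qed

lemma obsolete_partial: "obsolete R (restrict_subst (univ_vars R) \<tau>) F \<longleftrightarrow> ob R \<tau> F"
proof -
  have "obsolete R (restrict_subst (univ_vars R) \<tau>) F \<longleftrightarrow>
      (\<exists>\<tau>'. agree R \<tau> \<tau>' \<and>
         subst_atom (restrict_subst (univ_vars R \<union> exist_vars R) \<tau>') ` set (head R) \<subseteq> F)"
    unfolding obsolete_def extends_partial by blast
  also have "\<dots> \<longleftrightarrow> ob R \<tau> F"
    unfolding head_inst_partial ob_def by blast
  finally show ?thesis .
qed

lemma output_partial:
  "is_output R (restrict_subst (univ_vars R) \<tau>) F A \<longleftrightarrow>
   (\<exists>\<tau>'. fresh_ext R \<tau> F \<tau>' \<and> A = inst \<tau>' ` set (head R))"
proof -
  have inj: "inj_on (restrict_subst (univ_vars R \<union> exist_vars R) \<tau>') (exist_vars R) \<longleftrightarrow>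
      inj_on \<tau>' (exist_vars R)" for \<tau>'
    by (auto simp: inj_on_def restrict_subst_def)
  have ex: "(\<forall>z\<in>exist_vars R. \<exists>n. restrict_subst (univ_vars R \<union> exist_vars R) \<tau>' z = Some (Null n) \<and> P n)
     \<longleftrightarrow> (\<forall>z\<in>exist_vars R. \<exists>n. \<tau>' z = Null n \<and> P n)" for \<tau>' P
    by (auto simp: restrict_subst_def)
  have "is_output R (restrict_subst (univ_vars R) \<tau>) F A \<longleftrightarrow>
     (\<exists>\<tau>'. agree R \<tau> \<tau>' \<and> inj_on (restrict_subst (univ_vars R \<union> exist_vars R) \<tau>') (exist_vars R) \<and>
       (\<forall>z\<in>exist_vars R. \<exists>n. restrict_subst (univ_vars R \<union> exist_vars R) \<tau>' z = Some (Null n)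
           \<and> n \<notin> (\<Union>a\<in>F. atom_nulls a)) \<and>
       A = subst_atom (restrict_subst (univ_vars R \<union> exist_vars R) \<tau>') ` set (head R))"
    unfolding is_output_def extends_partial by blast
  also have "\<dots> \<longleftrightarrow> (\<exists>\<tau>'. fresh_ext R \<tau> F \<tau>' \<and> A = inst \<tau>' ` set (head R))"
    unfolding inj ex head_inst_partial fresh_ext_def nulls_def by blast
  finally show ?thesis .
qed

lemma trigger_partial:
  "(\<exists>\<sigma>. trigger \<Sigma> R \<sigma> \<and> P \<sigma>) \<longleftrightarrow> R \<in> \<Sigma> \<and> (\<exists>\<tau>. P (restrict_subst (univ_vars R) \<tau>))"
  unfolding trigger_def by (metis dom_partial partial_total)

lemma all_trigger_partial:
  "(\<forall>\<sigma>. trigger \<Sigma> R \<sigma> \<longrightarrow> P \<sigma>) \<longleftrightarrow> (R \<in> \<Sigma> \<longrightarrow> (\<forall>\<tau>. P (restrict_subst (univ_vars R) \<tau>)))"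
  unfolding trigger_def by (metis dom_partial partial_total)

lemma restricted_chase_sequence_infinite:
  "database D \<and> restricted_chase_sequence \<Sigma> D F \<infinity> \<longleftrightarrow> F 0 = D \<and> inf_chase \<Sigma> F"
proof -
  have 1: "(\<exists>R \<sigma> A. trigger \<Sigma> R \<sigma> \<and> loaded R \<sigma> G \<and> \<not> obsolete R \<sigma> G \<and> is_output R \<sigma> G A
      \<and> G' = G \<union> A) \<longleftrightarrow> step \<Sigma> G G'" for G G'
  proof -
    have "(\<exists>R \<sigma> A. trigger \<Sigma> R \<sigma> \<and> loaded R \<sigma> G \<and> \<not> obsolete R \<sigma> G \<and> is_output R \<sigma> G A
        \<and> G' = G \<union> A) \<longleftrightarrow>
      (\<exists>R. (\<exists>\<sigma>. trigger \<Sigma> R \<sigma> \<and> (\<exists>A. loaded R \<sigma> G \<and> \<not> obsolete R \<sigma> G \<and> is_output R \<sigma> G A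
        \<and> G' = G \<union> A)))" by blast
    also have "\<dots> \<longleftrightarrow> step \<Sigma> G G'"
      unfolding trigger_partial loaded_partial obsolete_partial output_partial step_def step_by_def
      by blast
    finally show ?thesis .
  qed
  have 2: "fair \<Sigma> F \<infinity> \<longleftrightarrow> (\<forall>R\<in>\<Sigma>. \<forall>\<tau> i. ld R \<tau> (F i) \<longrightarrow> (\<exists>j\<ge>i. ob R \<tau> (F j)))"
  proof -
    have "fair \<Sigma> F \<infinity> \<longleftrightarrow> (\<forall>R. \<forall>\<sigma>. trigger \<Sigma> R \<sigma> \<longrightarrow> (\<forall>i. loaded R \<sigma> (F i) \<longrightarrow>
        (\<exists>j\<ge>i. obsolete R \<sigma> (F j))))"
      unfolding fair_def by auto
    also have "\<dots> \<longleftrightarrow> (\<forall>R\<in>\<Sigma>. \<forall>\<tau> i. ld R \<tau> (F i) \<longrightarrow> (\<exists>j\<ge>i. ob R \<tau> (F j)))"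
      unfolding all_trigger_partial loaded_partial obsolete_partial by blast
    finally show ?thesis .
  qed
  show ?thesis
    unfolding restricted_chase_sequence_def restricted_chase_derivation_def 1 2 inf_chase_def
    by auto
qed

lemma CT_rest_forall_forall_iff:
  "\<Sigma> \<in> CT_rest_forall_forall \<longleftrightarrow> rule_set \<Sigma> \<and> \<not> (\<exists>F. inf_chase \<Sigma> F)"
proof -
  have "(\<forall>D. database D \<longrightarrow> (\<forall>F L. restricted_chase_sequence \<Sigma> D F L \<longrightarrow> L < \<infinity>)) \<longleftrightarrow>
      \<not> (\<exists>D F. database D \<and> restricted_chase_sequence \<Sigma> D F \<infinity>)"
    by (metis enat_ord_simps(4) enat_ord_simps(6) not_infinity_eq)
  then show ?thesis
    unfolding CT_rest_forall_forall_def restricted_chase_sequence_infinite by blast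
qed

section \<open>The rule sets of the reduction\<close>

instance recf :: countable
  by countable_datatype

text \<open>
  The first argument \<open>w\<close> of every predicate is a stage. \<open>aS\<close>, \<open>aN\<close>, \<open>aZ\<close>: successor, being a number
  and zero in the chain of \<open>w\<close>; \<open>aK w w'\<close>: \<open>w'\<close> is a stage spawned by \<open>w\<close>; \<open>aL w y w'\<close>: it was
  spawned for the number \<open>y\<close> of \<open>w\<close>; \<open>aE w w' u u'\<close>: \<open>u\<close> in \<open>w\<close> and \<open>u'\<close> in \<open>w'\<close> are the same number;
  \<open>aX\<close>: the current value of the descent; \<open>aP\<close>: the parameter \<open>n\<close>; \<open>aG g\<close>: the graph of \<open>g\<close>.
  Both \<open>aS w u w\<close> and \<open>aL w u w\<close> are created together with the number \<open>u\<close>, so that only \<open>aN w w\<close> and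
  \<open>aK w w\<close> are missing for \<open>w\<close> itself to witness every existential rule of its stage; as long as
  these two are missing, the Datalog rules ignore \<open>w\<close>.
\<close>

abbreviation aS :: "tm \<Rightarrow> tm \<Rightarrow> tm \<Rightarrow> atom" where "aS w u v \<equiv> Atom 0 [w, u, v]"
abbreviation aN :: "tm \<Rightarrow> tm \<Rightarrow> atom" where "aN w u \<equiv> Atom 2 [w, u]"
abbreviation aZ :: "tm \<Rightarrow> tm \<Rightarrow> atom" where "aZ w u \<equiv> Atom 3 [w, u]"
abbreviation aK :: "tm \<Rightarrow> tm \<Rightarrow> atom" where "aK w w' \<equiv> Atom 4 [w, w']"
abbreviation aL :: "tm \<Rightarrow> tm \<Rightarrow> tm \<Rightarrow> atom" where "aL w y w' \<equiv> Atom 5 [w, y, w']"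
abbreviation aE :: "tm \<Rightarrow> tm \<Rightarrow> tm \<Rightarrow> tm \<Rightarrow> atom" where "aE w w' u u' \<equiv> Atom 6 [w, w', u, u']"
abbreviation aX :: "tm \<Rightarrow> tm \<Rightarrow> atom" where "aX w x \<equiv> Atom 7 [w, x]"
abbreviation aP :: "tm \<Rightarrow> tm \<Rightarrow> atom" where "aP w p \<equiv> Atom 8 [w, p]"
abbreviation aG :: "recf \<Rightarrow> tm \<Rightarrow> tm list \<Rightarrow> tm \<Rightarrow> atom" where
  "aG g w xs y \<equiv> Atom (9 + to_nat g) (w # xs @ [y])"

text \<open>With \<open>w\<close> for variable 2 the head consists of three body atoms and
  \<open>aN w w\<close>. This is why the body asks for the self-loops: one brake makes all triggers
  of this rule at \<open>w\<close> obsolete.\<close>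

definition chain_rule :: rule where
  "chain_rule = Rule
    [aS (Var 0) (Var 0) (Var 0), aL (Var 0) (Var 0) (Var 0), aS (Var 0) (Var 1) (Var 0),
     aN (Var 0) (Var 1)]
    [aS (Var 0) (Var 1) (Var 2), aN (Var 0) (Var 2), aS (Var 0) (Var 2) (Var 0),
     aL (Var 0) (Var 2) (Var 0)]"

definition brake_rule :: rule where
  "brake_rule = Rule [aS (Var 0) (Var 0) (Var 0)] [aN (Var 0) (Var 0), aK (Var 0) (Var 0)]"

text \<open>Variables 1 to 4 are the next value, the current value, the parameter and zero, so the
  graph atom says that \<open>f\<close> maps (parameter, current, next) to 0. The new stage 5
  receives a zero of its own, variable 6, and all brake atoms except \<open>aN\<close> and
  \<open>aK\<close> on itself.\<close>

definition stage_rule :: "recf \<Rightarrow> rule" where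
  "stage_rule f = Rule
    [aS (Var 0) (Var 0) (Var 0), aL (Var 0) (Var 0) (Var 0), aZ (Var 0) (Var 0),
     aL (Var 0) (Var 1) (Var 0), aX (Var 0) (Var 2), aP (Var 0) (Var 3), aZ (Var 0) (Var 4),
     aN (Var 0) (Var 4), aG f (Var 0) [Var 3, Var 2, Var 1] (Var 4)]
    [aK (Var 0) (Var 5), aL (Var 0) (Var 1) (Var 5), aS (Var 5) (Var 5) (Var 5),
     aL (Var 5) (Var 5) (Var 5), aZ (Var 5) (Var 5), aZ (Var 5) (Var 6), aN (Var 5) (Var 6),
     aS (Var 5) (Var 6) (Var 5), aL (Var 5) (Var 6) (Var 5)]"

text \<open>The new numbers of each stage are fresh nulls, so a value is handed over by matching the
  two chains upwards from their zeros.\<close>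

definition eq_zero_rule :: rule where
  "eq_zero_rule = Rule
    [aK (Var 0) (Var 1), aZ (Var 0) (Var 2), aN (Var 0) (Var 2), aZ (Var 1) (Var 3),
     aN (Var 1) (Var 3)]
    [aE (Var 0) (Var 1) (Var 2) (Var 3)]"

definition eq_suc_rule :: rule where
  "eq_suc_rule = Rule
    [aE (Var 0) (Var 1) (Var 2) (Var 3), aS (Var 0) (Var 2) (Var 4), aN (Var 0) (Var 4),
     aS (Var 1) (Var 3) (Var 5), aN (Var 1) (Var 5)]
    [aE (Var 0) (Var 1) (Var 4) (Var 5)]"

definition value_rule :: rule where
  "value_rule = Rule
    [aL (Var 0) (Var 2) (Var 1), aE (Var 0) (Var 1) (Var 2) (Var 3)] [aX (Var 1) (Var 3)]"

text \<open>Variable \<open>Suc i\<close> stands for the number \<open>i\<close>. The list grows at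
  its front, so that its code obeys a primitive recursion in the parameter.\<close>

primrec param_body :: "nat \<Rightarrow> atom list" where
  "param_body 0 = [aZ (Var 0) (Var 1), aN (Var 0) (Var 1)]"
| "param_body (Suc n) = aS (Var 0) (Var (Suc n)) (Var (Suc (Suc n))) # aN (Var 0) (Var (Suc (Suc n)))
     # param_body n"

definition param_rule :: "nat \<Rightarrow> rule" where
  "param_rule n = Rule (param_body n) [aP (Var 0) (Var (Suc n))]"

abbreviation vars :: "nat \<Rightarrow> tm list" where "vars k \<equiv> map Var [1..<Suc k]"

abbreviation nums :: "nat \<Rightarrow> atom list" where "nums k \<equiv> map (\<lambda>i. aN (Var 0) (Var i)) [1..<Suc k]"

text \<open>The defining equations of a function at arity \<open>k\<close>, with the arguments in
  variables 1 to \<open>k\<close> or, for primitive recursion, the counter after the other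
  arguments. The \<open>nums\<close> atoms bind arguments that no other body atom mentions.
  \<open>Mu\<close> gets no rules; completeness is claimed under \<open>no_mu\<close>.\<close>

fun fun_rules :: "recf \<Rightarrow> nat \<Rightarrow> rule list" where
  "fun_rules Zero k =
     [Rule (nums k @ [aZ (Var 0) (Var (Suc k)), aN (Var 0) (Var (Suc k))])
       [aG Zero (Var 0) (vars k) (Var (Suc k))]]"
| "fun_rules Succ k =
     (if k = 1 then [Rule [aN (Var 0) (Var 1), aS (Var 0) (Var 1) (Var 2), aN (Var 0) (Var 2)]
       [aG Succ (Var 0) [Var 1] (Var 2)]] else [])"
| "fun_rules (Proj i) k =
     (if i < k then [Rule (nums k) [aG (Proj i) (Var 0) (vars k) (Var (Suc i))]] else [])"
| "fun_rules (Comp f gs) k =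
     [Rule (nums k @ map (\<lambda>j. aG (gs ! j) (Var 0) (vars k) (Var (Suc k + j))) [0..<length gs] @
         [aG f (Var 0) (map (\<lambda>j. Var (Suc k + j)) [0..<length gs]) (Var (Suc k + length gs))])
       [aG (Comp f gs) (Var 0) (vars k) (Var (Suc k + length gs))]]"
| "fun_rules (PrimRec f g) k = (case k of 0 \<Rightarrow> [] | Suc k \<Rightarrow>
     [Rule [aZ (Var 0) (Var (k + 1)), aN (Var 0) (Var (k + 1)), aG f (Var 0) (vars k) (Var (k + 2))]
       [aG (PrimRec f g) (Var 0) (Var (k + 1) # vars k) (Var (k + 2))],
      Rule [aG (PrimRec f g) (Var 0) (Var (k + 1) # vars k) (Var (k + 2)),
         aS (Var 0) (Var (k + 1)) (Var (k + 3)), aN (Var 0) (Var (k + 3)),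
         aG g (Var 0) (Var (k + 1) # Var (k + 2) # vars k) (Var (k + 4))]
       [aG (PrimRec f g) (Var 0) (Var (k + 3) # vars k) (Var (k + 4))]])"
| "fun_rules (Mu f) k = []"

text \<open>A \<open>recf\<close> term carries no arity, so the arity is passed down from the
  outermost call; the step function of a primitive recursion has one argument more than the
  recursion itself.\<close>

fun all_fun_rules :: "recf \<Rightarrow> nat \<Rightarrow> rule list" where
  "all_fun_rules (Comp f gs) k = fun_rules (Comp f gs) k @ all_fun_rules f (length gs) @
     concat (map (\<lambda>g. all_fun_rules g k) gs)"
| "all_fun_rules (PrimRec f g) k = fun_rules (PrimRec f g) k @ all_fun_rules f (k - 1) @
     all_fun_rules g (Suc k)"
| "all_fun_rules f k = fun_rules f k"

text \<open>Collects what does not depend on the parameter, so that only one rule varies in the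
  reduction.\<close>

definition fixed_rules :: "recf \<Rightarrow> rule list" where
  "fixed_rules f = [chain_rule, brake_rule, stage_rule f, eq_zero_rule, eq_suc_rule, value_rule] @
     all_fun_rules f 3"

definition red_rules :: "recf \<Rightarrow> nat \<Rightarrow> rule list" where
  "red_rules f n = param_rule n # fixed_rules f"

lemma all_fun_rules_fun_rules: "R \<in> set (all_fun_rules f k) \<Longrightarrow> \<exists>g k'. R \<in> set (fun_rules g k')"
  by (induction f k rule: all_fun_rules.induct) (auto simp del: fun_rules.simps)

definition datalog :: "rule \<Rightarrow> bool" where
  "datalog R \<longleftrightarrow> exist_vars R = {}"

lemma atom_vars_Atom: "atom_vars (Atom p ts) = {v. Var v \<in> set ts}"
  by (simp add: atom_vars_def)

lemma param_body_vars: "(\<Union>a\<in>set (param_body n). atom_vars a) = {..Suc n}"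
  by (induction n) (auto simp: atom_vars_Atom)

lemma fun_rules_datalog: "R \<in> set (fun_rules g k) \<Longrightarrow> datalog R"
  by (cases g; auto simp: datalog_def exist_vars_def univ_vars_def atom_vars_Atom less_Suc_eq_le Suc_le_eq
      split: if_splits nat.splits)

lemma param_rule_datalog: "datalog (param_rule n)"
  using param_body_vars[of n]
  by (auto simp: datalog_def exist_vars_def univ_vars_def param_rule_def atom_vars_Atom)

lemma eq_rules_datalog: "datalog eq_zero_rule" "datalog eq_suc_rule" "datalog value_rule" "datalog brake_rule"
  by (auto simp: datalog_def exist_vars_def univ_vars_def atom_vars_Atom
      eq_zero_rule_def eq_suc_rule_def value_rule_def brake_rule_def)

lemma chain_rule_vars: "univ_vars chain_rule = {0, 1}" "exist_vars chain_rule = {2}"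
  by (auto simp: exist_vars_def univ_vars_def atom_vars_Atom chain_rule_def)

lemma stage_rule_vars: "univ_vars (stage_rule f) = {0, 1, 2, 3, 4}" "exist_vars (stage_rule f) = {5, 6}"
  by (auto simp: exist_vars_def univ_vars_def atom_vars_Atom stage_rule_def)

section \<open>Invariants of the chase\<close>

lemma step_by_datalog:
  assumes "datalog R" "step_by R \<tau> \<tau>' F F'"
  shows "F' = F \<union> inst \<tau> ` set (head R)"
proof -
  have "inst \<tau>' a = inst \<tau> a" if "a \<in> set (head R)" for a
  proof (rule inst_cong)
    fix v assume "v \<in> atom_vars a"
    then have "v \<in> univ_vars R" using that assms(1) by (auto simp: datalog_def exist_vars_def)
    then show "\<tau>' v = \<tau> v" using assms(2) by (simp add: step_by_def fresh_ext_def agree_def)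
  qed
  then show ?thesis using assms(2) by (auto simp: step_by_def)
qed

lemma ob_datalog: "datalog R \<Longrightarrow> ob R \<tau> F \<longleftrightarrow> (\<forall>a\<in>set (head R). inst \<tau> a \<in> F)"
proof -
  assume "datalog R"
  then have "inst \<tau>' a = inst \<tau> a" if "a \<in> set (head R)" "agree R \<tau> \<tau>'" for a \<tau>'
    using that by (intro inst_cong) (auto simp: datalog_def exist_vars_def agree_def)
  moreover have "agree R \<tau> \<tau>" by (simp add: agree_def)
  ultimately show ?thesis unfolding ob_def by metis
qed

lemma ob_chain_rule:
  "ob chain_rule \<tau> F \<longleftrightarrow> (\<exists>v. aS (\<tau> 0) (\<tau> 1) v \<in> F \<and> aN (\<tau> 0) v \<in> F \<and> aS (\<tau> 0) v (\<tau> 0) \<in> F \<and>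
     aL (\<tau> 0) v (\<tau> 0) \<in> F)" (is "?l \<longleftrightarrow> ?r")
proof
  assume ?l
  then show ?r by (auto simp: ob_def agree_def chain_rule_vars) (auto simp: chain_rule_def)
next
  assume ?r
  then obtain v where "aS (\<tau> 0) (\<tau> 1) v \<in> F \<and> aN (\<tau> 0) v \<in> F \<and> aS (\<tau> 0) v (\<tau> 0) \<in> F \<and>
     aL (\<tau> 0) v (\<tau> 0) \<in> F" by blast
  then show ?l unfolding ob_def agree_def chain_rule_vars
    by (intro exI[of _ "\<tau>(2 := v)"]) (auto simp: chain_rule_def)
qed

lemma ob_stage_rule:
  "ob (stage_rule f) \<tau> F \<longleftrightarrow> (\<exists>w' o'. aK (\<tau> 0) w' \<in> F \<and> aL (\<tau> 0) (\<tau> 1) w' \<in> F \<and>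
     aS w' w' w' \<in> F \<and> aL w' w' w' \<in> F \<and> aZ w' w' \<in> F \<and> aZ w' o' \<in> F \<and> aN w' o' \<in> F \<and>
     aS w' o' w' \<in> F \<and> aL w' o' w' \<in> F)" (is "?l \<longleftrightarrow> ?r")
proof
  assume ?l
  then show ?r by (auto simp: ob_def agree_def stage_rule_vars) (auto simp: stage_rule_def)
next
  assume ?r
  then obtain w' o' where "aK (\<tau> 0) w' \<in> F \<and> aL (\<tau> 0) (\<tau> 1) w' \<in> F \<and>
     aS w' w' w' \<in> F \<and> aL w' w' w' \<in> F \<and> aZ w' w' \<in> F \<and> aZ w' o' \<in> F \<and> aN w' o' \<in> F \<and>
     aS w' o' w' \<in> F \<and> aL w' o' w' \<in> F" by blast
  then show ?l unfolding ob_def agree_def stage_rule_vars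
    by (intro exI[of _ "\<tau>(5 := w', 6 := o')"]) (auto simp: stage_rule_def)
qed

section \<open>Fresh nulls and the effect of the two existential rules\<close>

definition fresh :: "atom set \<Rightarrow> tm \<Rightarrow> bool" where
  "fresh F t \<longleftrightarrow> (\<exists>m. t = Null m) \<and> (\<forall>a\<in>F. t \<notin> set (args a))"

lemma fresh_Null: "m \<notin> nulls F \<Longrightarrow> fresh F (Null m)"
  by (auto simp: fresh_def nulls_def atom_nulls_def)

lemma freshD: "fresh F t \<Longrightarrow> t \<in> set ts \<Longrightarrow> Atom p ts \<notin> F"
  by (force simp: fresh_def)

text \<open>The brake cannot have been applied: with \<open>aN w w\<close> present, \<open>w\<close>
  itself would witness the head and the trigger would be obsolete.\<close>

lemma step_chain_rule:
  assumes "step_by chain_rule \<tau> \<tau>' F F'"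
  shows "aS (\<tau> 0) (\<tau> 0) (\<tau> 0) \<in> F" "aL (\<tau> 0) (\<tau> 0) (\<tau> 0) \<in> F" "aS (\<tau> 0) (\<tau> 1) (\<tau> 0) \<in> F"
    "aN (\<tau> 0) (\<tau> 1) \<in> F" "aN (\<tau> 0) (\<tau> 0) \<notin> F" "fresh F (\<tau>' 2)"
    "F' = F \<union> {aS (\<tau> 0) (\<tau> 1) (\<tau>' 2), aN (\<tau> 0) (\<tau>' 2), aS (\<tau> 0) (\<tau>' 2) (\<tau> 0), aL (\<tau> 0) (\<tau>' 2) (\<tau> 0)}"
proof -
  have l: "ld chain_rule \<tau> F" and nob: "\<not> ob chain_rule \<tau> F" and fr: "fresh_ext chain_rule \<tau> F \<tau>'"
    and F': "F' = F \<union> inst \<tau>' ` set (head chain_rule)"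
    using assms by (auto simp: step_by_def)
  show 1: "aS (\<tau> 0) (\<tau> 0) (\<tau> 0) \<in> F" "aL (\<tau> 0) (\<tau> 0) (\<tau> 0) \<in> F" "aS (\<tau> 0) (\<tau> 1) (\<tau> 0) \<in> F"
    "aN (\<tau> 0) (\<tau> 1) \<in> F"
    using l by (auto simp: ld_def chain_rule_def)
  then show "aN (\<tau> 0) (\<tau> 0) \<notin> F" using nob unfolding ob_chain_rule by blast
  show "fresh F (\<tau>' 2)" using fr by (auto simp: fresh_ext_def chain_rule_vars fresh_Null)
  have "\<tau>' 0 = \<tau> 0" "\<tau>' 1 = \<tau> 1" using fr by (auto simp: fresh_ext_def agree_def chain_rule_vars)
  then show "F' = F \<union> {aS (\<tau> 0) (\<tau> 1) (\<tau>' 2), aN (\<tau> 0) (\<tau>' 2), aS (\<tau> 0) (\<tau>' 2) (\<tau> 0),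
      aL (\<tau> 0) (\<tau>' 2) (\<tau> 0)}"
    using F' by (simp add: chain_rule_def)
qed

lemma step_stage_rule:
  assumes "step_by (stage_rule f) \<tau> \<tau>' F F'"
  shows "aS (\<tau> 0) (\<tau> 0) (\<tau> 0) \<in> F" "aL (\<tau> 0) (\<tau> 0) (\<tau> 0) \<in> F" "aX (\<tau> 0) (\<tau> 2) \<in> F"
    "aP (\<tau> 0) (\<tau> 3) \<in> F" "aZ (\<tau> 0) (\<tau> 4) \<in> F" "aN (\<tau> 0) (\<tau> 4) \<in> F"
    "aG f (\<tau> 0) [\<tau> 3, \<tau> 2, \<tau> 1] (\<tau> 4) \<in> F"
    "\<not> (aN (\<tau> 0) (\<tau> 0) \<in> F \<and> aK (\<tau> 0) (\<tau> 0) \<in> F)" "fresh F (\<tau>' 5)" "fresh F (\<tau>' 6)" "\<tau>' 5 \<noteq> \<tau>' 6"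
    "F' = F \<union> {aK (\<tau> 0) (\<tau>' 5), aL (\<tau> 0) (\<tau> 1) (\<tau>' 5), aS (\<tau>' 5) (\<tau>' 5) (\<tau>' 5),
     aL (\<tau>' 5) (\<tau>' 5) (\<tau>' 5), aZ (\<tau>' 5) (\<tau>' 5), aZ (\<tau>' 5) (\<tau>' 6), aN (\<tau>' 5) (\<tau>' 6),
     aS (\<tau>' 5) (\<tau>' 6) (\<tau>' 5), aL (\<tau>' 5) (\<tau>' 6) (\<tau>' 5)}"
proof -
  have l: "ld (stage_rule f) \<tau> F" and nob: "\<not> ob (stage_rule f) \<tau> F"
    and fr: "fresh_ext (stage_rule f) \<tau> F \<tau>'"
    and F': "F' = F \<union> inst \<tau>' ` set (head (stage_rule f))"
    using assms by (auto simp: step_by_def)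
  show "aS (\<tau> 0) (\<tau> 0) (\<tau> 0) \<in> F" "aL (\<tau> 0) (\<tau> 0) (\<tau> 0) \<in> F" "aX (\<tau> 0) (\<tau> 2) \<in> F"
    "aP (\<tau> 0) (\<tau> 3) \<in> F" "aZ (\<tau> 0) (\<tau> 4) \<in> F" "aN (\<tau> 0) (\<tau> 4) \<in> F"
    "aG f (\<tau> 0) [\<tau> 3, \<tau> 2, \<tau> 1] (\<tau> 4) \<in> F"
    using l by (auto simp: ld_def stage_rule_def)
  have "aS (\<tau> 0) (\<tau> 0) (\<tau> 0) \<in> F" "aL (\<tau> 0) (\<tau> 0) (\<tau> 0) \<in> F" "aZ (\<tau> 0) (\<tau> 0) \<in> F"
    "aL (\<tau> 0) (\<tau> 1) (\<tau> 0) \<in> F"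
    using l by (auto simp: ld_def stage_rule_def)
  then show "\<not> (aN (\<tau> 0) (\<tau> 0) \<in> F \<and> aK (\<tau> 0) (\<tau> 0) \<in> F)" using nob unfolding ob_stage_rule by blast
  show "fresh F (\<tau>' 5)" "fresh F (\<tau>' 6)" "\<tau>' 5 \<noteq> \<tau>' 6"
    using fr by (auto simp: fresh_ext_def stage_rule_vars fresh_Null)
  have "\<tau>' 0 = \<tau> 0" "\<tau>' 1 = \<tau> 1" using fr by (auto simp: fresh_ext_def agree_def stage_rule_vars)
  then show "F' = F \<union> {aK (\<tau> 0) (\<tau>' 5), aL (\<tau> 0) (\<tau> 1) (\<tau>' 5), aS (\<tau>' 5) (\<tau>' 5) (\<tau>' 5),
     aL (\<tau>' 5) (\<tau>' 5) (\<tau>' 5), aZ (\<tau>' 5) (\<tau>' 5), aZ (\<tau>' 5) (\<tau>' 6), aN (\<tau>' 5) (\<tau>' 6),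
     aS (\<tau>' 5) (\<tau>' 6) (\<tau>' 5), aL (\<tau>' 5) (\<tau>' 6) (\<tau>' 5)}"
    using F' by (simp add: stage_rule_def)
qed

text \<open>Distance from a zero along elements other than \<open>w\<close>. Excluding
  \<open>w\<close> discards the self-loops and the edges back to \<open>w\<close> that every stage
  carries for its brake.\<close>

inductive dep :: "atom set \<Rightarrow> tm \<Rightarrow> tm \<Rightarrow> nat \<Rightarrow> bool" for F w where
  dep_zero: "aZ w u \<in> F \<Longrightarrow> u \<noteq> w \<Longrightarrow> dep F w u 0"
| dep_suc: "dep F w u k \<Longrightarrow> aS w u v \<in> F \<Longrightarrow> v \<noteq> w \<Longrightarrow> dep F w v (Suc k)"

lemma dep_mono: "dep F w u k \<Longrightarrow> F \<subseteq> F' \<Longrightarrow> dep F' w u k"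
  by (induction rule: dep.induct) (auto intro: dep.intros)

lemma dep_neq: "dep F w u k \<Longrightarrow> u \<noteq> w"
  by (induction rule: dep.induct) auto

text \<open>The first two clauses make depths unique, the fifth makes the parent of a stage and the
  transmitted number unique. The brake is recorded as an equivalence because a chain step reveals
  that \<open>aN w w\<close> is missing, whereas a spawn reveals only that one of the two atoms
  is.\<close>

definition core_at :: "atom set \<Rightarrow> tm \<Rightarrow> bool" where
  "core_at F w \<longleftrightarrow>
     (\<forall>u v. aS w u v \<in> F \<longrightarrow> v \<noteq> w \<longrightarrow> aZ w v \<notin> F) \<and>
     (\<forall>u u' v. aS w u v \<in> F \<longrightarrow> aS w u' v \<in> F \<longrightarrow> v \<noteq> w \<longrightarrow> u' = u) \<and>
     (\<forall>u. aN w u \<in> F \<longrightarrow> u \<noteq> w \<longrightarrow> (\<exists>k. dep F w u k)) \<and>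
     (aN w w \<in> F \<longleftrightarrow> aK w w \<in> F) \<and>
     (\<forall>w0 y w0' y'. aL w0 y w \<in> F \<longrightarrow> w0 \<noteq> w \<longrightarrow> aL w0' y' w \<in> F \<longrightarrow> w0' \<noteq> w \<longrightarrow>
        w0' = w0 \<and> y' = y) \<and>
     (\<forall>y w'. aL w y w' \<in> F \<longrightarrow> w' \<noteq> w \<longrightarrow> y \<noteq> w)"

text \<open>A zero is no successor and every other number has one predecessor, so two derivations of
  a depth retrace each other.\<close>

lemma core_at_dep_unique:
  assumes "core_at F w" "dep F w u k" "dep F w u k'"
  shows "k' = k"
  using assms(2,3)
proof (induction arbitrary: k' rule: dep.induct)
  case (dep_zero u)
  from dep_zero(3) show ?case
  proof cases
    case (dep_suc u' k)
    then show ?thesis using dep_zero(1,2) assms(1) unfolding core_at_def by blast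
  qed simp
next
  case (dep_suc u k v)
  note IH = dep_suc.IH
  have v: "v \<noteq> w" "aS w u v \<in> F" by fact+
  from dep_suc.prems show ?case
  proof cases
    case dep_zero
    then show ?thesis using assms(1) v unfolding core_at_def by blast
  next
    case (dep_suc u' k'')
    then have "u' = u" using assms(1) v unfolding core_at_def by blast
    then show ?thesis using dep_suc IH by blast
  qed
qed

lemma core_at_num:
  "core_at F w \<Longrightarrow> aN w u \<in> F \<Longrightarrow> aN w w \<notin> F \<Longrightarrow> \<exists>k. dep F w u k"
  unfolding core_at_def by metis

text \<open>The meaning of derived atoms. The clauses on \<open>aX\<close>, \<open>aP\<close> and
  \<open>aG\<close> lapse with the brake, when \<open>w\<close> begins to pass for a number.
  Equality atoms must stay correct beyond it, because a child may still be copying its value from a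
  braked parent. Nothing is claimed about values handed over by non-null stages. The last clause is
  the descent step read off two consecutive links.\<close>

definition derived_at :: "recf \<Rightarrow> nat \<Rightarrow> atom set \<Rightarrow> tm \<Rightarrow> bool" where
  "derived_at f n F w \<longleftrightarrow>
     (\<forall>w0 u u'. aE w0 w u u' \<in> F \<longrightarrow> aK w0 w \<in> F \<and> aN w0 u \<in> F \<and> aN w u' \<in> F) \<and>
     (\<forall>m0 u u'. aE (Null m0) w u u' \<in> F \<longrightarrow> u \<noteq> Null m0 \<longrightarrow> u' \<noteq> w \<longrightarrow>
        (\<exists>k. dep F (Null m0) u k \<and> dep F w u' k)) \<and>
     (\<forall>x. aX w x \<in> F \<longrightarrow> aN w w \<notin> F \<longrightarrow> (\<exists>w0 y. w0 \<noteq> w \<and> aL w0 y w \<in> F \<and>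
        (\<forall>m0. w0 = Null m0 \<longrightarrow> (\<exists>k. dep F w0 y k \<and> dep F w x k)))) \<and>
     (\<forall>p. aP w p \<in> F \<longrightarrow> aN w w \<notin> F \<longrightarrow> dep F w p n) \<and>
     (\<forall>g xs y. aG g w xs y \<in> F \<longrightarrow> aN w w \<notin> F \<longrightarrow>
        (\<exists>ks k. list_all2 (dep F w) xs ks \<and> dep F w y k \<and> computes g ks k)) \<and>
     (\<forall>m0 y0 y1 w2. aL (Null m0) y0 w \<in> F \<longrightarrow> Null m0 \<noteq> w \<longrightarrow> aL w y1 w2 \<in> F \<longrightarrow> w2 \<noteq> w \<longrightarrow>
        (\<exists>a b. dep F (Null m0) y0 a \<and> dep F w y1 b \<and> computes f [n, a, b] 0))"

definition stage_inv :: "recf \<Rightarrow> nat \<Rightarrow> atom set \<Rightarrow> bool" where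
  "stage_inv f n F \<longleftrightarrow> (\<forall>m. core_at F (Null m) \<and> derived_at f n F (Null m))"

lemma absent_core_at:
  assumes "\<And>p ts. w \<in> set ts \<Longrightarrow> Atom p ts \<notin> F"
  shows "core_at F w" "derived_at f n F w"
  using assms by (simp_all add: core_at_def derived_at_def)

text \<open>No null occurs in a database, so every clause is vacuous for every null.\<close>

lemma inv_database: "database D \<Longrightarrow> stage_inv f n D"
  unfolding stage_inv_def
  by (intro allI conjI absent_core_at) (fastforce simp: database_def atom_nulls_def)+

definition dval :: "atom set \<Rightarrow> tm \<Rightarrow> tm \<Rightarrow> nat" where
  "dval F w u = (SOME k. dep F w u k)"

lemma dep_dval: "dep F w u k \<Longrightarrow> dep F w u (dval F w u)"
  unfolding dval_def by (rule someI)

lemma dval_eq: "core_at F w \<Longrightarrow> dep F w u k \<Longrightarrow> dval F w u = k"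
  using core_at_dep_unique dep_dval by blast

lemma list_all2_dval:
  assumes "core_at F w" "list_all2 (dep F w) xs ks"
  shows "ks = map (dval F w) xs" "\<forall>x\<in>set xs. \<exists>k. dep F w x k"
  using assms(2) by (induction) (auto simp: dval_eq[OF assms(1)])

text \<open>Functional form of the \<open>aG\<close> clause: with \<open>dval\<close> in place of
  quantified depths, a variable shared by several body atoms has the same value in all of
  them.\<close>

definition sound_at :: "atom set \<Rightarrow> tm \<Rightarrow> recf \<Rightarrow> tm list \<Rightarrow> tm \<Rightarrow> bool" where
  "sound_at F w g xs y \<longleftrightarrow> (\<forall>x\<in>insert y (set xs). \<exists>k. dep F w x k) \<and>
     computes g (map (dval F w) xs) (dval F w y)"

lemma sound_atI:
  assumes "core_at F w" "list_all2 (dep F w) xs ks" "dep F w y k" "computes g ks k"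
  shows "sound_at F w g xs y"
  using assms list_all2_dval[OF assms(1,2)] dval_eq[OF assms(1,3)] by (auto simp: sound_at_def)

lemma sound_atD:
  assumes "sound_at F w g xs y"
  shows "\<exists>ks k. list_all2 (dep F w) xs ks \<and> dep F w y k \<and> computes g ks k"
proof (intro exI conjI)
  show "list_all2 (dep F w) xs (map (dval F w) xs)"
    using assms by (auto simp: sound_at_def list_all2_map2 intro!: list_all2_refl list.rel_refl_strong dep_dval)
  show "dep F w y (dval F w y)" "computes g (map (dval F w) xs) (dval F w y)"
    using assms by (auto simp: sound_at_def intro: dep_dval)
qed

text \<open>Each rule mirrors a clause of \<open>computes\<close>. As the stage is not braked, every
  element marked by \<open>aN\<close> is a proper number and has a depth.\<close>

lemma fun_rules_sound:
  assumes R: "R \<in> set (fun_rules g k)" and l: "ld R \<tau> F" and core: "core_at F w"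
    and w: "w = \<tau> 0" "aN w w \<notin> F"
    and G: "\<And>g xs y. aG g w xs y \<in> F \<Longrightarrow> sound_at F w g xs y"
  shows "\<exists>xs y. inst \<tau> ` set (head R) = {aG g w xs y} \<and> sound_at F w g xs y"
proof -
  have N: "\<exists>k. dep F w u k" if "aN w u \<in> F" for u
    using core_at_num[OF core that w(2)] .
  have Z: "dval F w u = 0" if "aN w u \<in> F" "aZ w u \<in> F" for u
  proof -
    have "dep F w u 0" using that w(2) by (auto intro: dep_zero)
    then show ?thesis using dval_eq[OF core] by simp
  qed
  have S: "dval F w v = Suc (dval F w u)" if "aN w v \<in> F" "aS w u v \<in> F" "\<exists>k. dep F w u k" for u v
  proof -
    from that(3) obtain k where k: "dep F w u k" by blast
    then have "dep F w v (Suc k)" using that w(2) by (auto intro: dep_suc)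
    then show ?thesis using dval_eq[OF core k] dval_eq[OF core] by simp
  qed
  show ?thesis
  proof (cases g)
    case Zero
    let ?xs = "map \<tau> [1..<Suc k]" and ?y = "\<tau> (Suc k)"
    have "aN w x \<in> F" if "x \<in> insert ?y (set ?xs)" for x
      using that l R Zero w by (auto simp: ld_def)
    moreover have "aZ w ?y \<in> F" using l R Zero w by (auto simp: ld_def)
    ultimately have "sound_at F w g ?xs ?y" using N Z
      by (simp add: sound_at_def Zero computes.intros(1))
    moreover have "inst \<tau> ` set (head R) = {aG g w ?xs ?y}" using R Zero w by (simp add: comp_def)
    ultimately show ?thesis by blast
  next
    case Succ
    have "aN w (\<tau> 1) \<in> F" "aN w (\<tau> 2) \<in> F" "aS w (\<tau> 1) (\<tau> 2) \<in> F"
      using R l Succ w by (auto simp: ld_def split: if_splits)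
    then have "sound_at F w g [\<tau> 1] (\<tau> 2)" using N S Succ
      by (simp add: sound_at_def computes.intros(2))
    moreover have "inst \<tau> ` set (head R) = {aG g w [\<tau> 1] (\<tau> 2)}"
      using R Succ w by (simp split: if_splits)
    ultimately show ?thesis by blast
  next
    case (Proj i)
    let ?xs = "map \<tau> [1..<Suc k]"
    have i: "i < k" using R Proj by (simp split: if_splits)
    have "aN w x \<in> F" if "x \<in> set ?xs" for x
      using that l R Proj w i by (auto simp: ld_def)
    then have *: "\<exists>k. dep F w x k" if "x \<in> set ?xs" for x using N that by blast
    have nth: "?xs ! i = \<tau> (Suc i)" using i by (simp del: upt_Suc)
    then have "\<tau> (Suc i) \<in> set ?xs" using i by (metis diff_Suc_1 length_map length_upt nth_mem)
    then have "sound_at F w g ?xs (\<tau> (Suc i))"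
      using * computes.intros(3)[of i "map (dval F w) ?xs"] i nth
      unfolding sound_at_def Proj by (simp del: upt_Suc)
    moreover have "inst \<tau> ` set (head R) = {aG g w ?xs (\<tau> (Suc i))}" using R Proj w i
      by (simp add: comp_def)
    ultimately show ?thesis by blast
  next
    case (Comp f gs)
    let ?xs = "map \<tau> [1..<Suc k]" and ?ys = "map (\<lambda>j. \<tau> (Suc k + j)) [0..<length gs]"
      and ?y = "\<tau> (Suc k + length gs)"
    have "aN w x \<in> F" if "x \<in> set ?xs" for x
      using that l R Comp w by (force simp: ld_def simp del: upt_Suc)
    then have *: "\<exists>k. dep F w x k" if "x \<in> set ?xs" for x using N that by blast
    have Gj: "aG (gs ! j) w ?xs (\<tau> (Suc k + j)) \<in> F" if "j < length gs" for j
      using that l R Comp w by (force simp: ld_def comp_def simp del: upt_Suc)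
    then have gs: "computes (gs ! j) (map (dval F w) ?xs) (dval F w (?ys ! j))" if "j < length gs" for j
      using G[OF Gj[OF that]] that unfolding sound_at_def by (simp del: upt_Suc)
    have "aG f w ?ys ?y \<in> F" using l R Comp w by (auto simp: ld_def comp_def)
    then have f: "sound_at F w f ?ys ?y" by (rule G)
    have "list_all2 (\<lambda>g y. computes g (map (dval F w) ?xs) y) gs (map (dval F w) ?ys)"
      using gs by (simp add: list_all2_conv_all_nth del: upt_Suc)
    then have "sound_at F w g ?xs ?y"
      using f * unfolding sound_at_def Comp by (blast intro: computes.intros(4))
    moreover have "inst \<tau> ` set (head R) = {aG g w ?xs ?y}" using R Comp w by (simp add: comp_def)
    ultimately show ?thesis by blast
  next
    case (PrimRec f h)
    then obtain k' where k: "k = Suc k'" using R by (auto split: nat.splits)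
    let ?xs = "map \<tau> [1..<Suc k']" and ?n = "\<tau> (k' + 1)" and ?y = "\<tau> (k' + 2)" and ?n' = "\<tau> (k' + 3)"
      and ?z = "\<tau> (k' + 4)"
    consider (base) "aZ w ?n \<in> F" "aN w ?n \<in> F" "aG f w ?xs ?y \<in> F"
        "inst \<tau> ` set (head R) = {aG g w (?n # ?xs) ?y}"
      | (step) "aG g w (?n # ?xs) ?y \<in> F" "aS w ?n ?n' \<in> F" "aN w ?n' \<in> F"
        "aG h w (?n # ?y # ?xs) ?z \<in> F" "inst \<tau> ` set (head R) = {aG g w (?n' # ?xs) ?z}"
      using R l w PrimRec k by (auto simp: ld_def comp_def)
    then show ?thesis
    proof cases
      case base
      then have "sound_at F w g (?n # ?xs) ?y"
        using N Z[of ?n] G[of f ?xs ?y] by (simp add: sound_at_def PrimRec computes.intros(5))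
      with base show ?thesis by blast
    next
      case step
      have a: "sound_at F w g (?n # ?xs) ?y" and b: "sound_at F w h (?n # ?y # ?xs) ?z"
        using step G by blast+
      then have "dval F w ?n' = Suc (dval F w ?n)" using S step by (simp add: sound_at_def)
      then have "sound_at F w g (?n' # ?xs) ?z"
        using N[of ?n'] step a b by (auto simp: sound_at_def PrimRec intro: computes.intros(6))
      with step show ?thesis by blast
    qed
  next
    case (Mu f)
    then show ?thesis using R by simp
  qed
qed

lemma fun_rules_head:
  "R \<in> set (fun_rules g k) \<Longrightarrow> \<exists>xs y. inst \<tau> ` set (head R) = {aG g (\<tau> 0) xs y}"
  by (cases g; auto split: if_splits nat.splits simp: comp_def)

lemma core_atD:
  assumes "core_at F w"
  shows core_at_zero: "aS w u v \<in> F \<Longrightarrow> v \<noteq> w \<Longrightarrow> aZ w v \<notin> F"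
    and core_at_pred: "aS w u v \<in> F \<Longrightarrow> aS w u' v \<in> F \<Longrightarrow> v \<noteq> w \<Longrightarrow> u' = u"
    and core_at_dep: "aN w u \<in> F \<Longrightarrow> u \<noteq> w \<Longrightarrow> \<exists>k. dep F w u k"
    and core_at_brake: "aN w w \<in> F \<longleftrightarrow> aK w w \<in> F"
    and core_at_link: "aL w0 y w \<in> F \<Longrightarrow> w0 \<noteq> w \<Longrightarrow> aL w0' y' w \<in> F \<Longrightarrow> w0' \<noteq> w \<Longrightarrow> w0' = w0 \<and> y' = y"
    and core_at_link_neq: "aL w y w' \<in> F \<Longrightarrow> w' \<noteq> w \<Longrightarrow> y \<noteq> w"
  using assms unfolding core_at_def by (elim conjE; metis)+

lemma derived_atD:
  assumes "derived_at f n F w"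
  shows derived_at_eq: "aE w0 w u u' \<in> F \<Longrightarrow> aK w0 w \<in> F \<and> aN w0 u \<in> F \<and> aN w u' \<in> F"
    and derived_at_eq_dep: "aE (Null m0) w u u' \<in> F \<Longrightarrow> u \<noteq> Null m0 \<Longrightarrow> u' \<noteq> w \<Longrightarrow>
        \<exists>k. dep F (Null m0) u k \<and> dep F w u' k"
    and derived_at_value: "aX w x \<in> F \<Longrightarrow> aN w w \<notin> F \<Longrightarrow> \<exists>w0 y. w0 \<noteq> w \<and> aL w0 y w \<in> F \<and>
        (\<forall>m0. w0 = Null m0 \<longrightarrow> (\<exists>k. dep F w0 y k \<and> dep F w x k))"
    and derived_at_param: "aP w p \<in> F \<Longrightarrow> aN w w \<notin> F \<Longrightarrow> dep F w p n"
    and derived_at_fun: "aG g w xs y \<in> F \<Longrightarrow> aN w w \<notin> F \<Longrightarrow>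
        \<exists>ks k. list_all2 (dep F w) xs ks \<and> dep F w y k \<and> computes g ks k"
    and derived_at_link: "aL (Null m0) y0 w \<in> F \<Longrightarrow> Null m0 \<noteq> w \<Longrightarrow> aL w y1 w2 \<in> F \<Longrightarrow> w2 \<noteq> w \<Longrightarrow>
        \<exists>a b. dep F (Null m0) y0 a \<and> dep F w y1 b \<and> computes f [n, a, b] 0"
  using assms unfolding derived_at_def by (elim conjE; simp)+

lemma core_at_mono:
  assumes "core_at F w" "F \<subseteq> F'"
    and "\<And>u v. aS w u v \<in> F' \<Longrightarrow> aS w u v \<in> F" "\<And>u. aZ w u \<in> F' \<Longrightarrow> aZ w u \<in> F"
    and "\<And>u. aN w u \<in> F' \<Longrightarrow> aN w u \<in> F" "aK w w \<in> F' \<Longrightarrow> aK w w \<in> F"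
    and "\<And>w0 y. aL w0 y w \<in> F' \<Longrightarrow> aL w0 y w \<in> F" "\<And>y w'. aL w y w' \<in> F' \<Longrightarrow> aL w y w' \<in> F"
  shows "core_at F' w"
  unfolding core_at_def
proof (intro conjI allI impI)
  fix u assume "aN w u \<in> F'" "u \<noteq> w"
  then have "\<exists>k. dep F w u k" using core_at_dep[OF assms(1)] assms(5) by blast
  then show "\<exists>k. dep F' w u k" using dep_mono[OF _ assms(2)] by blast
next
  show "aN w w \<in> F' \<longleftrightarrow> aK w w \<in> F'" using core_at_brake[OF assms(1)] assms(2,5,6) by blast
next
  fix u v assume "aS w u v \<in> F'" "v \<noteq> w"
  then show "aZ w v \<notin> F'" using core_at_zero[OF assms(1)] assms(3,4) by blast
next
  fix u u' v assume "aS w u v \<in> F'" "aS w u' v \<in> F'" "v \<noteq> w"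
  then show "u' = u" using core_at_pred[OF assms(1)] assms(3) by blast
next
  fix w0 y w0' y' assume "aL w0 y w \<in> F'" "w0 \<noteq> w" "aL w0' y' w \<in> F'" "w0' \<noteq> w"
  then show "w0' = w0" "y' = y" using core_at_link[OF assms(1)] assms(7) by blast+
next
  fix y w' assume "aL w y w' \<in> F'" "w' \<noteq> w"
  then show "y \<noteq> w" using core_at_link_neq[OF assms(1)] assms(8) by blast
qed

text \<open>Frame rule for the invariant: old atoms keep their justification since depths are
  monotone, so only new atoms at \<open>w\<close> must be justified. New incoming links from other
  stages are excluded; they arise only for a freshly spawned stage, which is treated
  separately.\<close>

lemma derived_at_extend:
  assumes d: "derived_at f n F w" and sub: "F \<subseteq> F'"
    and E: "\<And>w0 u u'. aE w0 w u u' \<in> F' - F \<Longrightarrow> aK w0 w \<in> F \<and> aN w0 u \<in> F \<and> aN w u' \<in> F"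
    and E': "\<And>m0 u u'. aE (Null m0) w u u' \<in> F' - F \<Longrightarrow> u \<noteq> Null m0 \<Longrightarrow> u' \<noteq> w \<Longrightarrow>
        \<exists>k. dep F (Null m0) u k \<and> dep F w u' k"
    and X: "\<And>x. aX w x \<in> F' - F \<Longrightarrow> aN w w \<notin> F \<Longrightarrow> \<exists>w0 y. w0 \<noteq> w \<and> aL w0 y w \<in> F \<and>
        (\<forall>m0. w0 = Null m0 \<longrightarrow> (\<exists>k. dep F w0 y k \<and> dep F w x k))"
    and P: "\<And>p. aP w p \<in> F' - F \<Longrightarrow> aN w w \<notin> F \<Longrightarrow> dep F w p n"
    and G: "\<And>g xs y. aG g w xs y \<in> F' - F \<Longrightarrow> aN w w \<notin> F \<Longrightarrow>
        \<exists>ks k. list_all2 (dep F w) xs ks \<and> dep F w y k \<and> computes g ks k"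
    and L: "\<And>w0 y. aL w0 y w \<in> F' \<Longrightarrow> w0 \<noteq> w \<Longrightarrow> aL w0 y w \<in> F"
    and L': "\<And>m0 y0 y w'. aL (Null m0) y0 w \<in> F \<Longrightarrow> Null m0 \<noteq> w \<Longrightarrow> aL w y w' \<in> F' - F \<Longrightarrow> w' \<noteq> w \<Longrightarrow>
       \<exists>a b. dep F (Null m0) y0 a \<and> dep F w y b \<and> computes f [n, a, b] 0"
  shows "derived_at f n F' w"
proof -
  note mono = dep_mono[OF _ sub]
  show ?thesis
    unfolding derived_at_def
  proof (intro conjI allI impI)
    fix w0 u u' assume "aE w0 w u u' \<in> F'"
    then have "aK w0 w \<in> F \<and> aN w0 u \<in> F \<and> aN w u' \<in> F" using derived_at_eq[OF d] E by blast
    then show "aK w0 w \<in> F'" "aN w0 u \<in> F'" "aN w u' \<in> F'" using sub by blast+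
  next
    fix m0 u u' assume "aE (Null m0) w u u' \<in> F'" "u \<noteq> Null m0" "u' \<noteq> w"
    then have "\<exists>k. dep F (Null m0) u k \<and> dep F w u' k" using derived_at_eq_dep[OF d] E' by blast
    then show "\<exists>k. dep F' (Null m0) u k \<and> dep F' w u' k" using mono by blast
  next
    fix x assume "aX w x \<in> F'" "aN w w \<notin> F'"
    then obtain w0 y where "w0 \<noteq> w" "aL w0 y w \<in> F"
        "\<forall>m0. w0 = Null m0 \<longrightarrow> (\<exists>k. dep F w0 y k \<and> dep F w x k)"
      using derived_at_value[OF d] X sub by blast
    then show "\<exists>w0 y. w0 \<noteq> w \<and> aL w0 y w \<in> F' \<and>
        (\<forall>m0. w0 = Null m0 \<longrightarrow> (\<exists>k. dep F' w0 y k \<and> dep F' w x k))"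
      using mono sub by blast
  next
    fix p assume "aP w p \<in> F'" "aN w w \<notin> F'"
    then have "dep F w p n" using derived_at_param[OF d] P sub by blast
    then show "dep F' w p n" by (rule mono)
  next
    fix g xs y assume "aG g w xs y \<in> F'" "aN w w \<notin> F'"
    then obtain ks k where *: "list_all2 (dep F w) xs ks" "dep F w y k" "computes g ks k"
      using derived_at_fun[OF d] G sub by blast
    then show "\<exists>ks k. list_all2 (dep F' w) xs ks \<and> dep F' w y k \<and> computes g ks k"
      using list_all2_mono[OF *(1)] mono by blast
  next
    fix m0 y0 y1 w2 assume *: "aL (Null m0) y0 w \<in> F'" "Null m0 \<noteq> w" "aL w y1 w2 \<in> F'" "w2 \<noteq> w"
    then have L0: "aL (Null m0) y0 w \<in> F" by (intro L)
    have "\<exists>a b. dep F (Null m0) y0 a \<and> dep F w y1 b \<and> computes f [n, a, b] 0"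
      using derived_at_link[OF d L0 *(2) _ *(4)] L'[OF L0 *(2) _ *(4)] *(3) by blast
    then show "\<exists>a b. dep F' (Null m0) y0 a \<and> dep F' w y1 b \<and> computes f [n, a, b] 0" using mono by blast
  qed
qed

section \<open>Preservation of the invariant, rule by rule\<close>

lemma inv_chain_rule:
  assumes inv: "stage_inv f n F" and st: "step_by chain_rule \<tau> \<tau>' F F'"
  shows "stage_inv f n F'"
  unfolding stage_inv_def
proof
  fix m
  let ?s = "Null m"
  define w u v where "w = \<tau> 0" "u = \<tau> 1" "v = \<tau>' 2"
  note st = step_chain_rule[OF st, folded w_u_v_def]
  have core: "core_at F ?s" and der: "derived_at f n F ?s" using inv by (auto simp: stage_inv_def)
  have v: "w \<noteq> v" "u \<noteq> v" "v \<in> set ts \<Longrightarrow> Atom p ts \<notin> F" for p ts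
    using freshD[OF st(6)] st(1,4) by fastforce+
  have vs: "aS a b v \<notin> F" "aS a v b \<notin> F" "aZ a v \<notin> F" "aN a v \<notin> F" "aL a v b \<notin> F" for a b
    by (simp_all add: v(3))
  have sub: "F \<subseteq> F'" using st(7) by blast
  show "core_at F' ?s \<and> derived_at f n F' ?s"
  proof (cases "?s = w")
    case False
    have "core_at F' ?s" by (rule core_at_mono[OF core sub]) (use st(7) False in auto)
    moreover have "derived_at f n F' ?s" by (rule derived_at_extend[OF der sub]) (use st(7) False in auto)
    ultimately show ?thesis ..
  next
    case True
    \<comment> \<open>The trigger is not obsolete, so \<open>aN w w\<close> is absent, whereas
      \<open>aN w u\<close> is present. Thus \<open>u\<close> has a depth and the new number gets
      the next one.\<close>
    have uw: "u \<noteq> w" using st(4,5) by auto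
    then obtain k where "dep F w u k" using core_at_dep[OF core] st(4) True by blast
    then have k: "dep F' w v (Suc k)" using dep_mono[OF _ sub] st(7) v(1) by (blast intro: dep_suc)
    have "core_at F' w"
      unfolding core_at_def
    proof (intro conjI allI impI)
      fix a b assume "aS w a b \<in> F'" "b \<noteq> w"
      then show "aZ w b \<notin> F'" using core_at_zero[OF core] st(7) vs True by auto
    next
      fix a a' b assume "aS w a b \<in> F'" "aS w a' b \<in> F'" "b \<noteq> w"
      then show "a' = a" using core_at_pred[OF core] st(7) vs True by auto
    next
      fix a assume "aN w a \<in> F'" "a \<noteq> w"
      then have "a = v \<or> aN w a \<in> F" using st(7) by auto
      then show "\<exists>k. dep F' w a k"
        using k core_at_dep[OF core] \<open>a \<noteq> w\<close> dep_mono[OF _ sub] unfolding True by blast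
    next
      show "aN w w \<in> F' \<longleftrightarrow> aK w w \<in> F'" using core_at_brake[OF core] st(7) v(1) unfolding True by auto
    next
      fix w0 y w0' y' assume "aL w0 y w \<in> F'" "w0 \<noteq> w" "aL w0' y' w \<in> F'" "w0' \<noteq> w"
      then have "aL w0 y w \<in> F" "aL w0' y' w \<in> F" using st(7) by auto
      then show "w0' = w0" "y' = y" using core_at_link[OF core] \<open>w0 \<noteq> w\<close> \<open>w0' \<noteq> w\<close> unfolding True by blast+
    next
      fix y w' assume "aL w y w' \<in> F'" "w' \<noteq> w"
      then have "aL w y w' \<in> F" using st(7) by auto
      then show "y \<noteq> w" using core_at_link_neq[OF core] \<open>w' \<noteq> w\<close> unfolding True by blast
    qed
    moreover have "derived_at f n F' w"
      unfolding True[symmetric]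
      by (rule derived_at_extend[OF der sub]) (use st(7) True in auto)
    ultimately show ?thesis using True by simp
  qed
qed

text \<open>The two atoms arrive together, which preserves the equivalence; the clause giving
  numbers a depth exempts \<open>w\<close>, and the clauses guarded by the absence of
  \<open>aN w w\<close> lapse.\<close>

lemma inv_brake_rule:
  assumes inv: "stage_inv f n F" and F': "F' = F \<union> {aN w w, aK w w}"
  shows "stage_inv f n F'"
  unfolding stage_inv_def
proof
  fix m
  let ?s = "Null m"
  have core: "core_at F ?s" and der: "derived_at f n F ?s" using inv by (auto simp: stage_inv_def)
  have sub: "F \<subseteq> F'" using F' by blast
  have "derived_at f n F' ?s" by (rule derived_at_extend[OF der sub]) (use F' in auto)
  moreover have "core_at F' ?s"
  proof (cases "?s = w")
    case False
    show ?thesis by (rule core_at_mono[OF core sub]) (use F' False in auto)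
  next
    case True
    note d = dep_mono[OF _ sub]
    show ?thesis
      unfolding core_at_def True
    proof (intro conjI allI impI)
      fix a assume "aN w a \<in> F'" "a \<noteq> w"
      then have "aN w a \<in> F" using F' by auto
      then show "\<exists>k. dep F' w a k" using core_at_dep[OF core] d \<open>a \<noteq> w\<close> unfolding True by blast
    qed (use core_atD[OF core, unfolded True] F' in auto)
  qed
  ultimately show "core_at F' ?s \<and> derived_at f n F' ?s" by simp
qed

text \<open>The essential case is the parent \<open>w\<close> of the new link. It is not braked, so
  its graph atom is sound, and its value atom leads back along the unique incoming link to the
  number for which \<open>w\<close> was spawned. Both links together are one step of the
  descent.\<close>

lemma inv_stage_rule:
  assumes inv: "stage_inv f n F" and st: "step_by (stage_rule f) \<tau> \<tau>' F F'"
  shows "stage_inv f n F'"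
  unfolding stage_inv_def
proof
  fix m
  let ?s = "Null m"
  define w y x p z w' z' where "w = \<tau> 0" "y = \<tau> 1" "x = \<tau> 2" "p = \<tau> 3" "z = \<tau> 4" "w' = \<tau>' 5" "z' = \<tau>' 6"
  note st = step_stage_rule[OF st, folded w_y_x_p_z_w'_z'_def]
  have core: "core_at F ?s" and der: "derived_at f n F ?s" using inv by (auto simp: stage_inv_def)
  note fw = freshD[OF st(9)] and fz = freshD[OF st(10)]
  have ne: "w \<noteq> w'" "y \<noteq> w'" "w \<noteq> z'" "y \<noteq> z'"
    using fw[of "[w, w, w]" 0] fw[of "w # [p, x, y] @ [z]" "9 + to_nat f"] fz[of "[w, w, w]" 0]
      fz[of "w # [p, x, y] @ [z]" "9 + to_nat f"] st(1,7) by auto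
  have sub: "F \<subseteq> F'" using st(12) by blast
  note d = dep_mono[OF _ sub]
  show "core_at F' ?s \<and> derived_at f n F' ?s"
  proof (cases "?s = w'")
    case False
    have unp: "aN w w \<notin> F" if "?s = w"
      using core_at_brake[OF core] st(8) that by blast
    \<comment> \<open>The next value is an argument of a sound graph atom and therefore has a
      depth.\<close>
    have yw: "y \<noteq> w \<and> (\<exists>b. dep F w y b)" if s: "?s = w"
    proof -
      obtain ks k where "list_all2 (dep F w) [p, x, y] ks"
        using derived_at_fun[OF der] st(7) unp[OF s] unfolding s by blast
      then show ?thesis by (auto simp: list_all2_Cons1 dest: dep_neq)
    qed
    have "core_at F' ?s"
      unfolding core_at_def
    proof (intro conjI allI impI)
      fix a assume "aN ?s a \<in> F'" "a \<noteq> ?s"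
      then have "aN ?s a \<in> F" using st(12) False by auto
      then show "\<exists>k. dep F' ?s a k" using core_at_dep[OF core] d \<open>a \<noteq> ?s\<close> by blast
    next
      show "aN ?s ?s \<in> F' \<longleftrightarrow> aK ?s ?s \<in> F'" using core_at_brake[OF core] False st(12) by auto
    next
      fix w0 y0 w0' y0' assume "aL w0 y0 ?s \<in> F'" "w0 \<noteq> ?s" "aL w0' y0' ?s \<in> F'" "w0' \<noteq> ?s"
      then have "aL w0 y0 ?s \<in> F" "aL w0' y0' ?s \<in> F" using st(12) False by auto
      then show "w0' = w0" "y0' = y0"
        using core_at_link[OF core] \<open>w0 \<noteq> ?s\<close> \<open>w0' \<noteq> ?s\<close> by blast+
    next
      fix y0 w2 assume "aL ?s y0 w2 \<in> F'" "w2 \<noteq> ?s"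
      then have "aL ?s y0 w2 \<in> F \<or> (?s = w \<and> y0 = y)" using st(12) False by auto
      then show "y0 \<noteq> ?s" using core_at_link_neq[OF core] yw \<open>w2 \<noteq> ?s\<close> by blast
    next
      fix a b assume "aS ?s a b \<in> F'" "b \<noteq> ?s"
      then have "aS ?s a b \<in> F" using st(12) False by auto
      then have "aZ ?s b \<notin> F" using core_at_zero[OF core] \<open>b \<noteq> ?s\<close> by blast
      then show "aZ ?s b \<notin> F'" using st(12) False by auto
    next
      fix a a' b assume "aS ?s a b \<in> F'" "aS ?s a' b \<in> F'" "b \<noteq> ?s"
      then have "aS ?s a b \<in> F" "aS ?s a' b \<in> F" using st(12) False by auto
      then show "a' = a" using core_at_pred[OF core] \<open>b \<noteq> ?s\<close> by blast
    qed
    moreover have "derived_at f n F' ?s"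
    proof (rule derived_at_extend[OF der sub])
      fix m0 y0 y1 w2
      assume L0: "aL (Null m0) y0 ?s \<in> F" "Null m0 \<noteq> ?s" and L1: "aL ?s y1 w2 \<in> F' - F" "w2 \<noteq> ?s"
      then have s: "?s = w" "y1 = y" using st(12) False by auto
      note unp = unp[OF s(1)]
      obtain w0 y0' where "w0 \<noteq> w" "aL w0 y0' w \<in> F"
          "\<forall>m0. w0 = Null m0 \<longrightarrow> (\<exists>k. dep F w0 y0' k \<and> dep F w x k)"
        using derived_at_value[OF der] st(3) unp unfolding s by blast
      \<comment> \<open>The parent behind the value atom and the given null stage coincide, as
        incoming links are unique.\<close>
      moreover have "w0 = Null m0" "y0' = y0"
        using core_at_link[OF core] L0 calculation(1,2) unfolding s by blast+
      ultimately obtain a where a: "dep F (Null m0) y0 a" "dep F w x a" by blast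
      obtain ks k where k: "list_all2 (dep F w) [p, x, y] ks" "dep F w z k" "computes f ks k"
        using derived_at_fun[OF der] st(7) unp unfolding s by blast
      then obtain b where b: "ks = [dval F w p, dval F w x, b]" "dep F w y b"
        using list_all2_dval[OF core k(1)[folded s]] by (auto simp: list_all2_Cons1 s)
      have "dval F w p = n"
        using derived_at_param[OF der] st(4) unp dval_eq[OF core] unfolding s by blast
      moreover have "dval F w x = a" using dval_eq[OF core] a(2) unfolding s by blast
      \<comment> \<open>Being a number of an unbraked stage, \<open>z\<close> differs from
        \<open>w\<close>, so its zero atom gives it depth 0.\<close>
      moreover have "k = 0"
        using dval_eq[OF core] k(2) dep_zero[OF st(5)] st(6) unp unfolding s by metis
      ultimately show "\<exists>a b. dep F (Null m0) y0 a \<and> dep F ?s y1 b \<and> computes f [n, a, b] 0"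
        using a(1) b k(3) unfolding s by blast
    qed (use st(12) False in auto)
    ultimately show ?thesis ..
  next
    case True
    \<comment> \<open>The stage is fresh, so its whole content can be read off the head just
      added.\<close>
    have old: "aS w' a b \<notin> F" "aZ w' a \<notin> F" "aN w' a \<notin> F" "aK a w' \<notin> F" "aK w' a \<notin> F"
      "aL a b w' \<notin> F" "aL w' a b \<notin> F"
      "aE a w' b c \<notin> F" "aX w' a \<notin> F" "aP w' a \<notin> F" "aG g w' as a \<notin> F" for a b c g as
      by (rule fw; simp)+
    have "dep F' w' z' 0" using st(11,12) by (intro dep_zero) auto
    then have "core_at F' w'"
      using st(11,12) old ne unfolding core_at_def by auto
    moreover have "derived_at f n F' w'"
      using st(11,12) old ne unfolding derived_at_def by auto
    ultimately show ?thesis unfolding True by simp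
  qed
qed

text \<open>Predicates from 6 on are \<open>aE\<close>, \<open>aX\<close>, \<open>aP\<close> and the
  function graphs: those that influence neither depths nor links nor \<open>core_at\<close>.\<close>

lemma derived_at_insert:
  assumes d: "derived_at f n F w" and p: "6 \<le> pred a"
    and E: "\<And>w0 u u'. a = aE w0 w u u' \<Longrightarrow> aK w0 w \<in> F \<and> aN w0 u \<in> F \<and> aN w u' \<in> F"
    and E': "\<And>m0 u u'. a = aE (Null m0) w u u' \<Longrightarrow> u \<noteq> Null m0 \<Longrightarrow> u' \<noteq> w \<Longrightarrow>
        \<exists>k. dep F (Null m0) u k \<and> dep F w u' k"
    and X: "\<And>x. a = aX w x \<Longrightarrow> aN w w \<notin> F \<Longrightarrow> \<exists>w0 y. w0 \<noteq> w \<and> aL w0 y w \<in> F \<and>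
        (\<forall>m0. w0 = Null m0 \<longrightarrow> (\<exists>k. dep F w0 y k \<and> dep F w x k))"
    and P: "\<And>p. a = aP w p \<Longrightarrow> aN w w \<notin> F \<Longrightarrow> dep F w p n"
    and G: "\<And>g xs y. a = aG g w xs y \<Longrightarrow> aN w w \<notin> F \<Longrightarrow>
        \<exists>ks k. list_all2 (dep F w) xs ks \<and> dep F w y k \<and> computes g ks k"
  shows "derived_at f n (insert a F) w"
  apply (rule derived_at_extend[OF d])
  subgoal by blast
  subgoal by (rule E) auto
  subgoal by (rule E') auto
  subgoal by (rule X) auto
  subgoal by (rule P) auto
  subgoal by (rule G) auto
  subgoal using p by auto
  subgoal using p by auto
  done

lemma core_at_insert: "core_at F w \<Longrightarrow> 6 \<le> pred a \<Longrightarrow> core_at (insert a F) w"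
  by (rule core_at_mono) auto

text \<open>The brake makes \<open>w\<close> a number but never the predecessor of another one:
  \<open>v\<close> has a depth, hence a predecessor with a depth, and predecessors are unique. This
  keeps \<open>eq_suc_rule\<close> sound on braked stages.\<close>

lemma core_at_dep_pred:
  assumes core: "core_at F w" and "aN w v \<in> F" "aS w u v \<in> F" "v \<noteq> w"
  shows "\<exists>k. dep F w u k"
proof -
  obtain k where "dep F w v k" using core_at_dep[OF core] assms by blast
  then show ?thesis
  proof cases
    case dep_zero
    then show ?thesis using core_at_zero[OF core assms(3)] by blast
  next
    case (dep_suc u' k')
    then show ?thesis using core_at_pred[OF core assms(3)] by blast
  qed
qed

lemma inv_eq_zero_rule:
  assumes inv: "stage_inv f n F" and l: "ld eq_zero_rule \<tau> F"
  shows "stage_inv f n (insert (aE (\<tau> 0) (\<tau> 1) (\<tau> 2) (\<tau> 3)) F)"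
  unfolding stage_inv_def
proof (intro allI conjI core_at_insert derived_at_insert)
  fix m
  show "core_at F (Null m)" "derived_at f n F (Null m)" using inv by (auto simp: stage_inv_def)
  have *: "aK (\<tau> 0) (\<tau> 1) \<in> F" "aZ (\<tau> 0) (\<tau> 2) \<in> F" "aN (\<tau> 0) (\<tau> 2) \<in> F" "aZ (\<tau> 1) (\<tau> 3) \<in> F"
    "aN (\<tau> 1) (\<tau> 3) \<in> F"
    using l by (auto simp: ld_def eq_zero_rule_def)
  show "\<exists>k. dep F (Null m0) u k \<and> dep F (Null m) u' k"
    if "aE (\<tau> 0) (\<tau> 1) (\<tau> 2) (\<tau> 3) = aE (Null m0) (Null m) u u'" "u \<noteq> Null m0" "u' \<noteq> Null m" for m0 u u'
    using that * by (auto intro!: exI[of _ 0] dep_zero)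
  show "aK w0 (Null m) \<in> F" "aN w0 u \<in> F" "aN (Null m) u' \<in> F"
    if "aE (\<tau> 0) (\<tau> 1) (\<tau> 2) (\<tau> 3) = aE w0 (Null m) u u'" for w0 u u'
    using that * by auto
qed simp_all

lemma inv_eq_suc_rule:
  assumes inv: "stage_inv f n F" and l: "ld eq_suc_rule \<tau> F"
  shows "stage_inv f n (insert (aE (\<tau> 0) (\<tau> 1) (\<tau> 4) (\<tau> 5)) F)"
  unfolding stage_inv_def
proof (intro allI conjI core_at_insert derived_at_insert)
  fix m
  have core: "core_at F (Null m)" and der: "derived_at f n F (Null m)" for m
    using inv by (auto simp: stage_inv_def)
  then show "core_at F (Null m)" "derived_at f n F (Null m)" by auto
  have *: "aE (\<tau> 0) (\<tau> 1) (\<tau> 2) (\<tau> 3) \<in> F" "aS (\<tau> 0) (\<tau> 2) (\<tau> 4) \<in> F" "aN (\<tau> 0) (\<tau> 4) \<in> F"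
    "aS (\<tau> 1) (\<tau> 3) (\<tau> 5) \<in> F" "aN (\<tau> 1) (\<tau> 5) \<in> F"
    using l by (auto simp: ld_def eq_suc_rule_def)
  show "\<exists>k. dep F (Null m0) u k \<and> dep F (Null m) u' k"
    if "aE (\<tau> 0) (\<tau> 1) (\<tau> 4) (\<tau> 5) = aE (Null m0) (Null m) u u'" "u \<noteq> Null m0" "u' \<noteq> Null m" for m0 u u'
  proof -
    have e: "\<tau> 0 = Null m0" "\<tau> 1 = Null m" "\<tau> 4 = u" "\<tau> 5 = u'" using that by auto
    have "\<tau> 2 \<noteq> Null m0" "\<tau> 3 \<noteq> Null m"
      using core_at_dep_pred[OF core[of m0], of u "\<tau> 2"] core_at_dep_pred[OF core[of m], of u' "\<tau> 3"]
        * that(2,3) unfolding e by (blast dest: dep_neq)+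
    then obtain k where "dep F (Null m0) (\<tau> 2) k" "dep F (Null m) (\<tau> 3) k"
      using derived_at_eq_dep[OF der] *(1) unfolding e by blast
    then have "dep F (Null m0) u (Suc k)" "dep F (Null m) u' (Suc k)"
      using * that(2,3) unfolding e by (blast intro: dep_suc)+
    then show ?thesis by blast
  qed
  show "aK w0 (Null m) \<in> F" "aN w0 u \<in> F" "aN (Null m) u' \<in> F"
    if "aE (\<tau> 0) (\<tau> 1) (\<tau> 4) (\<tau> 5) = aE w0 (Null m) u u'" for w0 u u'
    using that * derived_at_eq[OF der[of m], of "\<tau> 0" "\<tau> 2" "\<tau> 3"] by auto
qed simp_all

text \<open>An equality atom brings along \<open>aK\<close> and \<open>aN\<close>, so an unbraked
  child excludes the degenerate cases in which the parent is the child or the copied number is the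
  child.\<close>

lemma inv_value_rule:
  assumes inv: "stage_inv f n F" and l: "ld value_rule \<tau> F"
  shows "stage_inv f n (insert (aX (\<tau> 1) (\<tau> 3)) F)"
  unfolding stage_inv_def
proof (intro allI conjI core_at_insert derived_at_insert)
  fix m
  have core: "core_at F (Null m)" and der: "derived_at f n F (Null m)" for m
    using inv by (auto simp: stage_inv_def)
  then show "core_at F (Null m)" "derived_at f n F (Null m)" by auto
  have *: "aL (\<tau> 0) (\<tau> 2) (\<tau> 1) \<in> F" "aE (\<tau> 0) (\<tau> 1) (\<tau> 2) (\<tau> 3) \<in> F"
    using l by (auto simp: ld_def value_rule_def)
  show "\<exists>w0 y. w0 \<noteq> Null m \<and> aL w0 y (Null m) \<in> F \<and>
        (\<forall>m0. w0 = Null m0 \<longrightarrow> (\<exists>k. dep F w0 y k \<and> dep F (Null m) x k))"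
    if "aX (\<tau> 1) (\<tau> 3) = aX (Null m) x" "aN (Null m) (Null m) \<notin> F" for x
  proof -
    have e: "\<tau> 1 = Null m" "\<tau> 3 = x" using that by auto
    have K: "aK (\<tau> 0) (Null m) \<in> F" "aN (Null m) x \<in> F" using derived_at_eq[OF der] *(2) unfolding e by blast+
    then have 0: "\<tau> 0 \<noteq> Null m" "x \<noteq> Null m" using core_at_brake[OF core] that(2) by auto
    moreover have "\<exists>k. dep F (\<tau> 0) (\<tau> 2) k \<and> dep F (Null m) x k" if "\<tau> 0 = Null m0" for m0
    proof -
      \<comment> \<open>The parent may have been braked meanwhile; that the transmitted number is
        not the parent itself was recorded when the link was created.\<close>
      have "\<tau> 2 \<noteq> \<tau> 0" using core_at_link_neq[OF core] *(1) that 0 unfolding e by metis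
      then show ?thesis using derived_at_eq_dep[OF der] *(2) that 0 unfolding e by metis
    qed
    ultimately show ?thesis using *(1) unfolding e by blast
  qed
qed simp_all

lemma param_body_dep:
  assumes "\<forall>a\<in>set (param_body n). inst \<tau> a \<in> F" "aN (\<tau> 0) (\<tau> 0) \<notin> F"
  shows "dep F (\<tau> 0) (\<tau> (Suc n)) n"
  using assms(1)
proof (induction n)
  case 0
  then show ?case using assms(2) by (auto intro!: dep_zero)
next
  case (Suc n)
  then show ?case using assms(2) by (auto intro!: dep_suc[of F "\<tau> 0" "\<tau> (Suc n)"])
qed

lemma inv_param_rule:
  assumes inv: "stage_inv f n F" and l: "ld (param_rule n) \<tau> F"
  shows "stage_inv f n (insert (aP (\<tau> 0) (\<tau> (Suc n))) F)"
  unfolding stage_inv_def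
proof (intro allI conjI core_at_insert derived_at_insert)
  fix m
  show "core_at F (Null m)" "derived_at f n F (Null m)" using inv by (auto simp: stage_inv_def)
  show "dep F (Null m) p n" if "aP (\<tau> 0) (\<tau> (Suc n)) = aP (Null m) p" "aN (Null m) (Null m) \<notin> F" for p
    using that l param_body_dep[of n \<tau> F] by (auto simp: ld_def param_rule_def)
qed simp_all

lemma inv_fun_rules:
  assumes inv: "stage_inv f n F" and R: "R \<in> set (fun_rules g k)" and l: "ld R \<tau> F"
  shows "stage_inv f n (F \<union> inst \<tau> ` set (head R))"
proof -
  obtain xs y where h: "inst \<tau> ` set (head R) = {aG g (\<tau> 0) xs y}" using fun_rules_head[OF R] by blast
  show ?thesis
    unfolding h Un_insert_right Un_empty_right stage_inv_def
  proof (intro allI conjI core_at_insert derived_at_insert)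
    fix m
    show core: "core_at F (Null m)" and der: "derived_at f n F (Null m)" using inv by (auto simp: stage_inv_def)
    show "\<exists>ks k. list_all2 (dep F (Null m)) as ks \<and> dep F (Null m) a k \<and> computes g' ks k"
      if *: "aG g (\<tau> 0) xs y = aG g' (Null m) as a" and u: "aN (Null m) (Null m) \<notin> F" for g' as a
    proof -
      have e: "\<tau> 0 = Null m" "g' = g" "as = xs" "a = y" using * by auto
      have "sound_at F (Null m) g xs y" if "aG g (Null m) xs y \<in> F" for g xs y
        using derived_at_fun[OF der that u] sound_atI[OF core] by blast
      then obtain xs' y' where "inst \<tau> ` set (head R) = {aG g (Null m) xs' y'}" "sound_at F (Null m) g xs' y'"
        using fun_rules_sound[OF R l core e(1)[symmetric] u] by blast
      then have "sound_at F (Null m) g xs y" using h e(1) by auto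
      then show ?thesis unfolding e by (rule sound_atD)
    qed
  qed simp_all
qed

lemma inv_step:
  assumes inv: "stage_inv f n F" and R: "R \<in> set (red_rules f n)" and st: "step_by R \<tau> \<tau>' F F'"
  shows "stage_inv f n F'"
proof -
  have l: "ld R \<tau> F" using st by (simp add: step_by_def)
  consider "R = chain_rule" | "R = stage_rule f" | "R = brake_rule" | "R = eq_zero_rule" | "R = eq_suc_rule"
    | "R = value_rule" | "R = param_rule n" | g k where "R \<in> set (fun_rules g k)"
    using R by (auto simp: red_rules_def fixed_rules_def dest!: all_fun_rules_fun_rules)
  then show ?thesis
  proof cases
    case 1
    then show ?thesis using inv st inv_chain_rule by blast
  next
    case 2
    then show ?thesis using inv st inv_stage_rule by blast
  next
    case 3
    then have "F' = F \<union> {aN (\<tau> 0) (\<tau> 0), aK (\<tau> 0) (\<tau> 0)}"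
      using step_by_datalog[OF eq_rules_datalog(4)] st by (simp add: brake_rule_def)
    then show ?thesis using inv inv_brake_rule by blast
  next
    case 4
    then have "F' = insert (aE (\<tau> 0) (\<tau> 1) (\<tau> 2) (\<tau> 3)) F"
      using step_by_datalog[OF eq_rules_datalog(1)] st by (simp add: eq_zero_rule_def)
    then show ?thesis using inv_eq_zero_rule[OF inv] l 4 by simp
  next
    case 5
    then have "F' = insert (aE (\<tau> 0) (\<tau> 1) (\<tau> 4) (\<tau> 5)) F"
      using step_by_datalog[OF eq_rules_datalog(2)] st by (simp add: eq_suc_rule_def)
    then show ?thesis using inv_eq_suc_rule[OF inv] l 5 by simp
  next
    case 6
    then have "F' = insert (aX (\<tau> 1) (\<tau> 3)) F"
      using step_by_datalog[OF eq_rules_datalog(3)] st by (simp add: value_rule_def)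
    then show ?thesis using inv_value_rule[OF inv] l 6 by simp
  next
    case 7
    then have "F' = insert (aP (\<tau> 0) (\<tau> (Suc n))) F"
      using step_by_datalog[OF param_rule_datalog] st by (simp add: param_rule_def)
    then show ?thesis using inv_param_rule[OF inv] l 7 by simp
  next
    case 8
    then have "F' = F \<union> inst \<tau> ` set (head R)"
      using step_by_datalog[OF fun_rules_datalog] st by blast
    then show ?thesis using inv_fun_rules[OF inv 8 l] by simp
  qed
qed

section \<open>Infinite chase sequences yield infinite descents\<close>

lemma step_by_strict: "step_by R \<tau> \<tau>' F F' \<Longrightarrow> F \<subset> F'"
  unfolding step_by_def ob_def fresh_ext_def by blast

text \<open>Without existential variables no new terms arise, so all facts lie in the finite set of
  atoms over the initial terms and the terms of the heads; but every step adds a fact.\<close>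

lemma datalog_terminates:
  assumes "finite \<Sigma>" "finite (G 0)"
    and st: "\<And>i. \<exists>R\<in>\<Sigma>. datalog R \<and> (\<exists>\<tau> \<tau>'. step_by R \<tau> \<tau>' (G i) (G (Suc i)))"
  shows False
proof -
  define H where "H = (\<Union>R\<in>\<Sigma>. set (head R))"
  define T where "T = (\<Union>a\<in>G 0 \<union> H. set (args a))"
  define B where "B = G 0 \<union> (\<Union>a\<in>H. Atom (pred a) ` {ts. set ts \<subseteq> T \<and> length ts = length (args a)})"
  have "finite H" using assms(1) by (simp add: H_def)
  then have "finite T" using assms(2) by (simp add: T_def)
  then have B: "finite B" using \<open>finite H\<close> assms(2) by (simp add: B_def finite_lists_length_eq)
  have BT: "set (args a) \<subseteq> T" if "a \<in> B" for a
    using that by (auto simp: B_def T_def)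
  have GB: "G i \<subseteq> B" for i
  proof (induction i)
    case 0
    show ?case by (simp add: B_def)
  next
    case (Suc i)
    obtain R \<tau> \<tau>' where R: "R \<in> \<Sigma>" "datalog R" "step_by R \<tau> \<tau>' (G i) (G (Suc i))" using st by blast
    have "inst \<tau> a \<in> B" if a: "a \<in> set (head R)" for a
    proof -
      have aH: "a \<in> H" using R(1) a by (auto simp: H_def)
      have "inst_tm \<tau> t \<in> T" if t: "t \<in> set (args a)" for t
      proof (cases t)
        case (Var v)
        then have "v \<in> univ_vars R" using R(2) a t by (auto simp: datalog_def exist_vars_def atom_vars_def)
        then obtain b where b: "b \<in> set (body R)" "Var v \<in> set (args b)"
          by (auto simp: univ_vars_def atom_vars_def)
        then have "inst \<tau> b \<in> B" using Suc R(3) by (auto simp: step_by_def ld_def)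
        moreover have "\<tau> v \<in> set (args (inst \<tau> b))" using b(2) by (force simp: inst_def)
        ultimately show ?thesis using BT Var by auto
      qed (use t aH in \<open>auto simp: T_def\<close>)
      then have "inst \<tau> a \<in> Atom (pred a) ` {ts. set ts \<subseteq> T \<and> length ts = length (args a)}"
        unfolding inst_def by (intro imageI) auto
      then show ?thesis using aH unfolding B_def by blast
    qed
    then show ?case using Suc step_by_datalog[OF R(2,3)] by auto
  qed
  have "i \<le> card (G i)" for i
  proof (induction i)
    case (Suc i)
    have "G i \<subset> G (Suc i)" using st step_by_strict by blast
    then have "card (G i) < card (G (Suc i))" using finite_subset[OF GB B] by (intro psubset_card_mono)
    then show ?case using Suc by simp
  qed simp
  moreover have "card (G i) \<le> card B" for i using card_mono[OF B GB] .
  ultimately have "Suc (card B) \<le> card B" by (meson le_trans)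
  then show False by simp
qed

lemma red_rules_datalog:
  assumes "R \<in> set (red_rules f n)" "R \<noteq> chain_rule" "R \<noteq> stage_rule f"
  shows "datalog R" "aS x y z \<notin> inst \<tau> ` set (head R)"
proof -
  consider "R = brake_rule" | "R = eq_zero_rule" | "R = eq_suc_rule"
    | "R = value_rule" | "R = param_rule n" | g k where "R \<in> set (fun_rules g k)"
    using assms by (auto simp: red_rules_def fixed_rules_def dest!: all_fun_rules_fun_rules)
  then have "datalog R \<and> aS x y z \<notin> inst \<tau> ` set (head R)"
  proof cases
    case (6 g k)
    obtain xs y' where "inst \<tau> ` set (head R) = {aG g (\<tau> 0) xs y'}" using fun_rules_head[OF 6] by blast
    then show ?thesis using fun_rules_datalog[OF 6] by simp
  qed (use eq_rules_datalog param_rule_datalog in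
      \<open>auto simp: brake_rule_def eq_zero_rule_def eq_suc_rule_def value_rule_def param_rule_def\<close>)
  then show "datalog R" "aS x y z \<notin> inst \<tau> ` set (head R)" by auto
qed

section \<open>The spawning forest of an infinite fair chase\<close>

locale red_chase =
  fixes f :: recf and n :: nat and F :: "nat \<Rightarrow> atom set" and R :: "nat \<Rightarrow> rule"
    and \<tau> \<tau>' :: "nat \<Rightarrow> nat \<Rightarrow> tm"
  assumes db: "database (F 0)"
    and R: "R i \<in> set (red_rules f n)"
    and st: "step_by (R i) (\<tau> i) (\<tau>' i) (F i) (F (Suc i))"
    and fair: "\<And>r t. r \<in> set (red_rules f n) \<Longrightarrow> ld r t (F i) \<Longrightarrow> \<exists>j\<ge>i. ob r t (F j)"
begin

lemma inv: "stage_inv f n (F i)"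
  by (induction i) (use db inv_database inv_step R st in blast)+

lemma F_mono: "i \<le> j \<Longrightarrow> F i \<subseteq> F j"
  by (rule lift_Suc_mono_le) (use st in \<open>auto simp: step_by_def\<close>)

lemma finite_F: "finite (F i)"
  by (induction i) (use db st in \<open>auto simp: database_def step_by_def\<close>)

text \<open>The edges of the forest: step \<open>i\<close> in \<open>E\<close> spawns stage
  \<open>\<tau>' i 5\<close> from stage \<open>\<tau> i 0\<close>.\<close>

definition E :: "nat set" where "E = {i. R i = stage_rule f}"

definition C :: "nat set" where "C = {i. R i = chain_rule}"

lemma CE_stage: "i \<in> C \<union> E \<Longrightarrow> aS (\<tau> i 0) (\<tau> i 0) (\<tau> i 0) \<in> F i"
  using step_chain_rule(1) step_stage_rule(1) st[of i] by (auto simp: C_def E_def)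

text \<open>This is where fairness enters. The brake trigger is loaded once the stage acts, and from
  the moment it is obsolete no existential rule is applicable at that stage.\<close>

lemma finite_active: "finite {i \<in> C \<union> E. \<tau> i 0 = w}"
proof (cases "{i \<in> C \<union> E. \<tau> i 0 = w} = {}")
  case False
  then obtain i where "i \<in> C \<union> E" "\<tau> i 0 = w" by auto
  then have "ld brake_rule (\<lambda>_. w) (F i)" using CE_stage[of i] by (simp add: ld_def brake_rule_def)
  then obtain j where "ob brake_rule (\<lambda>_. w) (F j)"
    using fair[of brake_rule] by (auto simp: red_rules_def fixed_rules_def)
  then have j: "aN w w \<in> F j" "aK w w \<in> F j"
    unfolding ob_datalog[OF eq_rules_datalog(4)] by (auto simp: brake_rule_def)
  have "i' < j" if "i' \<in> C \<union> E" "\<tau> i' 0 = w" for i'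
  proof (rule ccontr)
    assume "\<not> i' < j"
    then have "aN w w \<in> F i'" "aK w w \<in> F i'" using j F_mono[of j i'] by auto
    then show False
      using step_chain_rule(5)[of "\<tau> i'" "\<tau>' i'"] step_stage_rule(8)[of f "\<tau> i'" "\<tau>' i'"] st[of i'] that
      by (auto simp: C_def E_def)
  qed
  then have "{i \<in> C \<union> E. \<tau> i 0 = w} \<subseteq> {..<j}" by auto
  then show ?thesis by (rule finite_subset) simp
next
  case True
  then show ?thesis by (simp only: finite.emptyI)
qed

text \<open>A self-loop \<open>aS w w w\<close> can only stem from the database or from a spawn: the
  number created by the chain rule is fresh and hence differs from its stage.\<close>

lemma stage_origin:
  "aS w w w \<in> F i \<Longrightarrow> aS w w w \<in> F 0 \<or> (\<exists>j\<in>E. j < i \<and> w = \<tau>' j 5)"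
proof (induction i)
  case (Suc i)
  show ?case
  proof (cases "aS w w w \<in> F i")
    case True
    then show ?thesis using Suc.IH less_SucI by blast
  next
    case False
    consider "i \<in> C" | "i \<in> E" | "R i \<noteq> chain_rule" "R i \<noteq> stage_rule f" by (auto simp: C_def E_def)
    then show ?thesis
    proof cases
      case 1
      then have s: "step_by chain_rule (\<tau> i) (\<tau>' i) (F i) (F (Suc i))" using st[of i] by (simp add: C_def)
      have "\<tau>' i 2 \<noteq> \<tau> i 0" using freshD[OF step_chain_rule(6)[OF s]] step_chain_rule(1)[OF s] by fastforce
      then show ?thesis using Suc.prems False step_chain_rule(7)[OF s] by auto
    next
      case 2
      then have s: "step_by (stage_rule f) (\<tau> i) (\<tau>' i) (F i) (F (Suc i))" using st[of i] by (simp add: E_def)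
      have "w = \<tau>' i 5" using Suc.prems False step_stage_rule(11,12)[OF s] by auto
      then show ?thesis using 2 by blast
    next
      case 3
      then show ?thesis
        using step_by_datalog[OF red_rules_datalog(1)[OF R 3] st] red_rules_datalog(2)[OF R 3] Suc.prems False
        by auto
    qed
  qed
qed simp

text \<open>With finitely many spawns there would be finitely many stages, each acting finitely
  often, and from some point on the chase would use Datalog rules only.\<close>

lemma infinite_E: "infinite E"
proof
  assume fin: "finite E"
  define W where "W = {w. aS w w w \<in> F 0} \<union> (\<lambda>j. \<tau>' j 5) ` E"
  have "{w. aS w w w \<in> F 0} \<subseteq> (\<Union>a\<in>F 0. set (args a))" by force
  then have "finite {w. aS w w w \<in> F 0}" using finite_F by (auto intro: finite_subset)
  then have "finite W" using fin by (simp add: W_def)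
  moreover have "C \<union> E \<subseteq> (\<Union>w\<in>W. {i \<in> C \<union> E. \<tau> i 0 = w})"
    using CE_stage stage_origin by (fastforce simp: W_def)
  ultimately have "finite (C \<union> E)" using finite_active by (meson finite_UN_I finite_subset)
  then obtain i0 where i0: "\<And>i. i \<in> C \<union> E \<Longrightarrow> i < i0" by (meson finite_nat_set_iff_bounded)
  show False
  proof (rule datalog_terminates[of "set (red_rules f n)" "\<lambda>i. F (i0 + i)"])
    fix i
    have "R (i0 + i) \<noteq> chain_rule" "R (i0 + i) \<noteq> stage_rule f" using i0[of "i0 + i"] by (auto simp: C_def E_def)
    then have "datalog (R (i0 + i))" by (rule red_rules_datalog[OF R])
    then show "\<exists>R\<in>set (red_rules f n). datalog R \<and>
        (\<exists>\<tau> \<tau>'. step_by R \<tau> \<tau>' (F (i0 + i)) (F (i0 + Suc i)))"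
      using R[of "i0 + i"] st[of "i0 + i"] by auto
  qed (use finite_F in auto)
qed

inductive_set desc :: "tm \<Rightarrow> nat set" for w where
  "i \<in> E \<Longrightarrow> \<tau> i 0 = w \<Longrightarrow> i \<in> desc w"
| "j \<in> desc w \<Longrightarrow> i \<in> E \<Longrightarrow> \<tau> i 0 = \<tau>' j 5 \<Longrightarrow> i \<in> desc w"

lemma E_desc: "i \<in> E \<Longrightarrow> \<exists>w. aS w w w \<in> F 0 \<and> i \<in> desc w"
proof (induction i rule: less_induct)
  case (less i)
  have "aS (\<tau> i 0) (\<tau> i 0) (\<tau> i 0) \<in> F i" using CE_stage less.prems by blast
  from stage_origin[OF this] show ?case
  proof
    assume "aS (\<tau> i 0) (\<tau> i 0) (\<tau> i 0) \<in> F 0"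
    then show ?thesis using less.prems desc.intros(1) by blast
  next
    assume "\<exists>j\<in>E. j < i \<and> \<tau> i 0 = \<tau>' j 5"
    then show ?thesis using less desc.intros(2) by blast
  qed
qed

lemma desc_split: "i \<in> desc w \<Longrightarrow> i \<in> {i \<in> E. \<tau> i 0 = w} \<union> (\<Union>j\<in>{i \<in> E. \<tau> i 0 = w}. desc (\<tau>' j 5))"
  by (induction rule: desc.induct) (auto intro: desc.intros)

text \<open>The step of Koenig's lemma; branching is finite because every stage acts finitely
  often.\<close>

lemma desc_child:
  assumes "infinite (desc w)"
  shows "\<exists>j\<in>E. \<tau> j 0 = w \<and> infinite (desc (\<tau>' j 5))"
proof (rule ccontr)
  assume "\<not> ?thesis"
  moreover have "finite {i \<in> E. \<tau> i 0 = w}" by (rule finite_subset[OF _ finite_active[of w]]) auto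
  ultimately have "finite ({i \<in> E. \<tau> i 0 = w} \<union> (\<Union>j\<in>{i \<in> E. \<tau> i 0 = w}. desc (\<tau>' j 5)))" by auto
  then show False using assms desc_split by (meson finite_subset subsetI)
qed

lemma infinite_path:
  "\<exists>p. \<forall>k. p k \<in> E \<and> \<tau> (p (Suc k)) 0 = \<tau>' (p k) 5"
proof -
  have "\<exists>w. aS w w w \<in> F 0 \<and> infinite (desc w)"
  proof (rule ccontr)
    assume *: "\<not> ?thesis"
    have "{w. aS w w w \<in> F 0} \<subseteq> (\<Union>a\<in>F 0. set (args a))" by force
    then have "finite {w. aS w w w \<in> F 0}" using finite_F by (auto intro: finite_subset)
    then have "finite (\<Union>w\<in>{w. aS w w w \<in> F 0}. desc w)" using * by auto
    moreover have "E \<subseteq> (\<Union>w\<in>{w. aS w w w \<in> F 0}. desc w)" using E_desc by blast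
    ultimately show False using infinite_E finite_subset by blast
  qed
  then obtain w where "infinite (desc w)" by blast
  then obtain j0 where j0: "j0 \<in> E" "infinite (desc (\<tau>' j0 5))" using desc_child by blast
  have "\<exists>p. \<forall>k. (p k \<in> E \<and> infinite (desc (\<tau>' (p k) 5))) \<and> \<tau> (p (Suc k)) 0 = \<tau>' (p k) 5"
    by (rule dependent_nat_choice) (use j0 desc_child in blast)+
  then show ?thesis by blast
qed

text \<open>All stages of the path but the first are nulls, and the link clause asks for two
  consecutive null stages. So the descent begins with the number that \<open>w 1\<close> passes on;
  the value atom of \<open>w 1\<close>, which may rest on junk in a database stage, is never
  consulted.\<close>

lemma infinite_descent: "\<exists>s. \<forall>k. computes f [n, s k, s (Suc k)] 0"
proof -
  obtain p where p: "p k \<in> E" "\<tau> (p (Suc k)) 0 = \<tau>' (p k) 5" for k using infinite_path by blast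
  define w y where "w k = \<tau> (p k) 0" and "y k = \<tau> (p k) 1" for k
  have s: "step_by (stage_rule f) (\<tau> (p k)) (\<tau>' (p k)) (F (p k)) (F (Suc (p k)))" for k
    using p(1)[of k] st[of "p k"] by (simp add: E_def)
  have L: "aL (w k) (y k) (w (Suc k)) \<in> F (Suc (p k))" for k
    using step_stage_rule(12)[OF s[of k]] by (simp add: w_def y_def p(2))
  have null: "\<exists>m. w (Suc k) = Null m" for k
    using step_stage_rule(9)[OF s[of k]] by (simp add: w_def p(2) fresh_def)
  have ne: "w (Suc k) \<noteq> w k" for k
    using freshD[OF step_stage_rule(9)[OF s[of k]]] step_stage_rule(1)[OF s[of k]] by (fastforce simp: w_def p(2))
  have uniq: "a = b" if "dep (F i) (w (Suc k)) u a" "dep (F j) (w (Suc k)) u b" for i j k u a b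
  proof -
    have "core_at (F (max i j)) (w (Suc k))" using inv[of "max i j"] null[of k] by (auto simp: stage_inv_def)
    moreover have "dep (F (max i j)) (w (Suc k)) u a" "dep (F (max i j)) (w (Suc k)) u b"
      by (rule dep_mono[OF that(1)] dep_mono[OF that(2)], simp add: F_mono)+
    ultimately show ?thesis using core_at_dep_unique by blast
  qed
  have link: "\<exists>i a b. dep (F i) (w (Suc k)) (y (Suc k)) a \<and> dep (F i) (w (Suc (Suc k))) (y (Suc (Suc k))) b
      \<and> computes f [n, a, b] 0" for k
  proof -
    define i where "i = max (Suc (p (Suc k))) (Suc (p (Suc (Suc k))))"
    have "F (Suc (p (Suc k))) \<subseteq> F i" "F (Suc (p (Suc (Suc k)))) \<subseteq> F i" by (simp_all add: F_mono i_def)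
    then have *: "aL (w (Suc k)) (y (Suc k)) (w (Suc (Suc k))) \<in> F i"
      "aL (w (Suc (Suc k))) (y (Suc (Suc k))) (w (Suc (Suc (Suc k)))) \<in> F i"
      using L by blast+
    have "derived_at f n (F i) (w (Suc (Suc k)))" using inv[of i] null[of "Suc k"] by (auto simp: stage_inv_def)
    moreover obtain m where "w (Suc k) = Null m" using null by blast
    ultimately show ?thesis using derived_at_link[of f n "F i" "w (Suc (Suc k))"] * ne by metis
  qed
  \<comment> \<open>A depth observed at some time; by \<open>uniq\<close> it is the same at all
    times.\<close>
  define s where "s k = (SOME a. \<exists>i. dep (F i) (w (Suc k)) (y (Suc k)) a)" for k
  have s: "s k = a" if "dep (F i) (w (Suc k)) (y (Suc k)) a" for k i a
  proof -
    have "\<exists>i. dep (F i) (w (Suc k)) (y (Suc k)) (s k)" unfolding s_def by (rule someI) (use that in blast)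
    then show ?thesis using uniq that by blast
  qed
  have "computes f [n, s k, s (Suc k)] 0" for k
    using link[of k] s by auto
  then show ?thesis by blast
qed

end

lemma inf_chase_descent:
  assumes "inf_chase (set (red_rules f n)) F"
  shows "\<exists>s. \<forall>k. computes f [n, s k, s (Suc k)] 0"
proof -
  have "\<forall>i. \<exists>(R, \<tau>, \<tau>')\<in>set (red_rules f n) \<times> UNIV \<times> UNIV. step_by R \<tau> \<tau>' (F i) (F (Suc i))"
    using assms by (fastforce simp: inf_chase_def step_def)
  then obtain q where q: "\<And>i. case q i of (R, \<tau>, \<tau>') \<Rightarrow> R \<in> set (red_rules f n) \<and> step_by R \<tau> \<tau>' (F i) (F (Suc i))"
    by (atomize_elim, intro choice) fastforce
  interpret red_chase f n F "\<lambda>i. fst (q i)" "\<lambda>i. fst (snd (q i))" "\<lambda>i. snd (snd (q i))"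
    using assms q by unfold_locales (auto simp: inf_chase_def case_prod_beta)
  show ?thesis by (rule infinite_descent)
qed

section \<open>Infinite descents yield infinite chase sequences\<close>

fun no_mu :: "recf \<Rightarrow> bool" where
  "no_mu (Comp f gs) \<longleftrightarrow> no_mu f \<and> (\<forall>g\<in>set gs. no_mu g)"
| "no_mu (PrimRec f g) \<longleftrightarrow> no_mu f \<and> no_mu g"
| "no_mu (Mu f) \<longleftrightarrow> False"
| "no_mu _ \<longleftrightarrow> True"

lemma finite_nulls: "finite F \<Longrightarrow> finite (nulls F)"
proof -
  have "finite (atom_nulls a)" for a
  proof -
    have "Null ` atom_nulls a \<subseteq> set (args a)" by (auto simp: atom_nulls_def)
    then show ?thesis by (metis List.finite_set finite_imageD finite_subset inj_onI tm.inject(3))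
  qed
  then show "finite F \<Longrightarrow> finite (nulls F)" by (simp add: nulls_def)
qed

lemma ex_fresh_ext: "finite F \<Longrightarrow> \<exists>\<tau>'. fresh_ext R \<tau> F \<tau>'"
proof -
  assume "finite F"
  then obtain N where N: "\<And>m. m \<in> nulls F \<Longrightarrow> m < N" using finite_nulls by (meson finite_nat_set_iff_bounded)
  define \<tau>' where "\<tau>' v = (if v \<in> exist_vars R then Null (N + v) else \<tau> v)" for v
  have "fresh_ext R \<tau> F \<tau>'"
    using N by (fastforce simp: fresh_ext_def agree_def \<tau>'_def inj_on_def exist_vars_def)
  then show ?thesis by blast
qed

section \<open>Finite chase segments that spare a given stage\<close>

lemma ld_mono: "ld R \<tau> F \<Longrightarrow> F \<subseteq> F' \<Longrightarrow> ld R \<tau> F'"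
  by (auto simp: ld_def)

lemma apply_trigger:
  assumes "finite F" "ld R \<tau> F" "\<not> ob R \<tau> F"
  shows "\<exists>\<tau>' F'. step_by R \<tau> \<tau>' F F' \<and> ob R \<tau> F' \<and> finite F' \<and> F \<subseteq> F'"
proof -
  obtain \<tau>' where \<tau>': "fresh_ext R \<tau> F \<tau>'" using ex_fresh_ext[OF assms(1)] by blast
  then have "ob R \<tau> (F \<union> inst \<tau>' ` set (head R))" by (auto simp: ob_def fresh_ext_def)
  then show ?thesis using assms \<tau>' unfolding step_by_def by blast
qed

text \<open>Absence of links excludes the brake and keeps every loaded stage trigger at
  \<open>w\<close> applicable, since the head of \<open>stage_rule\<close> contains an atom
  \<open>aK w _\<close>.\<close>

definition no_link :: "atom set \<Rightarrow> tm \<Rightarrow> bool" where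
  "no_link F w \<longleftrightarrow> (\<forall>x. aK w x \<notin> F)"

definition reach :: "rule set \<Rightarrow> tm \<Rightarrow> atom set \<Rightarrow> atom set \<Rightarrow> bool" where
  "reach \<Sigma> w F F' \<longleftrightarrow> finite F \<and> (step \<Sigma>)\<^sup>*\<^sup>* F F' \<and> finite F' \<and> F \<subseteq> F' \<and> (no_link F w \<longrightarrow> no_link F' w)"

lemma reach_refl: "finite F \<Longrightarrow> reach \<Sigma> w F F"
  by (simp add: reach_def)

lemma reach_trans: "reach \<Sigma> w F F' \<Longrightarrow> reach \<Sigma> w F' F'' \<Longrightarrow> reach \<Sigma> w F F''"
  by (auto simp: reach_def)

lemma reach_ob:
  assumes "finite F" "R \<in> \<Sigma>" "ld R \<tau> F" and h: "\<And>a. a \<in> set (head R) \<Longrightarrow> pred a \<noteq> 4"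
  shows "\<exists>F'. reach \<Sigma> w F F' \<and> ob R \<tau> F'"
proof (cases "ob R \<tau> F")
  case True
  then show ?thesis using reach_refl[OF assms(1)] by blast
next
  case False
  obtain \<tau>' F' where F': "step_by R \<tau> \<tau>' F F'" "ob R \<tau> F'" "finite F'" "F \<subseteq> F'"
    using apply_trigger[OF assms(1,3) False] by blast
  then have "step \<Sigma> F F'" using assms(2) by (auto simp: step_def)
  moreover have "no_link F w \<longrightarrow> no_link F' w"
    using F'(1) h by (force simp: no_link_def step_by_def inst_def)
  ultimately show ?thesis using F' assms(1) by (auto simp: reach_def)
qed

text \<open>Derivability abstracts from the order of chase steps. Predicate 4 is \<open>aK\<close>;
  in the reduction the condition on heads leaves out just the brake, which must be postponed while a
  stage is computing.\<close>

inductive_set dl :: "rule set \<Rightarrow> atom set \<Rightarrow> atom set" for \<Sigma> F where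
  dl_base: "a \<in> F \<Longrightarrow> a \<in> dl \<Sigma> F"
| dl_rule: "R \<in> \<Sigma> \<Longrightarrow> datalog R \<Longrightarrow> (\<And>a. a \<in> set (head R) \<Longrightarrow> pred a \<noteq> 4) \<Longrightarrow>
    (\<And>b. b \<in> set (body R) \<Longrightarrow> inst \<tau> b \<in> dl \<Sigma> F) \<Longrightarrow> a \<in> set (head R) \<Longrightarrow> inst \<tau> a \<in> dl \<Sigma> F"

lemma reach_set:
  assumes "finite A" "\<And>a G. a \<in> A \<Longrightarrow> F \<subseteq> G \<Longrightarrow> finite G \<Longrightarrow> \<exists>G'. reach \<Sigma> w G G' \<and> a \<in> G'"
    and "F \<subseteq> G" "finite G"
  shows "\<exists>G'. reach \<Sigma> w G G' \<and> A \<subseteq> G'"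
  using assms
proof (induction A)
  case empty
  then show ?case by (meson empty_subsetI reach_refl)
next
  case (insert a A)
  then obtain G1 where G1: "reach \<Sigma> w G G1" "A \<subseteq> G1" by blast
  then obtain G2 where "reach \<Sigma> w G1 G2" "a \<in> G2"
    using insert.prems(1)[of a G1] insert.prems(2) by (auto simp: reach_def)
  then show ?case using G1 reach_trans[OF G1(1)] by (fastforce simp: reach_def)
qed

text \<open>A Datalog trigger that is obsolete already has its instantiated head among the facts, so
  skipping it loses nothing; otherwise it can be applied.\<close>

lemma dl_reach:
  "a \<in> dl \<Sigma> F \<Longrightarrow> F \<subseteq> G \<Longrightarrow> finite G \<Longrightarrow> \<exists>G'. reach \<Sigma> w G G' \<and> a \<in> G'"
proof (induction arbitrary: G rule: dl.induct)
  case (dl_base a)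
  then show ?case using reach_refl by blast
next
  case (dl_rule R \<tau> a)
  have "\<exists>G'. reach \<Sigma> w G G' \<and> inst \<tau> ` set (body R) \<subseteq> G'"
    by (rule reach_set[OF _ _ dl_rule.prems]) (use dl_rule.IH in auto)
  then obtain G1 where G1: "reach \<Sigma> w G G1" "ld R \<tau> G1" by (auto simp: ld_def)
  moreover have "finite G1" using G1 by (simp add: reach_def)
  ultimately obtain G2 where "reach \<Sigma> w G1 G2" "ob R \<tau> G2"
    using reach_ob[of G1 R \<Sigma> \<tau> w] dl_rule.hyps by blast
  then show ?case using G1(1) reach_trans dl_rule.hyps ob_datalog by blast
qed

lemma dl_reach_set:
  "finite A \<Longrightarrow> A \<subseteq> dl \<Sigma> F \<Longrightarrow> finite F \<Longrightarrow> \<exists>F'. reach \<Sigma> w F F' \<and> A \<subseteq> F'"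
  by (rule reach_set[of A F]) (use dl_reach in blast)+

text \<open>The atoms \<open>aS w (c j) w\<close> and \<open>aL w (c j) w\<close> are carried along
  because the bodies of the chain and the stage rule ask for them. The \<open>c j\<close> may
  coincide: a single constant with self-loops is a path of every length.\<close>

definition path :: "atom set \<Rightarrow> tm \<Rightarrow> (nat \<Rightarrow> tm) \<Rightarrow> nat \<Rightarrow> bool" where
  "path F w c k \<longleftrightarrow> aZ w (c 0) \<in> F \<and>
     (\<forall>j\<le>k. aN w (c j) \<in> F \<and> aS w (c j) w \<in> F \<and> aL w (c j) w \<in> F) \<and>
     (\<forall>j<k. aS w (c j) (c (Suc j)) \<in> F)"

lemma path_mono: "path F w c k \<Longrightarrow> F \<subseteq> F' \<Longrightarrow> path F' w c k"
  by (auto simp: path_def)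

lemma path_le: "path F w c k \<Longrightarrow> k' \<le> k \<Longrightarrow> path F w c k'"
  by (auto simp: path_def)

lemma chain_rule_pred: "a \<in> set (head chain_rule) \<Longrightarrow> pred a \<noteq> 4"
  by (auto simp: chain_rule_def)

text \<open>If the chain trigger is already obsolete, the witness of its obsolescence serves as the
  next number. The old prefix is kept because the current value is one of its elements.\<close>

lemma path_extend:
  assumes ch: "chain_rule \<in> \<Sigma>" and fin: "finite F" and p: "path F w c k" and st: "aS w w w \<in> F" "aL w w w \<in> F"
  shows "\<exists>F' c'. reach \<Sigma> w' F F' \<and> path F' w c' (k + d) \<and> (\<forall>j\<le>k. c' j = c j)"
proof (induction d)
  case 0
  then show ?case using p reach_refl[OF fin] by auto
next
  case (Suc d)
  then obtain F' c' where F': "reach \<Sigma> w' F F'" "path F' w c' (k + d)" "\<forall>j\<le>k. c' j = c j" by blast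
  define \<tau> where "\<tau> = (\<lambda>_::nat. c' (k + d))(0 := w)"
  have "ld chain_rule \<tau> F'"
    using F' st by (auto simp: ld_def chain_rule_def \<tau>_def path_def reach_def)
  moreover have "finite F'" using F' by (simp add: reach_def)
  ultimately obtain F'' where F'': "reach \<Sigma> w' F' F''" "ob chain_rule \<tau> F''"
    using reach_ob[OF _ ch] chain_rule_pred by blast
  then obtain v where v: "aS w (c' (k + d)) v \<in> F''" "aN w v \<in> F''" "aS w v w \<in> F''" "aL w v w \<in> F''"
    unfolding ob_chain_rule \<tau>_def by auto
  have "path F'' w c' (k + d)" using F' F'' path_mono by (auto simp: reach_def)
  then have "path F'' w (c'(Suc (k + d) := v)) (k + Suc d)"
    using v by (auto simp: path_def le_Suc_eq less_Suc_eq)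
  moreover have "\<forall>j\<le>k. (c'(Suc (k + d) := v)) j = c j" using F'(3) by auto
  ultimately show ?case using reach_trans[OF F'(1) F''(1)] by blast
qed

section \<open>Completeness of the Datalog evaluation of primitive recursive terms\<close>

lemma map_nth_vars: "length xs = k \<Longrightarrow> map ((!) (w # xs @ zs)) [1..<Suc k] = xs"
  by (rule nth_equalityI) (auto simp: nth_append simp del: upt_Suc)

text \<open>Valuations are written as lists: entry 0 is the stage, entries 1 to \<open>k\<close> are
  the arguments, and \<open>zs\<close> holds results and auxiliary numbers.\<close>

lemma inst_vars: "length xs = k \<Longrightarrow> map (inst_tm ((!) (w # xs @ zs))) (vars k) = xs"
  using map_nth_vars[of xs k w zs] by (simp add: comp_def del: upt_Suc)

lemma fun_rules_pred: "R \<in> set (fun_rules g k) \<Longrightarrow> a \<in> set (head R) \<Longrightarrow> pred a \<noteq> 4"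
  by (cases g) (auto split: if_splits nat.splits)

lemma fun_rules_dl:
  assumes "R \<in> set (fun_rules g k)" "R \<in> \<Sigma>" "head R = [h]"
    and "\<And>b. b \<in> set (body R) \<Longrightarrow> inst \<tau> b \<in> dl \<Sigma> F"
  shows "inst \<tau> h \<in> dl \<Sigma> F"
  using dl_rule[of R \<Sigma> \<tau> F h] assms fun_rules_datalog fun_rules_pred by simp

text \<open>\<open>M\<close> has to cover the intermediate results too, as these must be elements of
  the chain before they can appear in graph atoms.\<close>

definition computed :: "rule set \<Rightarrow> recf \<Rightarrow> nat list \<Rightarrow> nat \<Rightarrow> nat \<Rightarrow> bool" where
  "computed \<Sigma> g xs y M \<longleftrightarrow> (\<forall>F w c. path F w c M \<longrightarrow> aG g w (map c xs) (c y) \<in> dl \<Sigma> F)"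

lemma computed_le: "computed \<Sigma> g xs y M \<Longrightarrow> M \<le> M' \<Longrightarrow> computed \<Sigma> g xs y M'"
  using path_le by (fastforce simp: computed_def)

lemma fun_rules_subset_all: "set (fun_rules g k) \<subseteq> set (all_fun_rules g k)"
  by (cases g) auto

lemma ex_bound: "\<exists>M::nat. \<forall>x\<in>set xs. x \<le> M"
  by (meson List.finite_set finite_nat_set_iff_bounded_le)

lemma computed_Zero:
  assumes "set (fun_rules Zero (length xs)) \<subseteq> \<Sigma>" shows "\<exists>M. computed \<Sigma> Zero xs 0 M"
proof -
  obtain M where M: "\<forall>x\<in>set xs. x \<le> M" using ex_bound by blast
  have "aG Zero w (map c xs) (c 0) \<in> dl \<Sigma> F" if "path F w c M" for F w c
  proof -
    let ?k = "length xs"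
    let ?\<tau> = "(!) (w # map c xs @ [c 0])"
    obtain R where R: "R \<in> set (fun_rules Zero ?k)" "R = Rule (nums ?k @ [aZ (Var 0) (Var (Suc ?k)), aN (Var 0) (Var (Suc ?k))])
       [aG Zero (Var 0) (vars ?k) (Var (Suc ?k))]" by simp
    have "inst ?\<tau> (aG Zero (Var 0) (vars ?k) (Var (Suc ?k))) \<in> dl \<Sigma> F"
    proof (rule fun_rules_dl[OF R(1)])
      fix b assume "b \<in> set (body R)"
      then show "inst ?\<tau> b \<in> dl \<Sigma> F"
        using that M by (auto simp: R(2) path_def nth_append intro!: dl_base simp del: upt_Suc)
    qed (use R assms in auto)
    then show ?thesis using inst_vars[of "map c xs" ?k w "[c 0]"] by (simp add: nth_append del: upt_Suc)
  qed
  then show ?thesis unfolding computed_def by blast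
qed

lemma computed_Succ:
  assumes "set (fun_rules Succ 1) \<subseteq> \<Sigma>" shows "\<exists>M. computed \<Sigma> Succ [x] (Suc x) M"
proof -
  have "aG Succ w [c x] (c (Suc x)) \<in> dl \<Sigma> F" if "path F w c (Suc x)" for F w c
  proof -
    let ?\<tau> = "(!) [w, c x, c (Suc x)]"
    obtain R where R: "R \<in> set (fun_rules Succ 1)" "R = Rule [aN (Var 0) (Var 1), aS (Var 0) (Var 1) (Var 2), aN (Var 0) (Var 2)]
       [aG Succ (Var 0) [Var 1] (Var 2)]" by simp
    have "inst ?\<tau> (aG Succ (Var 0) [Var 1] (Var 2)) \<in> dl \<Sigma> F"
    proof (rule fun_rules_dl[OF R(1)])
      fix b assume "b \<in> set (body R)"
      then show "inst ?\<tau> b \<in> dl \<Sigma> F"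
        using that by (auto simp: R(2) path_def intro!: dl_base)
    qed (use R assms in auto)
    then show ?thesis by simp
  qed
  then show ?thesis unfolding computed_def by auto
qed

lemma computed_Proj:
  assumes "set (fun_rules (Proj i) (length xs)) \<subseteq> \<Sigma>" "i < length xs"
  shows "\<exists>M. computed \<Sigma> (Proj i) xs (xs ! i) M"
proof -
  obtain M where M: "\<forall>x\<in>set xs. x \<le> M" using ex_bound by blast
  have "aG (Proj i) w (map c xs) (c (xs ! i)) \<in> dl \<Sigma> F" if "path F w c M" for F w c
  proof -
    let ?k = "length xs"
    let ?\<tau> = "(!) (w # map c xs @ [])"
    obtain R where R: "R \<in> set (fun_rules (Proj i) ?k)"
      "R = Rule (nums ?k) [aG (Proj i) (Var 0) (vars ?k) (Var (Suc i))]" using assms(2) by simp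
    have "inst ?\<tau> (aG (Proj i) (Var 0) (vars ?k) (Var (Suc i))) \<in> dl \<Sigma> F"
    proof (rule fun_rules_dl[OF R(1)])
      fix b assume "b \<in> set (body R)"
      then show "inst ?\<tau> b \<in> dl \<Sigma> F"
        using that M by (auto simp: R(2) path_def nth_append intro!: dl_base simp del: upt_Suc)
    qed (use R assms in auto)
    then show ?thesis using inst_vars[of "map c xs" ?k w "[]"] assms(2) by (simp add: nth_append del: upt_Suc)
  qed
  then show ?thesis unfolding computed_def by blast
qed

lemma computed_Comp:
  assumes sub: "set (fun_rules (Comp f gs) (length xs)) \<subseteq> \<Sigma>" and len: "length ys = length gs"
    and gs: "\<And>j. j < length gs \<Longrightarrow> \<exists>M. computed \<Sigma> (gs ! j) xs (ys ! j) M" and f: "\<exists>M. computed \<Sigma> f ys z M"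
  shows "\<exists>M. computed \<Sigma> (Comp f gs) xs z M"
proof -
  obtain M1 where M1: "\<forall>x\<in>set xs. x \<le> M1" using ex_bound by blast
  obtain M2 where M2: "computed \<Sigma> f ys z M2" using f by blast
  obtain m where m: "\<And>j. j < length gs \<Longrightarrow> computed \<Sigma> (gs ! j) xs (ys ! j) (m j)" using gs by metis
  obtain M3 where M3: "\<forall>x\<in>set (map m [0..<length gs]). x \<le> M3" using ex_bound by blast
  define M where "M = max M1 (max M2 M3)"
  have "aG (Comp f gs) w (map c xs) (c z) \<in> dl \<Sigma> F" if p: "path F w c M" for F w c
  proof -
    let ?k = "length xs" and ?l = "length gs"
    let ?\<tau> = "(!) (w # map c xs @ map c ys @ [c z])"
    have g: "aG (gs ! j) w (map c xs) (c (ys ! j)) \<in> dl \<Sigma> F" if "j < ?l" for j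
    proof -
      have "m j \<le> M" using M3 that by (simp add: M_def le_max_iff_disj)
      then show ?thesis using computed_le[OF m[OF that]] p by (auto simp: computed_def)
    qed
    have f: "aG f w (map c ys) (c z) \<in> dl \<Sigma> F"
      using computed_le[OF M2, of M] p by (auto simp: computed_def M_def)
    have tk: "map (inst_tm ?\<tau>) (vars ?k) = map c xs" using inst_vars[of "map c xs" ?k w "map c ys @ [c z]"] by simp
    have ty: "?\<tau> (Suc ?k + j) = c (ys ! j)" if "j < ?l" for j using that len by (simp add: nth_append)
    have tys: "map (inst_tm ?\<tau>) (map (\<lambda>j. Var (Suc ?k + j)) [0..<?l]) = map c ys"
      by (rule nth_equalityI) (use ty len in auto)
    have tz: "?\<tau> (Suc ?k + ?l) = c z" using len by (simp add: nth_append)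
    obtain R where R: "R \<in> set (fun_rules (Comp f gs) ?k)"
      "R = Rule (nums ?k @ map (\<lambda>j. aG (gs ! j) (Var 0) (vars ?k) (Var (Suc ?k + j))) [0..<?l] @
         [aG f (Var 0) (map (\<lambda>j. Var (Suc ?k + j)) [0..<?l]) (Var (Suc ?k + ?l))])
       [aG (Comp f gs) (Var 0) (vars ?k) (Var (Suc ?k + ?l))]" by simp
    have "inst ?\<tau> (aG (Comp f gs) (Var 0) (vars ?k) (Var (Suc ?k + ?l))) \<in> dl \<Sigma> F"
    proof (rule fun_rules_dl[OF R(1)])
      fix b assume "b \<in> set (body R)"
      then consider i where "i \<in> {1..<Suc ?k}" "b = aN (Var 0) (Var i)"
        | j where "j < ?l" "b = aG (gs ! j) (Var 0) (vars ?k) (Var (Suc ?k + j))"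
        | "b = aG f (Var 0) (map (\<lambda>j. Var (Suc ?k + j)) [0..<?l]) (Var (Suc ?k + ?l))"
        unfolding R(2) by (auto simp del: upt_Suc)
      then show "inst ?\<tau> b \<in> dl \<Sigma> F"
      proof cases
        case 1
        then have "xs ! (i - 1) \<le> M" using M1 by (auto simp: M_def intro!: max.coboundedI1)
        then show ?thesis using 1 p by (auto simp: path_def nth_append intro!: dl_base)
      next
        case 2
        then show ?thesis using g[OF 2(1)] tk ty[OF 2(1)] by (simp del: upt_Suc)
      next
        case 3
        then show ?thesis using f tys tz by (simp del: upt_Suc)
      qed
    qed (use R sub in \<open>auto simp del: upt_Suc\<close>)
    then show ?thesis using tk tz by (simp del: upt_Suc)
  qed
  then show ?thesis unfolding computed_def by blast
qed

lemma computed_PrimRec_0: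
  assumes sub: "set (fun_rules (PrimRec f g) (Suc (length xs))) \<subseteq> \<Sigma>" and f: "\<exists>M. computed \<Sigma> f xs y M"
  shows "\<exists>M. computed \<Sigma> (PrimRec f g) (0 # xs) y M"
proof -
  obtain M where M: "computed \<Sigma> f xs y M" using f by blast
  have "aG (PrimRec f g) w (map c (0 # xs)) (c y) \<in> dl \<Sigma> F" if p: "path F w c M" for F w c
  proof -
    let ?k = "length xs"
    let ?\<tau> = "(!) (w # map c xs @ [c 0, c y])"
    have tk: "map (inst_tm ?\<tau>) (vars ?k) = map c xs" using inst_vars[of "map c xs" ?k w "[c 0, c y]"] by simp
    have t: "?\<tau> (?k + 1) = c 0" "?\<tau> (?k + 2) = c y" by (simp_all add: nth_append)
    obtain R where R: "R \<in> set (fun_rules (PrimRec f g) (Suc ?k))"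
      "R = Rule [aZ (Var 0) (Var (?k + 1)), aN (Var 0) (Var (?k + 1)), aG f (Var 0) (vars ?k) (Var (?k + 2))]
       [aG (PrimRec f g) (Var 0) (Var (?k + 1) # vars ?k) (Var (?k + 2))]" by simp
    have fd: "aG f w (map c xs) (c y) \<in> dl \<Sigma> F" using M p by (auto simp: computed_def)
    have "inst ?\<tau> (aG (PrimRec f g) (Var 0) (Var (?k + 1) # vars ?k) (Var (?k + 2))) \<in> dl \<Sigma> F"
    proof (rule fun_rules_dl[OF R(1)])
      fix b assume "b \<in> set (body R)"
      then consider "b = aZ (Var 0) (Var (?k + 1))" | "b = aN (Var 0) (Var (?k + 1))"
        | "b = aG f (Var 0) (vars ?k) (Var (?k + 2))" unfolding R(2) by (auto simp del: upt_Suc)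
      then show "inst ?\<tau> b \<in> dl \<Sigma> F"
        by cases (use fd p t tk in \<open>auto simp: path_def intro!: dl_base simp del: upt_Suc\<close>)
    qed (use R sub in \<open>auto simp del: upt_Suc\<close>)
    then show ?thesis using tk t by (simp del: upt_Suc)
  qed
  then show ?thesis unfolding computed_def by blast
qed

lemma computed_PrimRec_Suc:
  assumes sub: "set (fun_rules (PrimRec f g) (Suc (length xs))) \<subseteq> \<Sigma>"
    and f: "\<exists>M. computed \<Sigma> (PrimRec f g) (n # xs) y M" and g: "\<exists>M. computed \<Sigma> g (n # y # xs) z M"
  shows "\<exists>M. computed \<Sigma> (PrimRec f g) (Suc n # xs) z M"
proof -
  obtain M1 M2 where M: "computed \<Sigma> (PrimRec f g) (n # xs) y M1" "computed \<Sigma> g (n # y # xs) z M2"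
    using f g by blast
  define M where "M = max (Suc n) (max M1 M2)"
  have "aG (PrimRec f g) w (map c (Suc n # xs)) (c z) \<in> dl \<Sigma> F" if p: "path F w c M" for F w c
  proof -
    let ?k = "length xs"
    let ?\<tau> = "(!) (w # map c xs @ [c n, c y, c (Suc n), c z])"
    have tk: "map (inst_tm ?\<tau>) (vars ?k) = map c xs"
      using inst_vars[of "map c xs" ?k w "[c n, c y, c (Suc n), c z]"] by simp
    have t: "?\<tau> (?k + 1) = c n" "?\<tau> (?k + 2) = c y" "?\<tau> (?k + 3) = c (Suc n)" "?\<tau> (?k + 4) = c z"
      by (simp_all add: nth_append)
    have l: "Suc n \<le> M" "M1 \<le> M" "M2 \<le> M" by (auto simp: M_def)
    have fd: "aG (PrimRec f g) w (c n # map c xs) (c y) \<in> dl \<Sigma> F"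
      and gd: "aG g w (c n # c y # map c xs) (c z) \<in> dl \<Sigma> F"
      using computed_le[OF M(1) l(2)] computed_le[OF M(2) l(3)] p by (auto simp: computed_def)
    have S: "aS w (c n) (c (Suc n)) \<in> F" "aN w (c (Suc n)) \<in> F" using p l(1) by (auto simp: path_def)
    obtain R where R: "R \<in> set (fun_rules (PrimRec f g) (Suc ?k))"
      "R = Rule [aG (PrimRec f g) (Var 0) (Var (?k + 1) # vars ?k) (Var (?k + 2)),
         aS (Var 0) (Var (?k + 1)) (Var (?k + 3)), aN (Var 0) (Var (?k + 3)),
         aG g (Var 0) (Var (?k + 1) # Var (?k + 2) # vars ?k) (Var (?k + 4))]
       [aG (PrimRec f g) (Var 0) (Var (?k + 3) # vars ?k) (Var (?k + 4))]" by simp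
    have "inst ?\<tau> (aG (PrimRec f g) (Var 0) (Var (?k + 3) # vars ?k) (Var (?k + 4))) \<in> dl \<Sigma> F"
    proof (rule fun_rules_dl[OF R(1)])
      fix b assume "b \<in> set (body R)"
      then consider "b = aG (PrimRec f g) (Var 0) (Var (?k + 1) # vars ?k) (Var (?k + 2))"
        | "b = aS (Var 0) (Var (?k + 1)) (Var (?k + 3))" | "b = aN (Var 0) (Var (?k + 3))"
        | "b = aG g (Var 0) (Var (?k + 1) # Var (?k + 2) # vars ?k) (Var (?k + 4))"
        unfolding R(2) by (auto simp del: upt_Suc)
      then show "inst ?\<tau> b \<in> dl \<Sigma> F"
        by cases (use fd gd S t tk in \<open>auto intro: dl_base simp del: upt_Suc\<close>)
    qed (use R sub in \<open>auto simp del: upt_Suc\<close>)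
    then show ?thesis using tk t by (simp del: upt_Suc)
  qed
  then show ?thesis unfolding computed_def by blast
qed

lemma computes_computed:
  "computes g xs y \<Longrightarrow> no_mu g \<Longrightarrow> set (all_fun_rules g (length xs)) \<subseteq> \<Sigma> \<Longrightarrow> \<exists>M. computed \<Sigma> g xs y M"
proof (induction rule: computes.induct)
  case (1 xs)
  then show ?case using computed_Zero fun_rules_subset_all by (metis dual_order.trans)
next
  case (2 x)
  then show ?case using computed_Succ fun_rules_subset_all by (metis all_fun_rules.simps(4) length_Cons list.size(3) One_nat_def)
next
  case (3 i xs)
  then show ?case using computed_Proj fun_rules_subset_all by (metis dual_order.trans)
next
  case (4 xs gs ys f z)
  have len: "length ys = length gs" using 4(1) by (simp add: list_all2_lengthD)
  have sub: "set (fun_rules (Comp f gs) (length xs)) \<subseteq> \<Sigma>" "set (all_fun_rules f (length ys)) \<subseteq> \<Sigma>"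
    "\<And>g. g \<in> set gs \<Longrightarrow> set (all_fun_rules g (length xs)) \<subseteq> \<Sigma>"
    using 4(5) len by auto
  show ?case
  proof (rule computed_Comp[OF sub(1) len])
    show "\<exists>M. computed \<Sigma> (gs ! j) xs (ys ! j) M" if "j < length gs" for j
      using 4(1) that sub(3)[of "gs ! j"] 4(4) by (auto simp: list_all2_conv_all_nth)
    show "\<exists>M. computed \<Sigma> f ys z M" using 4 sub(2) by auto
  qed
next
  case (5 f xs y g)
  then show ?case by (intro computed_PrimRec_0) auto
next
  case (6 f g n xs y z)
  then show ?case by (intro computed_PrimRec_Suc[of f g xs \<Sigma> n y z]) auto
next
  case (7 f n xs)
  then show ?case by simp
qed

text \<open>No link of \<open>w\<close> exists yet, so the stage rule is applicable to \<open>w\<close> whatever else has happened.\<close>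

definition staged :: "atom set \<Rightarrow> tm \<Rightarrow> nat \<Rightarrow> bool" where
  "staged F w a \<longleftrightarrow> finite F \<and> no_link F w \<and> aS w w w \<in> F \<and> aL w w w \<in> F \<and> aZ w w \<in> F \<and>
     (\<exists>c. path F w c a \<and> aX w (c a) \<in> F)"

lemma param_dl:
  assumes "param_rule n \<in> \<Sigma>" "path F w c n"
  shows "aP w (c n) \<in> dl \<Sigma> F"
proof -
  define \<tau> where "\<tau> i = (case i of 0 \<Rightarrow> w | Suc j \<Rightarrow> c j)" for i
  have "inst \<tau> b \<in> F" if "b \<in> set (param_body k)" "k \<le> n" for b k
    using that
  proof (induction k)
    case 0
    then show ?case using assms(2) by (auto simp: \<tau>_def path_def)
  next
    case (Suc k)
    then show ?case using assms(2) by (auto simp: \<tau>_def path_def)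
  qed
  then have *: "inst \<tau> b \<in> dl \<Sigma> F" if "b \<in> set (param_body n)" for b using that by (blast intro: dl_base)
  have "inst \<tau> (aP (Var 0) (Var (Suc n))) \<in> dl \<Sigma> F"
    by (rule dl_rule[OF assms(1) param_rule_datalog]) (use * in \<open>auto simp: param_rule_def\<close>)
  then show ?thesis by (simp add: \<tau>_def)
qed

lemma eq_dl:
  assumes "eq_zero_rule \<in> \<Sigma>" "eq_suc_rule \<in> \<Sigma>" "path F w c k" "path F w' c' k" "aK w w' \<in> F"
  shows "j \<le> k \<Longrightarrow> aE w w' (c j) (c' j) \<in> dl \<Sigma> F"
proof (induction j)
  case 0
  have "inst ((!) [w, w', c 0, c' 0]) (aE (Var 0) (Var 1) (Var 2) (Var 3)) \<in> dl \<Sigma> F"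
    by (rule dl_rule[OF assms(1) eq_rules_datalog(1)])
      (use assms in \<open>auto simp: eq_zero_rule_def path_def intro: dl_base\<close>)
  then show ?case by simp
next
  case (Suc j)
  have "inst ((!) [w, w', c j, c' j, c (Suc j), c' (Suc j)]) (aE (Var 0) (Var 1) (Var 4) (Var 5)) \<in> dl \<Sigma> F"
    by (rule dl_rule[OF assms(2) eq_rules_datalog(2)])
      (use Suc assms in \<open>auto simp: eq_suc_rule_def path_def intro: dl_base\<close>)
  then show ?case by simp
qed

lemma value_dl:
  assumes "value_rule \<in> \<Sigma>" "aL w y w' \<in> F" "aE w w' y y' \<in> dl \<Sigma> F"
  shows "aX w' y' \<in> dl \<Sigma> F"
proof -
  have "inst ((!) [w, w', y, y']) (aX (Var 1) (Var 3)) \<in> dl \<Sigma> F"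
    by (rule dl_rule[OF assms(1) eq_rules_datalog(3)])
      (use assms in \<open>auto simp: value_rule_def intro: dl_base\<close>)
  then show ?thesis by simp
qed

text \<open>All evaluation happens while \<open>w\<close> has no link; then the stage rule fires,
  and the chain of the child is extended up to \<open>b\<close> so that the value can be copied. The
  brake of the old stage is left to the fair schedule.\<close>

lemma advance:
  assumes st: "staged F w a" and mu: "no_mu f" and comp: "computes f [n, a, b] 0"
  shows "\<exists>F' w'. (step (set (red_rules f n)))\<^sup>+\<^sup>+ F F' \<and> F \<subseteq> F' \<and> staged F' w' b \<and> fresh F w'"
proof -
  let ?\<Sigma> = "set (red_rules f n)"
  have sub: "chain_rule \<in> ?\<Sigma>" "stage_rule f \<in> ?\<Sigma>" "eq_zero_rule \<in> ?\<Sigma>" "eq_suc_rule \<in> ?\<Sigma>"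
    "value_rule \<in> ?\<Sigma>" "param_rule n \<in> ?\<Sigma>" "set (all_fun_rules f 3) \<subseteq> ?\<Sigma>"
    by (auto simp: red_rules_def fixed_rules_def)
  obtain M where M: "computed ?\<Sigma> f [n, a, b] 0 M" using computes_computed[OF comp mu] sub(7) by (auto simp: numeral_3_eq_3)
  \<comment> \<open>Room for the parameter, the next value and all intermediate results of the
    evaluation.\<close>
  define d where "d = n + b + M"
  obtain c0 where c0: "path F w c0 a" "aX w (c0 a) \<in> F" using st by (auto simp: staged_def)
  have fin: "finite F" and nl: "no_link F w" and stw: "aS w w w \<in> F" "aL w w w \<in> F" "aZ w w \<in> F"
    using st by (auto simp: staged_def)
  obtain F1 c where F1: "reach ?\<Sigma> w F F1" "path F1 w c (a + d)" "\<forall>j\<le>a. c j = c0 j"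
    using path_extend[OF sub(1) fin c0(1) stw(1,2), of w d] by blast
  have pn: "path F1 w c n" and pb: "path F1 w c b" and pM: "path F1 w c M"
    using path_le[OF F1(2)] by (auto simp: d_def)
  have fin1: "finite F1" using F1 by (simp add: reach_def)
  have "{aP w (c n), aG f w [c n, c a, c b] (c 0)} \<subseteq> dl ?\<Sigma> F1"
    using param_dl[OF sub(6) pn] M pM by (auto simp: computed_def)
  then obtain F2 where F2: "reach ?\<Sigma> w F1 F2" "{aP w (c n), aG f w [c n, c a, c b] (c 0)} \<subseteq> F2"
    using dl_reach_set fin1 by (metis finite.emptyI finite_insert)
  have sub2: "F1 \<subseteq> F2" "F \<subseteq> F2" and fin2: "finite F2" and nl2: "no_link F2 w" and r2: "(step ?\<Sigma>)\<^sup>*\<^sup>* F F2"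
    using F1(1) F2(1) nl by (auto simp: reach_def)
  define \<tau> where "\<tau> = (!) [w, c b, c a, c n, c 0]"
  have l: "ld (stage_rule f) \<tau> F2"
    using F2(2) sub2 stw c0(2) F1(3) pb by (auto simp: ld_def stage_rule_def \<tau>_def path_def)
  have "\<not> ob (stage_rule f) \<tau> F2" using nl2 unfolding ob_stage_rule by (auto simp: no_link_def \<tau>_def)
  then obtain \<tau>' F3 where s3: "step_by (stage_rule f) \<tau> \<tau>' F2 F3" and fin3: "finite F3"
    using apply_trigger[OF fin2 l] by blast
  define w' z where "w' = \<tau>' 5" and "z = \<tau>' 6"
  note st3 = step_stage_rule[OF s3, folded w'_def z_def]
  have fr: "fresh F2 w'" by (rule st3(9))
  then have frF: "fresh F w'" using sub2 by (auto simp: fresh_def)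
  have ww': "w \<noteq> w'" using freshD[OF fr] stw(1) sub2 by fastforce
  have "no_link F3 w'" using freshD[OF fr] ww' st3(12) by (auto simp: no_link_def \<tau>_def)
  have p3: "path F3 w' (\<lambda>_. z) 0" using st3(12) by (auto simp: path_def)
  have stw': "aS w' w' w' \<in> F3" "aL w' w' w' \<in> F3" "aZ w' w' \<in> F3" "aK w w' \<in> F3" "aL w (c b) w' \<in> F3"
    using st3(12) by (auto simp: \<tau>_def)
  obtain F4 c' where F4: "reach ?\<Sigma> w' F3 F4" "path F4 w' c' (0 + b)"
    using path_extend[OF sub(1) fin3 p3 stw'(1,2), of w' b] by blast
  have sub4: "F3 \<subseteq> F4" "F2 \<subseteq> F4" and fin4: "finite F4" using F4(1) st3(12) by (auto simp: reach_def)
  have "path F4 w c b" by (rule path_mono[OF pb]) (use sub2 sub4 in auto)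
  then have "aE w w' (c b) (c' b) \<in> dl ?\<Sigma> F4"
    using eq_dl[OF sub(3,4)] F4(2) stw'(4) sub4(1) by auto
  then have "aX w' (c' b) \<in> dl ?\<Sigma> F4" using value_dl[OF sub(5)] stw'(5) sub4(1) by blast
  then obtain F5 where F5: "reach ?\<Sigma> w' F4 F5" "aX w' (c' b) \<in> F5"
    using dl_reach[of _ ?\<Sigma> F4 F4] fin4 by blast
  have r: "reach ?\<Sigma> w' F3 F5" by (rule reach_trans[OF F4(1) F5(1)])
  have "path F5 w' c' b" by (rule path_mono[of F4]) (use F4(2) F5(1) in \<open>auto simp: reach_def\<close>)
  then have "staged F5 w' b"
    using F5(2) stw' r \<open>no_link F3 w'\<close> unfolding staged_def reach_def by blast
  moreover have "(step ?\<Sigma>)\<^sup>+\<^sup>+ F F5"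
  proof -
    have "step ?\<Sigma> F2 F3" using s3 sub(2) by (auto simp: step_def)
    then have "(step ?\<Sigma>)\<^sup>+\<^sup>+ F F3" using r2 by (rule rtranclp_into_tranclp1[rotated])
    then show ?thesis using r by (auto simp: reach_def)
  qed
  moreover have "F \<subseteq> F5" using sub2 sub4 r st3(12) by (auto simp: reach_def)
  ultimately show ?thesis using frF by blast
qed

text \<open>Links start at a universally quantified variable, so a trigger can brake a stage or
  spawn from it only if its body mentions that stage.\<close>

lemma link_heads:
  assumes "R \<in> set (red_rules f n)" "a \<in> set (head R)" "pred a = 4"
  shows "\<exists>t. a = aK (Var 0) t \<and> 0 \<in> univ_vars R"
proof -
  consider "R = brake_rule" | "R = stage_rule f" | "R = chain_rule" | "R = eq_zero_rule" | "R = eq_suc_rule"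
    | "R = value_rule" | "R = param_rule n" | g k where "R \<in> set (fun_rules g k)"
    using assms by (auto simp: red_rules_def fixed_rules_def dest!: all_fun_rules_fun_rules)
  then show ?thesis
  proof cases
    case 1
    then show ?thesis using assms by (auto simp: brake_rule_def univ_vars_def atom_vars_Atom)
  next
    case 2
    then show ?thesis using assms stage_rule_vars by (auto simp: stage_rule_def)
  next
    case (8 g k)
    then show ?thesis using assms fun_rules_pred by blast
  qed (use assms in \<open>auto simp: chain_rule_def eq_zero_rule_def eq_suc_rule_def value_rule_def param_rule_def\<close>)
qed

text \<open>A trigger loaded for \<open>F\<close> does not mention the stage spawned by the descent step, so it can be
  applied afterwards without harming that stage.\<close>

lemma macro_step:
  assumes st: "staged F w a" and mu: "no_mu f" and comp: "computes f [n, a, b] 0"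
  shows "\<exists>F' w'. (step (set (red_rules f n)))\<^sup>+\<^sup>+ F F' \<and> F \<subseteq> F' \<and> staged F' w' b \<and>
    (R \<in> set (red_rules f n) \<longrightarrow> ld R \<tau> F \<longrightarrow> ob R \<tau> F')"
proof -
  let ?\<Sigma> = "set (red_rules f n)"
  obtain F' w' where F': "(step ?\<Sigma>)\<^sup>+\<^sup>+ F F'" "F \<subseteq> F'" "staged F' w' b" "fresh F w'"
    using advance[OF assms] by blast
  show ?thesis
  proof (cases "R \<in> ?\<Sigma> \<and> ld R \<tau> F \<and> \<not> ob R \<tau> F'")
    case False
    then show ?thesis using F' by blast
  next
    case True
    have fin: "finite F'" using F'(3) by (simp add: staged_def)
    have "ld R \<tau> F'" using True F'(2) ld_mono by blast
    then obtain \<tau>' G where G: "step_by R \<tau> \<tau>' F' G" "ob R \<tau> G" "finite G" "F' \<subseteq> G"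
      using apply_trigger[OF fin] True by blast
    have "no_link G w'"
      unfolding no_link_def
    proof (intro allI notI)
      fix x assume "aK w' x \<in> G"
      moreover have "aK w' x \<notin> F'" using F'(3) by (simp add: staged_def no_link_def)
      ultimately obtain a where a: "a \<in> set (head R)" "aK w' x = inst \<tau>' a" using G(1) by (auto simp: step_by_def)
      then have "pred a = 4" by (simp add: inst_def)
      then obtain t where t: "a = aK (Var 0) t" "0 \<in> univ_vars R" using link_heads True a(1) by blast
      then have "w' = \<tau> 0" using a(2) G(1) by (simp add: step_by_def fresh_ext_def agree_def)
      moreover obtain b where b: "b \<in> set (body R)" "Var 0 \<in> set (args b)"
        using t(2) by (auto simp: univ_vars_def atom_vars_def)
      then have "inst \<tau> b \<in> F" "\<tau> 0 \<in> set (args (inst \<tau> b))" using True by (auto simp: ld_def inst_def image_iff intro: bexI[of _ "Var 0"])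
      ultimately show False using F'(4) by (auto simp: fresh_def)
    qed
    then have "staged G w' b"
      using F'(3) G(3,4) path_mono[OF _ G(4)] unfolding staged_def by blast
    moreover have "step ?\<Sigma> F' G" using G(1) True by (auto simp: step_def)
    then have "(step ?\<Sigma>)\<^sup>+\<^sup>+ F G" using F'(1) by auto
    ultimately show ?thesis using G(2,4) F'(2) by blast
  qed
qed

section \<open>A fair schedule\<close>

lemma flatten_tranclp_sequence:
  assumes "\<And>m. S\<^sup>+\<^sup>+ (G m) (G (Suc m))"
  shows "\<exists>F. F 0 = G 0 \<and> (\<forall>i. S (F i) (F (Suc i))) \<and> (\<forall>m. \<exists>i\<ge>m. F i = G m)"
proof -
  have "\<exists>l. (S ^^ Suc l) (G m) (G (Suc m))" for m
    using assms[of m] unfolding tranclp_power by (metis gr0_conv_Suc)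
  then obtain L where L: "\<And>m. (S ^^ Suc (L m)) (G m) (G (Suc m))" by metis
  \<comment> \<open>In a state \<open>(m, l, x)\<close> the set \<open>x\<close> is exactly
    \<open>Suc l\<close> steps away from \<open>G (Suc m)\<close>; \<open>Q\<close> counts
    \<open>l\<close> down and then enters the next segment.\<close>
  define P where "P i = (\<lambda>(m, l, x). (i = 0 \<longrightarrow> (m, l, x) = (0, L 0, G 0)) \<and> (S ^^ Suc l) x (G (Suc m)))" for i :: nat
  define Q where "Q = (\<lambda>(m, l, x) (m', l', x'). S x x' \<and>
     (case l of 0 \<Rightarrow> (m', l', x') = (Suc m, L (Suc m), G (Suc m)) | Suc k \<Rightarrow> m' = m \<and> l' = k))"
  have "\<exists>h. \<forall>i. P i (h i) \<and> Q (h i) (h (Suc i))"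
  proof (rule dependent_nat_choice)
    show "\<exists>x. P 0 x" using L[of 0] by (intro exI[of _ "(0, L 0, G 0)"]) (auto simp: P_def simp del: relpowp.simps)
  next
    fix x i assume "P i x"
    obtain m l y where x: "x = (m, l, y)" by (cases x) auto
    have p: "(S ^^ Suc l) y (G (Suc m))" using \<open>P i x\<close> by (simp add: x P_def del: relpowp.simps)
    show "\<exists>y. P (Suc i) y \<and> Q x y"
    proof (cases l)
      case 0
      then have "S y (G (Suc m))" using p by auto
      then show ?thesis using 0 L[of "Suc m"]
        by (intro exI[of _ "(Suc m, L (Suc m), G (Suc m))"]) (auto simp: P_def Q_def x simp del: relpowp.simps)
    next
      case (Suc k)
      then obtain y' where "S y y'" "(S ^^ Suc k) y' (G (Suc m))" using p by (meson relpowp_Suc_D2)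
      then show ?thesis using Suc
        by (intro exI[of _ "(m, k, y')"]) (auto simp: P_def Q_def x simp del: relpowp.simps)
    qed
  qed
  then obtain h where h: "\<And>i. P i (h i)" "\<And>i. Q (h i) (h (Suc i))" by blast
  have run: "\<exists>x'. h (i + l) = (m, 0, x')" if "h i = (m, l, x)" for i l m x
    using that
  proof (induction l arbitrary: i x)
    case (Suc l)
    obtain x' where "h (Suc i) = (m, l, x')" using h(2)[of i] Suc.prems by (auto simp: Q_def)
    then show ?case using Suc.IH by fastforce
  qed auto
  have visit: "\<exists>i\<ge>m. h i = (m, L m, G m)" for m
  proof (induction m)
    case 0
    show ?case using h(1)[of 0] by (intro exI[of _ 0]) (auto simp: P_def split: prod.splits)
  next
    case (Suc m)
    then obtain i where i: "i \<ge> m" "h i = (m, L m, G m)" by blast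
    obtain x' where "h (i + L m) = (m, 0, x')" using run[OF i(2)] by blast
    then have "h (Suc (i + L m)) = (Suc m, L (Suc m), G (Suc m))"
      using h(2)[of "i + L m"] by (auto simp: Q_def split: prod.splits)
    then show ?case using i(1) by (intro exI[of _ "Suc (i + L m)"]) auto
  qed
  define F where "F i = snd (snd (h i))" for i
  have "F 0 = G 0" using h(1)[of 0] by (auto simp: F_def P_def split: prod.splits)
  moreover have "S (F i) (F (Suc i))" for i
    using h(2)[of i] by (auto simp: F_def Q_def split: prod.splits)
  moreover have "\<exists>i\<ge>m. F i = G m" for m using visit[of m] by (auto simp: F_def)
  ultimately show ?thesis by blast
qed

instance tm :: countable
  by countable_datatype

lemma finite_univ_vars: "finite (univ_vars R)"
proof -
  have "finite (atom_vars a)" for a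
  proof -
    have "Var ` atom_vars a \<subseteq> set (args a)" by (auto simp: atom_vars_def)
    then show ?thesis by (metis List.finite_set finite_imageD finite_subset inj_onI tm.inject(1))
  qed
  then show ?thesis by (simp add: univ_vars_def)
qed

lemma ld_cong: "agree R \<tau> \<tau>' \<Longrightarrow> ld R \<tau>' F \<longleftrightarrow> ld R \<tau> F"
proof -
  assume *: "agree R \<tau> \<tau>'"
  have "inst \<tau>' a = inst \<tau> a" if "a \<in> set (body R)" for a
    using that * by (intro inst_cong) (auto simp: agree_def univ_vars_def)
  then show ?thesis by (auto simp: ld_def)
qed

lemma ob_cong: "agree R \<tau> \<tau>' \<Longrightarrow> ob R \<tau>' F \<longleftrightarrow> ob R \<tau> F"
  unfolding ob_def agree_def by simp

text \<open>A trigger matters only on finitely many variables, so finite lists of terms represent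
  all triggers and can be enumerated.\<close>

definition list_subst :: "tm list \<Rightarrow> nat \<Rightarrow> tm" where
  "list_subst ts v = (if v < length ts then ts ! v else Const 0)"

lemma ex_list_subst: "\<exists>ts. agree R \<tau> (list_subst ts)"
proof -
  obtain N where "\<And>v. v \<in> univ_vars R \<Longrightarrow> v < N" using finite_univ_vars by (meson finite_nat_set_iff_bounded)
  then have "agree R \<tau> (list_subst (map \<tau> [0..<N]))" by (simp add: agree_def list_subst_def)
  then show ?thesis by blast
qed

text \<open>Macro step \<open>m\<close> continues the descent by one stage and then settles trigger
  \<open>m\<close> of an enumeration; the brakes of older stages are handled like any other
  trigger.\<close>

lemma descent_inf_chase:
  assumes mu: "no_mu f" and comp: "\<And>k. computes f [n, s k, s (Suc k)] 0"
  shows "\<exists>F. inf_chase (set (red_rules f n)) F"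
proof -
  let ?\<Sigma> = "set (red_rules f n)"
  let ?w = "Const 0"
  \<comment> \<open>The constant serves as stage and as every number of its chain at once.\<close>
  define D where "D = {aS ?w ?w ?w, aL ?w ?w ?w, aZ ?w ?w, aN ?w ?w, aX ?w ?w}"
  \<comment> \<open>The first component only serves repetition: each trigger occurs infinitely
    often, hence also after it has become loaded.\<close>
  define trig where "trig i = (case from_nat i of (j :: nat, R, ts) \<Rightarrow> (red_rules f n ! R, list_subst ts))" for i
  have D: "database D" by (auto simp: D_def database_def atom_vars_def atom_nulls_def)
  have "path D ?w (\<lambda>_. ?w) (s 0)" by (simp add: path_def D_def)
  \<comment> \<open>\<open>D\<close> contains only the \<open>aN\<close> half of the brake; without
    \<open>aK\<close> the stage rule can still fire at the constant.\<close>
  then have st0: "staged D ?w (s 0)" by (auto simp: staged_def D_def no_link_def)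
  have "\<exists>g. \<forall>m. ((m = 0 \<longrightarrow> fst (g m) = D) \<and> staged (fst (g m)) (snd (g m)) (s m)) \<and>
      ((step ?\<Sigma>)\<^sup>+\<^sup>+ (fst (g m)) (fst (g (Suc m))) \<and> fst (g m) \<subseteq> fst (g (Suc m)) \<and>
       (fst (trig m) \<in> ?\<Sigma> \<longrightarrow> ld (fst (trig m)) (snd (trig m)) (fst (g m)) \<longrightarrow>
         ob (fst (trig m)) (snd (trig m)) (fst (g (Suc m)))))" (is "\<exists>g. \<forall>m. ?P g m")
  proof (rule dependent_nat_choice)
    show "\<exists>x. (0 = 0 \<longrightarrow> fst x = D) \<and> staged (fst x) (snd x) (s 0)" using st0 by auto
  next
    fix x m assume "(m = 0 \<longrightarrow> fst x = D) \<and> staged (fst x) (snd x) (s m)"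
    then obtain F' w' where F': "(step ?\<Sigma>)\<^sup>+\<^sup>+ (fst x) F'" "fst x \<subseteq> F'" "staged F' w' (s (Suc m))"
      "fst (trig m) \<in> ?\<Sigma> \<longrightarrow> ld (fst (trig m)) (snd (trig m)) (fst x) \<longrightarrow> ob (fst (trig m)) (snd (trig m)) F'"
      using macro_step[OF _ mu comp, of "fst x" "snd x" m "fst (trig m)" "snd (trig m)"] by blast
    show "\<exists>y. ((Suc m = 0 \<longrightarrow> fst y = D) \<and> staged (fst y) (snd y) (s (Suc m))) \<and>
       ((step ?\<Sigma>)\<^sup>+\<^sup>+ (fst x) (fst y) \<and> fst x \<subseteq> fst y \<and>
       (fst (trig m) \<in> ?\<Sigma> \<longrightarrow> ld (fst (trig m)) (snd (trig m)) (fst x) \<longrightarrow>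
         ob (fst (trig m)) (snd (trig m)) (fst y)))"
      using F' by (intro exI[of _ "(F', w')"]) simp
  qed
  then obtain g where g': "\<forall>m. ?P g m" ..
  have g: "fst (g 0) = D" "\<And>m. (step ?\<Sigma>)\<^sup>+\<^sup>+ (fst (g m)) (fst (g (Suc m)))"
    "\<And>m. fst (trig m) \<in> ?\<Sigma> \<Longrightarrow> ld (fst (trig m)) (snd (trig m)) (fst (g m)) \<Longrightarrow>
         ob (fst (trig m)) (snd (trig m)) (fst (g (Suc m)))"
    using g' by simp_all
  obtain F where F: "F 0 = D" "\<And>i. step ?\<Sigma> (F i) (F (Suc i))" "\<And>m. \<exists>i\<ge>m. F i = fst (g m)"
    using flatten_tranclp_sequence[of "step ?\<Sigma>" "\<lambda>m. fst (g m)", OF g(2)] g(1) by auto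
  have mono: "i \<le> j \<Longrightarrow> F i \<subseteq> F j" for i j
  proof (rule lift_Suc_mono_le)
    fix i show "F i \<subseteq> F (Suc i)" using F(2)[of i] by (auto simp: step_def step_by_def)
  qed
  have "\<exists>j\<ge>i. ob R \<tau> (F j)" if R: "R \<in> ?\<Sigma>" and l: "ld R \<tau> (F i)" for R \<tau> i
  proof -
    obtain ts where ts: "agree R \<tau> (list_subst ts)" using ex_list_subst by blast
    obtain r where r: "r < length (red_rules f n)" "red_rules f n ! r = R" using R by (meson in_set_conv_nth)
    obtain m where m: "m \<ge> i" "trig m = (R, list_subst ts)"
    proof -
      have "inj (\<lambda>j::nat. to_nat (j, r, ts))" by (auto simp: inj_on_def)
      then have "infinite (range (\<lambda>j::nat. to_nat (j, r, ts)))" by (rule range_inj_infinite)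
      then obtain j :: nat where "to_nat (j, r, ts) \<ge> i" 
        unfolding infinite_nat_iff_unbounded_le by blast
      then show ?thesis using that[of "to_nat (j, r, ts)"] r by (simp add: trig_def)
    qed
    obtain i1 where i1: "i1 \<ge> m" "F i1 = fst (g m)" using F(3) by blast
    obtain i2 where i2: "i2 \<ge> Suc m" "F i2 = fst (g (Suc m))" using F(3) by blast
    have "ld R \<tau> (F i1)" using l ld_mono mono m(1) i1(1) by (meson le_trans)
    then have "ld R (list_subst ts) (fst (g m))" using ld_cong[OF ts] i1(2) by simp
    then have "ob R (list_subst ts) (F i2)" using g(3)[of m] R m(2) i2(2) by simp
    then have "ob R \<tau> (F i2)" using ob_cong[OF ts] by blast
    moreover have "i2 \<ge> i" using i2(1) m(1) by simp
    ultimately show ?thesis by blast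
  qed
  then have "inf_chase ?\<Sigma> F" using D F by (auto simp: inf_chase_def)
  then show ?thesis by blast
qed

section \<open>Primitive recursive functions and relations\<close>

definition pr :: "nat \<Rightarrow> (nat list \<Rightarrow> nat) \<Rightarrow> bool" where
  "pr k F \<longleftrightarrow> (\<exists>f. no_mu f \<and> (\<forall>xs. length xs = k \<longrightarrow> computes f xs (F xs)))"

lemma pr_cong: "pr k F \<Longrightarrow> (\<And>xs. length xs = k \<Longrightarrow> F xs = G xs) \<Longrightarrow> pr k G"
  by (auto simp: pr_def)

lemma pr_nth: "i < k \<Longrightarrow> pr k (\<lambda>xs. xs ! i)"
  unfolding pr_def by (rule exI[of _ "Proj i"]) (auto intro: computes.intros)

lemma pr_hd: "0 < k \<Longrightarrow> pr k hd"
  by (rule pr_cong[OF pr_nth[of 0]]) (auto simp: hd_conv_nth)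

lemma pr_nth_tl: "Suc i < k \<Longrightarrow> pr k (\<lambda>xs. tl xs ! i)"
  by (rule pr_cong[OF pr_nth[of "Suc i"]]) (auto simp: nth_tl)

lemma pr_zero: "pr k (\<lambda>_. 0)"
  unfolding pr_def by (rule exI[of _ Zero]) (auto intro: computes.intros)

lemma pr_subst:
  assumes "pr m G" "\<And>i. i < m \<Longrightarrow> pr k (h i)"
  shows "pr k (\<lambda>xs. G (map (\<lambda>i. h i xs) [0..<m]))"
proof -
  obtain g where g: "no_mu g" "\<And>xs. length xs = m \<Longrightarrow> computes g xs (G xs)" using assms(1) by (auto simp: pr_def)
  obtain hs where hs: "\<And>i. i < m \<Longrightarrow> no_mu (hs i) \<and> (\<forall>xs. length xs = k \<longrightarrow> computes (hs i) xs (h i xs))"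
    using assms(2) unfolding pr_def by metis
  have "computes (Comp g (map hs [0..<m])) xs (G (map (\<lambda>i. h i xs) [0..<m]))" if "length xs = k" for xs
    by (rule computes.intros(4)[of _ _ "map (\<lambda>i. h i xs) [0..<m]"])
      (use g(2) hs that in \<open>auto simp: list_all2_conv_all_nth\<close>)
  moreover have "no_mu (Comp g (map hs [0..<m]))" using g(1) hs by auto
  ultimately show ?thesis unfolding pr_def by blast
qed

lemma pr_comp1: "pr 1 (\<lambda>xs. G (xs ! 0)) \<Longrightarrow> pr k A \<Longrightarrow> pr k (\<lambda>xs. G (A xs))"
  using pr_subst[of 1 "\<lambda>xs. G (xs ! 0)" k "\<lambda>_. A"] by simp

lemma pr_comp2: "pr 2 (\<lambda>xs. G (xs ! 0) (xs ! 1)) \<Longrightarrow> pr k A \<Longrightarrow> pr k B \<Longrightarrow> pr k (\<lambda>xs. G (A xs) (B xs))"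
  using pr_subst[of 2 "\<lambda>xs. G (xs ! 0) (xs ! 1)" k "\<lambda>i. if i = 0 then A else B"] by (simp add: numeral_2_eq_2)

lemma pr_Suc: "pr k A \<Longrightarrow> pr k (\<lambda>xs. Suc (A xs))"
proof (rule pr_comp1[of Suc])
  have "computes Succ xs (Suc (xs ! 0))" if "length xs = 1" for xs
    using that computes.intros(2)[of "xs ! 0"] by (cases xs) auto
  then show "pr 1 (\<lambda>xs. Suc (xs ! 0))"
    unfolding pr_def by (intro exI[of _ Succ]) simp
qed

lemma pr_const: "pr k (\<lambda>_. c)"
  by (induction c) (auto intro: pr_zero pr_Suc)

lemma pr_rec:
  assumes "pr k A" "pr (Suc (Suc k)) (\<lambda>ys. T (hd ys) (hd (tl ys)) (tl (tl ys)))" "pr k B"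
  shows "pr k (\<lambda>xs. rec_nat (A xs) (\<lambda>n y. T n y xs) (B xs))"
proof -
  obtain a t where a: "no_mu a" "\<And>xs. length xs = k \<Longrightarrow> computes a xs (A xs)"
    and t: "no_mu t" "\<And>ys. length ys = Suc (Suc k) \<Longrightarrow> computes t ys (T (hd ys) (hd (tl ys)) (tl (tl ys)))"
    using assms(1,2) by (auto simp: pr_def)
  have "computes (PrimRec a t) (n # xs) (rec_nat (A xs) (\<lambda>n y. T n y xs) n)" if "length xs = k" for n xs
  proof (induction n)
    case 0
    then show ?case using a(2)[OF that] by (simp add: computes.intros(5))
  next
    case (Suc n)
    show ?case
      using computes.intros(6)[OF Suc] t(2)[of "n # rec_nat (A xs) (\<lambda>n y. T n y xs) n # xs"] that by simp
  qed
  then have *: "computes (PrimRec a t) ys (rec_nat (A (tl ys)) (\<lambda>n y. T n y (tl ys)) (hd ys))" if "length ys = Suc k" for ys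
    using that by (cases ys) auto
  have "no_mu (PrimRec a t)" using a t by simp
  then have "pr (Suc k) (\<lambda>ys. rec_nat (A (tl ys)) (\<lambda>n y. T n y (tl ys)) (hd ys))"
    using * unfolding pr_def by blast
  note rec = this
  \<comment> \<open>Rearranges the arguments \<open>xs\<close> into \<open>B xs # xs\<close>, as the
    recursion expects its counter in front.\<close>
  define h where "h i = (case i of 0 \<Rightarrow> B | Suc j \<Rightarrow> (\<lambda>xs. xs ! j))" for i
  have h: "pr k (h i)" if "i < Suc k" for i
    using that assms(3) pr_nth by (cases i) (simp_all add: h_def)
  have eq: "map (\<lambda>i. h i xs) [0..<Suc k] = B xs # xs" if "length xs = k" for xs
    using that by (intro nth_equalityI) (auto simp: h_def nth_Cons split: nat.splits simp del: upt_Suc)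
  show ?thesis
    by (rule pr_cong[OF pr_subst[OF rec h]], assumption) (simp add: eq del: upt_Suc)
qed

lemma pr_hd_tl: "Suc 0 < k \<Longrightarrow> pr k (\<lambda>xs. hd (tl xs))"
proof (rule pr_cong[OF pr_nth[of 1]])
  fix xs :: "nat list" assume "Suc 0 < k" "length xs = k"
  then show "xs ! 1 = hd (tl xs)" by (cases xs; cases "tl xs") auto
qed simp

lemma pr_nth_tl_tl: "Suc (Suc i) < k \<Longrightarrow> pr k (\<lambda>xs. tl (tl xs) ! i)"
  by (rule pr_cong[OF pr_nth[of "Suc (Suc i)"]]) (auto simp: nth_tl)

lemmas pr_proj = pr_nth pr_hd pr_nth_tl pr_hd_tl pr_nth_tl_tl

lemma pr_add: "pr k A \<Longrightarrow> pr k B \<Longrightarrow> pr k (\<lambda>xs. A xs + B xs)"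
proof (rule pr_comp2[of "(+)"])
  have "pr 2 (\<lambda>xs. rec_nat (xs ! 1) (\<lambda>n y. Suc y) (xs ! 0))"
    by (intro pr_rec pr_Suc pr_proj) auto
  moreover have "rec_nat b (\<lambda>n y. Suc y) a = a + b" for a b by (induction a) auto
  ultimately show "pr 2 (\<lambda>xs. xs ! 0 + xs ! 1)" by simp
qed

lemma pr_mult: "pr k A \<Longrightarrow> pr k B \<Longrightarrow> pr k (\<lambda>xs. A xs * B xs)"
proof (rule pr_comp2[of "(*)"])
  have "pr 2 (\<lambda>xs. rec_nat 0 (\<lambda>n y. y + xs ! 1) (xs ! 0))"
    by (intro pr_rec pr_add pr_const pr_proj) auto
  moreover have "rec_nat 0 (\<lambda>n y. y + b) a = a * b" for a b :: nat by (induction a) auto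
  ultimately show "pr 2 (\<lambda>xs. xs ! 0 * xs ! 1)" by simp
qed

lemma pr_diff: "pr k A \<Longrightarrow> pr k B \<Longrightarrow> pr k (\<lambda>xs. A xs - B xs)"
proof (rule pr_comp2[of "(-)"])
  have "pr 1 (\<lambda>xs. rec_nat 0 (\<lambda>n y. n) (xs ! 0))" by (intro pr_rec pr_const pr_proj) auto
  moreover have "rec_nat 0 (\<lambda>n y. n) a = a - 1" for a :: nat by (cases a) auto
  ultimately have pred: "pr 1 (\<lambda>xs. xs ! 0 - 1)" by simp
  have "pr 2 (\<lambda>xs. rec_nat (xs ! 0) (\<lambda>n y. y - 1) (xs ! 1))"
    by (intro pr_rec pr_comp1[OF pred] pr_proj) auto
  moreover have "rec_nat a (\<lambda>n y. y - 1) b = a - b" for a b :: nat by (induction b) auto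
  ultimately show "pr 2 (\<lambda>xs. xs ! 0 - xs ! 1)" by simp
qed

lemma pr_power2: "pr k A \<Longrightarrow> pr k (\<lambda>xs. 2 ^ A xs)"
proof (rule pr_comp1[of "\<lambda>a. 2 ^ a"])
  have "pr 1 (\<lambda>xs. rec_nat 1 (\<lambda>n y. 2 * y) (xs ! 0))"
    by (intro pr_rec pr_mult pr_const pr_proj) auto
  moreover have "rec_nat (1::nat) (\<lambda>n y. 2 * y) a = 2 ^ a" for a :: nat by (induction a) auto
  ultimately show "pr 1 (\<lambda>xs. 2 ^ (xs ! 0))" by simp
qed

lemma pr_sum:
  assumes "pr k B" "pr (Suc k) (\<lambda>ys. T (hd ys) (tl ys))"
  shows "pr k (\<lambda>xs. \<Sum>i<B xs. T i xs)"
proof -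
  \<comment> \<open>Drops the accumulator, the second argument of the step function, which
    \<open>T\<close> does not take.\<close>
  define h where "h i = (case i of 0 \<Rightarrow> hd | Suc j \<Rightarrow> (\<lambda>ys::nat list. ys ! Suc (Suc j)))" for i
  have h: "pr (Suc (Suc k)) (h i)" if "i < Suc k" for i
    using that pr_nth pr_hd by (cases i) (simp_all add: h_def)
  have eq: "map (\<lambda>i. h i ys) [0..<Suc k] = hd ys # tl (tl ys)" if "length ys = Suc (Suc k)" for ys
    using that by (intro nth_equalityI) (auto simp: h_def nth_Cons nth_tl split: nat.splits simp del: upt_Suc)
  have "pr (Suc (Suc k)) (\<lambda>ys. T (hd ys) (tl (tl ys)))"
    by (rule pr_cong[OF pr_subst[OF assms(2) h]], assumption) (simp add: eq del: upt_Suc)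
  then have "pr k (\<lambda>xs. rec_nat 0 (\<lambda>n y. y + T n xs) (B xs))"
    by (intro pr_rec pr_add pr_const pr_hd_tl assms(1)) auto
  moreover have "rec_nat 0 (\<lambda>n y. y + T n xs) b = (\<Sum>i<b. T i xs)" for b xs by (induction b) auto
  ultimately show ?thesis by simp
qed

definition prR :: "nat \<Rightarrow> (nat list \<Rightarrow> bool) \<Rightarrow> bool" where
  "prR k P \<longleftrightarrow> pr k (\<lambda>xs. of_bool (P xs))"

lemma prR_not: "prR k P \<Longrightarrow> prR k (\<lambda>xs. \<not> P xs)"
proof -
  assume "prR k P"
  then have "pr k (\<lambda>xs. 1 - of_bool (P xs))" unfolding prR_def by (intro pr_diff pr_const)
  then show ?thesis unfolding prR_def by (rule pr_cong) auto
qed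

lemma prR_conj: "prR k P \<Longrightarrow> prR k Q \<Longrightarrow> prR k (\<lambda>xs. P xs \<and> Q xs)"
proof -
  assume "prR k P" "prR k Q"
  then have "pr k (\<lambda>xs. of_bool (P xs) * of_bool (Q xs))" unfolding prR_def by (rule pr_mult)
  then show ?thesis unfolding prR_def by (rule pr_cong) auto
qed

lemma prR_disj: "prR k P \<Longrightarrow> prR k Q \<Longrightarrow> prR k (\<lambda>xs. P xs \<or> Q xs)"
proof -
  assume "prR k P" "prR k Q"
  then have "prR k (\<lambda>xs. \<not> (\<not> P xs \<and> \<not> Q xs))" by (intro prR_not prR_conj)
  then show ?thesis by simp
qed

lemma prR_imp: "prR k P \<Longrightarrow> prR k Q \<Longrightarrow> prR k (\<lambda>xs. P xs \<longrightarrow> Q xs)"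
  unfolding imp_conv_disj by (intro prR_disj prR_not)

lemma prR_less: "pr k A \<Longrightarrow> pr k B \<Longrightarrow> prR k (\<lambda>xs. A xs < B xs)"
proof -
  assume "pr k A" "pr k B"
  then have "pr k (\<lambda>xs. 1 - (1 - (B xs - A xs)))" by (intro pr_diff pr_const)
  moreover have "1 - (1 - (b - a)) = of_bool (a < b)" for a b :: nat by auto
  ultimately show ?thesis unfolding prR_def by simp
qed

lemma prR_eq: "pr k A \<Longrightarrow> pr k B \<Longrightarrow> prR k (\<lambda>xs. A xs = B xs)"
proof -
  assume "pr k A" "pr k B"
  then have "prR k (\<lambda>xs. \<not> A xs < B xs \<and> \<not> B xs < A xs)" by (intro prR_conj prR_not prR_less)
  moreover have "\<not> a < b \<and> \<not> b < a \<longleftrightarrow> a = b" for a b :: nat by auto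
  ultimately show ?thesis by simp
qed

lemma pr_if: "prR k P \<Longrightarrow> pr k A \<Longrightarrow> pr k B \<Longrightarrow> pr k (\<lambda>xs. if P xs then A xs else B xs)"
proof -
  assume "prR k P" "pr k A" "pr k B"
  then have "pr k (\<lambda>xs. of_bool (P xs) * A xs + of_bool (\<not> P xs) * B xs)"
    using prR_not[of k P] unfolding prR_def by (intro pr_add pr_mult)
  then show ?thesis by (rule pr_cong) auto
qed

lemma prR_ball:
  assumes "pr k B" "prR (Suc k) (\<lambda>ys. P (hd ys) (tl ys))"
  shows "prR k (\<lambda>xs. \<forall>i<B xs. P i xs)"
proof -
  have "pr k (\<lambda>xs. \<Sum>i<B xs. of_bool (\<not> P i xs))"
    by (rule pr_sum[OF assms(1)]) (use prR_not[OF assms(2)] in \<open>simp add: prR_def\<close>)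
  then have "prR k (\<lambda>xs. (\<Sum>i<B xs. of_bool (\<not> P i xs)) = (0::nat))" by (intro prR_eq pr_const)
  moreover have "((\<Sum>i<b. of_bool (\<not> P i xs)) = (0::nat)) \<longleftrightarrow> (\<forall>i<b. P i xs)" for b xs by auto
  ultimately show ?thesis by simp
qed

lemma prR_bex:
  assumes "pr k B" "prR (Suc k) (\<lambda>ys. P (hd ys) (tl ys))"
  shows "prR k (\<lambda>xs. \<exists>i<B xs. P i xs)"
  using prR_not[OF prR_ball[OF assms(1) prR_not[OF assms(2)]]] by simp

lemma pr_prod_encode: "pr k A \<Longrightarrow> pr k B \<Longrightarrow> pr k (\<lambda>xs. prod_encode (A xs, B xs))"
proof -
  have tri: "triangle n = (\<Sum>i<n. Suc i)" for n by (induction n) auto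
  have "pr k (\<lambda>xs. (\<Sum>i<A xs + B xs. Suc i) + A xs)" if "pr k A" "pr k B"
    by (intro pr_add pr_sum pr_Suc pr_hd that) auto
  then show "pr k A \<Longrightarrow> pr k B \<Longrightarrow> pr k (\<lambda>xs. prod_encode (A xs, B xs))"
    by (simp add: prod_encode_def tri)
qed

text \<open>Bounded search written as a sum with at most one nonzero summand; a component never
  exceeds the code of the pair.\<close>

lemma prod_decode_fst_sum:
  "fst (prod_decode x) = (\<Sum>a<Suc x. if \<exists>b<Suc x. prod_encode (a, b) = x then a else 0)"
proof -
  obtain a b where x: "x = prod_encode (a, b)" by (metis prod_decode_inverse surj_pair)
  have "(\<exists>b<Suc x. prod_encode (a', b) = x) \<longleftrightarrow> a = a'" for a'
    using le_prod_encode_2[of b a] by (auto simp: x less_Suc_eq_le)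
  then have "(\<Sum>a<Suc x. if \<exists>b<Suc x. prod_encode (a, b) = x then a else 0) = (\<Sum>a'<Suc x. if a = a' then a' else 0)"
    by simp
  also have "\<dots> = a" using le_prod_encode_1[of a b] by (subst sum.delta') (auto simp: x)
  finally show ?thesis by (simp add: x)
qed

lemma prod_decode_snd_sum:
  "snd (prod_decode x) = (\<Sum>b<Suc x. if \<exists>a<Suc x. prod_encode (a, b) = x then b else 0)"
proof -
  obtain a b where x: "x = prod_encode (a, b)" by (metis prod_decode_inverse surj_pair)
  have "(\<exists>a<Suc x. prod_encode (a, b') = x) \<longleftrightarrow> b = b'" for b'
    using le_prod_encode_1[of a b] by (auto simp: x less_Suc_eq_le)
  then have "(\<Sum>b<Suc x. if \<exists>a<Suc x. prod_encode (a, b) = x then b else 0) = (\<Sum>b'<Suc x. if b = b' then b' else 0)"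
    by simp
  also have "\<dots> = b" using le_prod_encode_2[of b a] by (subst sum.delta') (auto simp: x)
  finally show ?thesis by (simp add: x)
qed

lemma pr_fst: "pr k A \<Longrightarrow> pr k (\<lambda>xs. fst (prod_decode (A xs)))"
proof (rule pr_comp1[of "\<lambda>x. fst (prod_decode x)"])
  show "pr 1 (\<lambda>xs. fst (prod_decode (xs ! 0)))"
    unfolding prod_decode_fst_sum
    by (intro pr_sum pr_if prR_bex prR_eq pr_prod_encode pr_Suc pr_const pr_proj) auto
qed

lemma pr_snd: "pr k A \<Longrightarrow> pr k (\<lambda>xs. snd (prod_decode (A xs)))"
proof (rule pr_comp1[of "\<lambda>x. snd (prod_decode x)"])
  show "pr 1 (\<lambda>xs. snd (prod_decode (xs ! 0)))"
    unfolding prod_decode_snd_sum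
    by (intro pr_sum pr_if prR_bex prR_eq pr_prod_encode pr_Suc pr_const pr_proj) auto
qed

text \<open>Bit \<open>m\<close> is set iff the quotient by \<open>2 ^ m\<close> is odd, stated with
  bounded quotient and remainder so that it is visibly primitive recursive.\<close>

lemma in_set_decode_iff:
  "m \<in> set_decode s \<longleftrightarrow> (\<exists>q<Suc s. \<exists>r<2 ^ m. s = (2 * q + 1) * 2 ^ m + r)"
proof
  assume "m \<in> set_decode s"
  then have "odd (s div 2 ^ m)" by (simp add: set_decode_def)
  then obtain q where "s div 2 ^ m = 2 * q + 1" by (auto elim: oddE)
  moreover have "s = s div 2 ^ m * 2 ^ m + s mod 2 ^ m" by (rule div_mult_mod_eq[symmetric])
  ultimately have "s = (2 * q + 1) * 2 ^ m + s mod 2 ^ m" by metis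
  moreover have "q < Suc s"
    using \<open>s div 2 ^ m = 2 * q + 1\<close> div_le_dividend[of s "2 ^ m"] by linarith
  moreover have "s mod 2 ^ m < 2 ^ m" by simp
  ultimately show "\<exists>q<Suc s. \<exists>r<2 ^ m. s = (2 * q + 1) * 2 ^ m + r" by blast
next
  assume "\<exists>q<Suc s. \<exists>r<2 ^ m. s = (2 * q + 1) * 2 ^ m + r"
  then obtain q r where "r < 2 ^ m" "s = (2 * q + 1) * 2 ^ m + r" by blast
  then have "s div 2 ^ m = 2 * q + 1" using div_mult_self3[of "2 ^ m" "2 * q + 1" r] by (simp del: div_mult_self1 div_mult_self2 div_mult_self3 div_mult_self4 add_mult_distrib add_mult_distrib2)
  then show "m \<in> set_decode s" by (simp add: set_decode_def)
qed

lemma prR_in_set_decode: "pr k A \<Longrightarrow> pr k B \<Longrightarrow> prR k (\<lambda>xs. A xs \<in> set_decode (B xs))"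
proof -
  have "prR 2 (\<lambda>xs. xs ! 0 \<in> set_decode (xs ! 1))"
    unfolding in_set_decode_iff
    by (intro prR_bex prR_eq pr_add pr_mult pr_power2 pr_Suc pr_const pr_proj) auto
  then show "pr k A \<Longrightarrow> pr k B \<Longrightarrow> prR k (\<lambda>xs. A xs \<in> set_decode (B xs))"
    unfolding prR_def by (rule pr_comp2)
qed

section \<open>Finite approximations of Hintikka sets\<close>

instance arith_term :: countable by countable_datatype

instance arith_form :: countable by countable_datatype

text \<open>Every number codes an environment that is eventually 0.\<close>

fun env :: "nat \<Rightarrow> nat \<Rightarrow> nat" where
  "env a 0 = fst (prod_decode a)"
| "env a (Suc v) = env (snd (prod_decode a)) v"

fun upd :: "nat \<Rightarrow> nat \<Rightarrow> nat \<Rightarrow> nat" where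
  "upd 0 z a = prod_encode (z, snd (prod_decode a))"
| "upd (Suc v) z a = prod_encode (fst (prod_decode a), upd v z (snd (prod_decode a)))"

lemma env_upd: "env (upd v z a) = (env a)(v := z)"
proof
  fix u show "env (upd v z a) u = ((env a)(v := z)) u"
  proof (induction v arbitrary: a u)
    case 0
    then show ?case by (cases u) auto
  next
    case (Suc v)
    then show ?case by (cases u) auto
  qed
qed

lemma env_0: "env 0 v = 0"
proof (induction v)
  have *: "prod_decode 0 = (0, 0)" by (simp add: prod_decode_def prod_decode_aux.simps)
  {
    case 0
    show ?case by (simp add: *)
  next
    case (Suc v)
    then show ?case by (simp add: *)
  }
qed

lemma env_init: "env (prod_encode (n, 0)) = (\<lambda>_. 0)(0 := n)"
proof
  fix v show "env (prod_encode (n, 0)) v = ((\<lambda>_. 0)(0 := n)) v" by (cases v) (auto simp: env_0)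
qed

text \<open>Together with \<open>le_node\<close> and \<open>in_set_decode_less\<close> this bounds
  the witness of an existential quantifier by the code of the set that contains its node.\<close>

lemma le_upd: "z \<le> upd v z a"
proof (induction v arbitrary: a)
  case (Suc v)
  then show ?case by (metis le_prod_encode_2 le_trans upd.simps(2))
qed (simp add: le_prod_encode_1)

text \<open>Even first components tag formulas with their environment, odd ones membership facts, so
  that one set of numbers holds both.\<close>

definition node :: "arith_form \<Rightarrow> nat \<Rightarrow> nat" where
  "node \<psi> a = prod_encode (2 * to_nat \<psi>, a)"

definition mem_node :: "nat \<Rightarrow> nat \<Rightarrow> nat" where
  "mem_node j v = prod_encode (2 * j + 1, v)"

lemma node_eq [simp]: "node \<psi> a = node \<chi> b \<longleftrightarrow> \<psi> = \<chi> \<and> a = b"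
  by (auto simp: node_def)

lemma mem_node_eq [simp]: "mem_node j v = mem_node j' v' \<longleftrightarrow> j = j' \<and> v = v'"
  by (auto simp: mem_node_def)

lemma node_neq_mem_node [simp]: "node \<psi> a \<noteq> mem_node j v" "mem_node j v \<noteq> node \<psi> a"
  unfolding node_def mem_node_def prod_encode_eq by (simp_all, presburger+)

lemma le_node: "a \<le> node \<psi> a"
  by (simp add: node_def le_prod_encode_2)

text \<open>The closure conditions of a Hintikka set. A finite set can contain only finitely many
  instances of a universal statement, so these are demanded below \<open>k\<close>, which grows
  along the descent. Negated membership speaks about the current set and is checked again in every
  later state.\<close>

fun req :: "arith_form \<Rightarrow> nat \<Rightarrow> nat \<Rightarrow> nat \<Rightarrow> bool" where
  "req (Eq t u) a s k \<longleftrightarrow> eval_term (env a) t = eval_term (env a) u"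
| "req (Less t u) a s k \<longleftrightarrow> eval_term (env a) t < eval_term (env a) u"
| "req (Mem t j) a s k \<longleftrightarrow> mem_node j (eval_term (env a) t) \<in> set_decode s"
| "req (Conj \<psi> \<chi>) a s k \<longleftrightarrow> node \<psi> a \<in> set_decode s \<and> node \<chi> a \<in> set_decode s"
| "req (ExNum v \<psi>) a s k \<longleftrightarrow> (\<exists>z<s. node \<psi> (upd v z a) \<in> set_decode s)"
| "req (Neg (Eq t u)) a s k \<longleftrightarrow> eval_term (env a) t \<noteq> eval_term (env a) u"
| "req (Neg (Less t u)) a s k \<longleftrightarrow> \<not> eval_term (env a) t < eval_term (env a) u"
| "req (Neg (Mem t j)) a s k \<longleftrightarrow> mem_node j (eval_term (env a) t) \<notin> set_decode s"
| "req (Neg (Neg \<psi>)) a s k \<longleftrightarrow> node \<psi> a \<in> set_decode s"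
| "req (Neg (Conj \<psi> \<chi>)) a s k \<longleftrightarrow> node (Neg \<psi>) a \<in> set_decode s \<or> node (Neg \<chi>) a \<in> set_decode s"
| "req (Neg (ExNum v \<psi>)) a s k \<longleftrightarrow> (\<forall>z<k. node (Neg \<psi>) (upd v z a) \<in> set_decode s)"

fun subforms :: "arith_form \<Rightarrow> arith_form list" where
  "subforms (Neg \<psi>) = Neg \<psi> # subforms \<psi>"
| "subforms (Conj \<psi> \<chi>) = Conj \<psi> \<chi> # subforms \<psi> @ subforms \<chi>"
| "subforms (ExNum v \<psi>) = ExNum v \<psi> # subforms \<psi>"
| "subforms \<psi> = [\<psi>]"

text \<open>Contains every formula that \<open>req\<close> can lead to from
  \<open>Neg \<phi>\<close>; as a fixed finite list it turns the quantifier over formulas in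
  \<open>check\<close> into a finite conjunction.\<close>

definition signed_subforms :: "arith_form \<Rightarrow> arith_form list" where
  "signed_subforms \<phi> = subforms \<phi> @ map Neg (subforms \<phi>)"

lemma subforms_refl: "\<phi> \<in> set (subforms \<phi>)"
  by (cases \<phi>) auto

lemma subforms_trans: "\<psi> \<in> set (subforms \<phi>) \<Longrightarrow> set (subforms \<psi>) \<subseteq> set (subforms \<phi>)"
  by (induction \<phi> rule: subforms.induct) auto

text \<open>A state of the descent is a pair of a bound \<open>k\<close> and a finite set \<open>s\<close> of nodes in which all
  nodes below \<open>k\<close> have been processed.\<close>

definition check :: "arith_form \<Rightarrow> nat \<Rightarrow> nat \<Rightarrow> nat \<Rightarrow> bool" where
  "check \<phi> n k s \<longleftrightarrow> node (Neg \<phi>) (prod_encode (n, 0)) \<in> set_decode s \<and>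
     (\<forall>x<k. x \<in> set_decode s \<longrightarrow> (\<forall>\<psi>\<in>set (signed_subforms \<phi>).
        fst (prod_decode x) = 2 * to_nat \<psi> \<longrightarrow> req \<psi> (snd (prod_decode x)) s k))"

text \<open>Elements of a coded set lie below its code, which bounds the inclusion. Only the target
  state is checked: the first number of a descent obtained from a chase is uncontrolled.\<close>

definition descends :: "arith_form \<Rightarrow> nat \<Rightarrow> nat \<Rightarrow> nat \<Rightarrow> bool" where
  "descends \<phi> n x y \<longleftrightarrow> fst (prod_decode y) = Suc (fst (prod_decode x)) \<and>
     (\<forall>m<snd (prod_decode x). m \<in> set_decode (snd (prod_decode x)) \<longrightarrow> m \<in> set_decode (snd (prod_decode y))) \<and>
     check \<phi> n (fst (prod_decode y)) (snd (prod_decode y))"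

lemma pr_env: "pr k A \<Longrightarrow> pr k (\<lambda>xs. env (A xs) v)"
  by (induction v arbitrary: A) (auto intro: pr_fst pr_snd)

lemma pr_upd: "pr k A \<Longrightarrow> pr k Z \<Longrightarrow> pr k (\<lambda>xs. upd v (Z xs) (A xs))"
  by (induction v arbitrary: A) (auto intro!: pr_prod_encode pr_fst pr_snd)

lemma pr_eval_term: "pr k A \<Longrightarrow> pr k (\<lambda>xs. eval_term (env (A xs)) t)"
  by (induction t) (auto intro: pr_env pr_zero pr_Suc pr_add pr_mult)

lemma pr_node: "pr k A \<Longrightarrow> pr k (\<lambda>xs. node \<psi> (A xs))"
  unfolding node_def by (intro pr_prod_encode pr_const)

lemma pr_mem_node: "pr k A \<Longrightarrow> pr k (\<lambda>xs. mem_node j (A xs))"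
  unfolding mem_node_def by (intro pr_prod_encode pr_const)

lemmas pr_intros = pr_env pr_upd pr_eval_term pr_node pr_mem_node prR_conj prR_disj prR_imp prR_not
  prR_eq prR_less prR_ball prR_bex prR_in_set_decode pr_fst pr_snd pr_prod_encode pr_const pr_Suc

lemma prR_req: "prR 3 (\<lambda>xs. req \<psi> (xs ! 0) (xs ! 1) (xs ! 2))"
proof (cases \<psi>)
  case (Neg \<chi>)
  then show ?thesis by (cases \<chi>) (simp_all, (intro pr_intros pr_proj; simp)+)
qed (simp_all, (intro pr_intros pr_proj; simp)+)

lemma prR_list_all: "(\<And>\<psi>. \<psi> \<in> set l \<Longrightarrow> prR k (P \<psi>)) \<Longrightarrow> prR k (\<lambda>xs. \<forall>\<psi>\<in>set l. P \<psi> xs)"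
proof (induction l)
  case Nil
  then show ?case using prR_eq[OF pr_zero pr_zero, of k] by simp
next
  case (Cons \<psi> l)
  then show ?case using prR_conj[of k "P \<psi>" "\<lambda>xs. \<forall>\<psi>\<in>set l. P \<psi> xs"] by simp
qed

lemma prR_subst3:
  assumes "prR 3 (\<lambda>xs. P (xs ! 0) (xs ! 1) (xs ! 2))" "pr k A" "pr k B" "pr k C"
  shows "prR k (\<lambda>xs. P (A xs) (B xs) (C xs))"
proof -
  have "pr k (\<lambda>xs. (\<lambda>xs. of_bool (P (xs ! 0) (xs ! 1) (xs ! 2)))
      (map (\<lambda>i. (if i = 0 then A else if i = 1 then B else C) xs) [0..<3]))"
    by (rule pr_subst) (use assms in \<open>auto simp: prR_def\<close>)
  then show ?thesis by (simp add: prR_def numeral_3_eq_3)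
qed

lemma prR_check: "prR 3 (\<lambda>xs. check \<phi> (xs ! 0) (xs ! 1) (xs ! 2))"
  unfolding check_def
  by (intro pr_intros prR_list_all prR_subst3[OF prR_req] pr_proj; simp)

lemma prR_descends: "prR 3 (\<lambda>xs. descends \<phi> (xs ! 0) (xs ! 1) (xs ! 2))"
  unfolding descends_def
  by (intro pr_intros prR_subst3[OF prR_check] pr_proj; simp)

inductive_cases computes_ZeroE: "computes Zero xs y"
inductive_cases computes_SuccE: "computes Succ xs y"
inductive_cases computes_ProjE: "computes (Proj i) xs y"
inductive_cases computes_CompE: "computes (Comp f gs) xs y"
inductive_cases computes_PrimRec_0E: "computes (PrimRec f g) (0 # xs) y"
inductive_cases computes_PrimRec_SucE: "computes (PrimRec f g) (Suc n # xs) y"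
inductive_cases computes_MuE: "computes (Mu f) xs y"

text \<open>Lets the value 1 of a characteristic function refute the value 0.\<close>

lemma computes_det: "computes f xs y \<Longrightarrow> computes f xs z \<Longrightarrow> y = z"
proof (induction arbitrary: z rule: computes.induct)
  case (1 xs)
  then show ?case by (auto elim: computes_ZeroE)
next
  case (2 x)
  then show ?case by (auto elim: computes_SuccE)
next
  case (3 i xs)
  then show ?case by (auto elim: computes_ProjE)
next
  case (4 xs gs ys f y)
  from 4(4) obtain ys' where ys': "list_all2 (\<lambda>g y. computes g xs y) gs ys'" "computes f ys' z"
    by (rule computes_CompE)
  have "ys = ys'"
    by (rule nth_equalityI) (use 4(1) ys'(1) in \<open>auto simp: list_all2_conv_all_nth\<close>)
  then show ?case using "4.IH"(2) ys'(2) by simp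
next
  case (5 f xs y g)
  from "5.prems" have "computes f xs z" by (rule computes_PrimRec_0E)
  then show ?case by (rule "5.IH")
next
  case (6 f g n xs y w)
  from "6.prems" obtain y' where "computes (PrimRec f g) (n # xs) y'" "computes g (n # y' # xs) z"
    by (rule computes_PrimRec_SucE)
  then show ?case using "6.IH"(1)[of y'] "6.IH"(2)[of z] by simp
next
  case (7 f n xs)
  from "7.prems" have z: "computes f (z # xs) 0" "\<forall>m<z. \<exists>y. computes f (m # xs) (Suc y)"
    by (auto elim: computes_MuE)
  show ?case
  proof (rule linorder_cases)
    assume "n < z"
    then obtain y where "computes f (n # xs) (Suc y)" using z(2) by blast
    then show ?thesis using "7.IH"(1)[of "Suc y"] by simp
  next
    assume "z < n"
    then obtain y where "\<forall>v. computes f (z # xs) v \<longrightarrow> Suc y = v" using "7.IH"(2) by blast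
    then show ?thesis using z(1) by blast
  qed
qed

lemma ex_recf_descends:
  "\<exists>f. no_mu f \<and> (\<forall>n x y. computes f [n, x, y] 0 \<longleftrightarrow> descends \<phi> n x y)"
proof -
  \<comment> \<open>The relation is negated because the stage rule tests for the value 0.\<close>
  obtain f where f: "no_mu f" "\<And>xs. length xs = 3 \<Longrightarrow> computes f xs (of_bool (\<not> descends \<phi> (xs ! 0) (xs ! 1) (xs ! 2)))"
    using prR_not[OF prR_descends[of \<phi>]] unfolding prR_def pr_def by blast
  have "computes f [n, x, y] (of_bool (\<not> descends \<phi> n x y))" for n x y using f(2)[of "[n, x, y]"] by simp
  then have "computes f [n, x, y] 0 \<longleftrightarrow> descends \<phi> n x y" for n x y
    by (metis (full_types) computes_det of_bool_eq_0_iff)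
  then show ?thesis using f(1) by blast
qed

lemma in_set_decode_less: "m \<in> set_decode s \<Longrightarrow> m < s"
proof -
  assume "m \<in> set_decode s"
  then have "odd (s div 2 ^ m)" by (simp add: set_decode_def)
  then have "s div 2 ^ m \<noteq> 0" by (metis even_zero)
  then have "2 ^ m \<le> s" by (meson div_less not_le)
  then show ?thesis using less_exp[of m] by linarith
qed

text \<open>The union of the node sets along an infinite descent is a Hintikka set.\<close>

lemma descent_sound:
  assumes "\<And>i. descends \<phi> n (x i) (x (Suc i))"
  shows "\<exists>X. \<not> holds X ((\<lambda>_. 0)(0 := n)) \<phi>"
proof -
  define k s where "k i = fst (prod_decode (x i))" and "s i = set_decode (snd (prod_decode (x i)))" for i
  have k: "k (Suc i) = Suc (k i)" and sub: "s i \<subseteq> s (Suc i)" for i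
    using assms[of i] in_set_decode_less unfolding descends_def k_def s_def by blast+
  have ch: "check \<phi> n (k (Suc i)) (snd (prod_decode (x (Suc i))))" for i
    using assms[of i] unfolding descends_def k_def by blast
  have mono: "s i \<subseteq> s j" if "i \<le> j" for i j using lift_Suc_mono_le[of s, OF sub that] .
  have ki: "i \<le> k i" for i by (induction i) (auto simp: k)
  define S where "S = (\<Union>i. s i)"
  \<comment> \<open>Nodes persist, so each is present in arbitrarily late states, when the bound has
    passed its code and its requirement is enforced.\<close>
  have late: "\<exists>i\<ge>N. m \<in> s (Suc i)" if m: "m \<in> S" for m N
  proof -
    obtain i where "m \<in> s i" using m by (auto simp: S_def)
    then have "m \<in> s (Suc (max i N))" using mono[of i "Suc (max i N)"] by (auto simp: le_SucI)
    then show ?thesis by (intro exI[of _ "max i N"]) auto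
  qed
  have req: "\<exists>i\<ge>N. req \<psi> a (snd (prod_decode (x (Suc i)))) (k (Suc i))"
    if m: "node \<psi> a \<in> S" and \<psi>: "\<psi> \<in> set (signed_subforms \<phi>)" for \<psi> a N
  proof -
    obtain i where i: "i \<ge> max N (node \<psi> a)" "node \<psi> a \<in> s (Suc i)" using late[OF m] by blast
    have "node \<psi> a < k (Suc i)" using i(1) ki[of "Suc i"] by simp
    then have "req \<psi> a (snd (prod_decode (x (Suc i)))) (k (Suc i))"
      using ch[of i] i(2) \<psi> unfolding check_def s_def by (auto simp: node_def)
    then show ?thesis using i(1) by auto
  qed
  have S: "m \<in> S" if "m \<in> set_decode (snd (prod_decode (x i)))" for m i using that by (auto simp: S_def s_def)
  define X where "X j = {v. mem_node j v \<in> S}" for j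
  have sg: "\<psi> \<in> set (signed_subforms \<phi>)" "Neg \<psi> \<in> set (signed_subforms \<phi>)" if "\<psi> \<in> set (subforms \<phi>)" for \<psi>
    using that by (auto simp: signed_subforms_def)
  \<comment> \<open>Both signs at once: the requirement of a negated formula refers to the negations
    of its parts.\<close>
  have main: "(node \<psi> a \<in> S \<longrightarrow> holds X (env a) \<psi>) \<and> (node (Neg \<psi>) a \<in> S \<longrightarrow> \<not> holds X (env a) \<psi>)"
    if "\<psi> \<in> set (subforms \<phi>)" for \<psi> a
    using that
  proof (induction \<psi> arbitrary: a)
    case (Eq t u)
    show ?case using req[OF _ sg(1)[OF Eq], of a 0] req[OF _ sg(2)[OF Eq], of a 0] by auto
  next
    case (Less t u)
    show ?case using req[OF _ sg(1)[OF Less], of a 0] req[OF _ sg(2)[OF Less], of a 0] by auto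
  next
    case (Mem t j)
    let ?m = "mem_node j (eval_term (env a) t)"
    have "?m \<in> S" if "node (Mem t j) a \<in> S"
      using req[OF that sg(1)[OF Mem], of 0] S by auto
    \<comment> \<open>A membership node stays once it is present, while its absence is demanded in
      arbitrarily late states.\<close>
    moreover have False if n: "node (Neg (Mem t j)) a \<in> S" and "?m \<in> S"
    proof -
      obtain i where i: "?m \<in> s (Suc i)" using late[OF \<open>?m \<in> S\<close>] by blast
      obtain i' where i': "i' \<ge> i" "?m \<notin> s (Suc i')"
        using req[OF n sg(2)[OF Mem], of i] by (auto simp: s_def)
      then show False using i mono[of "Suc i" "Suc i'"] by auto
    qed
    ultimately show ?case by (auto simp: X_def)
  next
    case (Neg \<psi>)
    have \<psi>: "\<psi> \<in> set (subforms \<phi>)" using subforms_trans[OF Neg.prems] subforms_refl[of \<psi>] by auto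
    have "node \<psi> a \<in> S" if "node (Neg (Neg \<psi>)) a \<in> S"
      using req[OF that sg(2)[OF Neg.prems], of 0] S by auto
    then show ?case using Neg.IH[OF \<psi>, of a] by auto
  next
    case (Conj \<psi> \<chi>)
    have sub: "\<psi> \<in> set (subforms \<phi>)" "\<chi> \<in> set (subforms \<phi>)"
      using subforms_trans[OF Conj.prems] subforms_refl[of \<psi>] subforms_refl[of \<chi>] by auto
    have "node \<psi> a \<in> S \<and> node \<chi> a \<in> S" if "node (Conj \<psi> \<chi>) a \<in> S"
      using req[OF that sg(1)[OF Conj.prems], of 0] S by auto
    moreover have "node (Neg \<psi>) a \<in> S \<or> node (Neg \<chi>) a \<in> S" if "node (Neg (Conj \<psi> \<chi>)) a \<in> S"
      using req[OF that sg(2)[OF Conj.prems], of 0] S by auto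
    ultimately show ?case using Conj.IH(1)[OF sub(1), of a] Conj.IH(2)[OF sub(2), of a] by auto
  next
    case (ExNum v \<psi>)
    have \<psi>: "\<psi> \<in> set (subforms \<phi>)" using subforms_trans[OF ExNum.prems] subforms_refl[of \<psi>] by auto
    have IH: "(node \<psi> (upd v z a) \<in> S \<longrightarrow> holds X ((env a)(v := z)) \<psi>) \<and>
        (node (Neg \<psi>) (upd v z a) \<in> S \<longrightarrow> \<not> holds X ((env a)(v := z)) \<psi>)" for z
      using ExNum.IH[OF \<psi>, of "upd v z a"] unfolding env_upd .
    have "\<exists>z. node \<psi> (upd v z a) \<in> S" if "node (ExNum v \<psi>) a \<in> S"
      using req[OF that sg(1)[OF ExNum.prems], of 0] S by auto
    \<comment> \<open>A state with index at least \<open>z\<close> has a bound above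
      \<open>z\<close>, so this instance is among those demanded.\<close>
    moreover have "node (Neg \<psi>) (upd v z a) \<in> S" if neg: "node (Neg (ExNum v \<psi>)) a \<in> S" for z
    proof -
      obtain i where i: "i \<ge> z" "\<forall>z<k (Suc i). node (Neg \<psi>) (upd v z a) \<in> set_decode (snd (prod_decode (x (Suc i))))"
        using req[OF neg sg(2)[OF ExNum.prems], of z] by auto
      have "z < k (Suc i)" using i(1) ki[of "Suc i"] by simp
      then show ?thesis using i(2) S by blast
    qed
    ultimately show ?case using IH unfolding holds.simps by blast
  qed
  have "node (Neg \<phi>) (prod_encode (n, 0)) \<in> S" using ch[of 0] S by (auto simp: check_def)
  then have "\<not> holds X ((\<lambda>_. 0)(0 := n)) \<phi>" using main[OF subforms_refl, of "prod_encode (n, 0)"] by (simp add: env_init)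
  then show ?thesis by blast
qed

text \<open>Cut off the set of all true nodes. For fixed \<open>k\<close> there are finitely many
  requirements, each asking for finitely many true nodes, so every sufficiently late cut passes the
  check.\<close>

lemma descent_complete:
  assumes "\<not> holds X ((\<lambda>_. 0)(0 := n)) \<phi>"
  shows "\<exists>x. \<forall>i. descends \<phi> n (x i) (x (Suc i))"
proof -
  define S where "S = {node \<psi> a | \<psi> a. holds X (env a) \<psi>} \<union> {mem_node j v | j v. v \<in> X j}"
  define e where "e b = set_encode (S \<inter> {..<b})" for b
  have dec: "set_decode (e b) = S \<inter> {..<b}" for b by (simp add: e_def)
  have inS: "node \<psi> a \<in> S \<longleftrightarrow> holds X (env a) \<psi>" "mem_node j v \<in> S \<longleftrightarrow> v \<in> X j" for \<psi> a j v
    by (auto simp: S_def)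
  have ev: "eventually (\<lambda>b. m \<in> set_decode (e b)) sequentially" if "m \<in> S" for m
    using that eventually_gt_at_top[of m] by (auto simp: dec)
  have req: "eventually (\<lambda>b. req \<psi> a (e b) k) sequentially" if "holds X (env a) \<psi>" for \<psi> a k
    using that
  \<comment> \<open>\<open>req\<close> is not recursive, so this is a case distinction on the
    formula; the 0 stands in for the set argument, which varies under
    \<open>eventually\<close>.\<close>
  proof (induction \<psi> a "0::nat" k rule: req.induct)
    case (5 v \<psi> a k)
    then obtain z where "node \<psi> (upd v z a) \<in> S" by (auto simp: inS env_upd)
    from ev[OF this] show ?case
    proof eventually_elim
      case (elim b)
      have "z < e b" using in_set_decode_less[OF elim] le_upd[of z v a] le_node[of "upd v z a" \<psi>] by linarith
      then show ?case using elim by auto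
    qed
  next
    case (10 \<psi> \<chi> a k)
    then have "node (Neg \<psi>) a \<in> S \<or> node (Neg \<chi>) a \<in> S" by (auto simp: inS)
    then show ?case by (auto dest!: ev elim: eventually_mono)
  next
    case (11 v \<psi> a k)
    then have "node (Neg \<psi>) (upd v z a) \<in> S" for z by (auto simp: inS env_upd)
    then have "\<forall>z\<in>{..<k}. eventually (\<lambda>b. node (Neg \<psi>) (upd v z a) \<in> set_decode (e b)) sequentially" using ev by blast
    then have "eventually (\<lambda>b. \<forall>z\<in>{..<k}. node (Neg \<psi>) (upd v z a) \<in> set_decode (e b)) sequentially"
      by (simp add: eventually_ball_finite_distrib)
    then show ?case by (simp add: Ball_def)
  qed (use ev in \<open>auto simp: inS dec intro: eventually_conj\<close>)
  have "eventually (\<lambda>b. check \<phi> n k (e b)) sequentially" for k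
  proof -
    have "eventually (\<lambda>b. x \<in> set_decode (e b) \<longrightarrow> (\<forall>\<psi>\<in>set (signed_subforms \<phi>).
        fst (prod_decode x) = 2 * to_nat \<psi> \<longrightarrow> req \<psi> (snd (prod_decode x)) (e b) k)) sequentially" for x
    proof (cases "\<exists>\<psi> a. x = node \<psi> a \<and> holds X (env a) \<psi>")
      case True
      then obtain \<psi> a where x: "x = node \<psi> a" "holds X (env a) \<psi>" by blast
      from req[OF x(2), of k] show ?thesis by eventually_elim (auto simp: x(1) node_def)
    next
      case False
      have "\<not> (x \<in> S \<and> fst (prod_decode x) = 2 * to_nat \<psi>)" for \<psi> :: arith_form
      proof
        assume *: "x \<in> S \<and> fst (prod_decode x) = 2 * to_nat \<psi>"
        then obtain j v where "x = mem_node j v" using False by (auto simp: S_def)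
        then show False using * by (simp add: mem_node_def) presburger
      qed
      then show ?thesis by (auto simp: dec)
    qed
    then have "\<forall>x\<in>{..<k}. eventually (\<lambda>b. x \<in> set_decode (e b) \<longrightarrow> (\<forall>\<psi>\<in>set (signed_subforms \<phi>).
        fst (prod_decode x) = 2 * to_nat \<psi> \<longrightarrow> req \<psi> (snd (prod_decode x)) (e b) k)) sequentially" by blast
    then have "eventually (\<lambda>b. \<forall>x\<in>{..<k}. x \<in> set_decode (e b) \<longrightarrow> (\<forall>\<psi>\<in>set (signed_subforms \<phi>).
        fst (prod_decode x) = 2 * to_nat \<psi> \<longrightarrow> req \<psi> (snd (prod_decode x)) (e b) k)) sequentially"
      by (subst eventually_ball_finite_distrib) auto
    moreover have "node (Neg \<phi>) (prod_encode (n, 0)) \<in> S" using assms by (simp add: inS env_init)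
    note ev[OF this]
    ultimately show ?thesis by eventually_elim (auto simp: check_def)
  qed
  then obtain B where B: "\<And>k b. b \<ge> B k \<Longrightarrow> check \<phi> n k (e b)" unfolding eventually_sequentially by metis
  \<comment> \<open>Partial sums dominate each \<open>B k\<close> and are monotone, so the cut sets
    grow.\<close>
  define b where "b k = (\<Sum>i\<le>k. B i)" for k
  have bB: "B k \<le> b k" for k unfolding b_def by (rule member_le_sum) auto
  have "descends \<phi> n (prod_encode (i, e (b i))) (prod_encode (Suc i, e (b (Suc i))))" for i
    using B[OF bB[of "Suc i"]] by (auto simp: descends_def dec b_def)
  then show ?thesis by (intro exI[of _ "\<lambda>i. prod_encode (i, e (b i))"]) blast
qed

section \<open>Computability of the reduction\<close>

lemma pr_param_body_code: "pr 1 (\<lambda>xs. list_encode (map atom_code (param_body (xs ! 0))))"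
proof -
  define T where "T n y = Suc (prod_encode (atom_code (aS (Var 0) (Var (Suc n)) (Var (Suc (Suc n)))),
      Suc (prod_encode (atom_code (aN (Var 0) (Var (Suc (Suc n)))), y))))" for n y
  have "pr 1 (\<lambda>xs. rec_nat (list_encode (map atom_code (param_body 0))) (\<lambda>n y. T n y) (xs ! 0))"
    unfolding T_def atom_code_def
    by (intro pr_rec) (simp_all, (intro pr_Suc pr_prod_encode pr_const pr_proj; simp)+)
  moreover have "rec_nat (list_encode (map atom_code (param_body 0))) (\<lambda>n y. T n y) n =
      list_encode (map atom_code (param_body n))" for n
    by (induction n) (simp_all add: T_def)
  ultimately show ?thesis by simp
qed

lemma computable_red_rules: "computable (\<lambda>n. rules_code (red_rules f n))"
proof -
  \<comment> \<open>The code of the rule list spelled out: each \<open>Suc (prod_encode _)\<close>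
    prepends to a list code, 8 is the predicate of \<open>aP\<close>, and
    \<open>prod_encode (0, Suc _)\<close> codes a variable.\<close>
  have "pr 1 (\<lambda>xs. Suc (prod_encode (prod_encode (list_encode (map atom_code (param_body (xs ! 0))),
      Suc (prod_encode (prod_encode (8, Suc (prod_encode (tm_code (Var 0),
        Suc (prod_encode (prod_encode (0, Suc (xs ! 0)), 0))))), 0))),
      rules_code (fixed_rules f))))"
    by (intro pr_Suc pr_prod_encode pr_param_body_code pr_const pr_proj) auto
  then obtain g where g: "\<And>xs. length xs = 1 \<Longrightarrow> computes g xs (Suc (prod_encode (prod_encode (list_encode (map atom_code (param_body (xs ! 0))),
      Suc (prod_encode (prod_encode (8, Suc (prod_encode (tm_code (Var 0),
        Suc (prod_encode (prod_encode (0, Suc (xs ! 0)), 0))))), 0))),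
      rules_code (fixed_rules f))))" unfolding pr_def by blast
  have "computes g [n] (rules_code (red_rules f n))" for n
    using g[of "[n]"] by (simp add: rules_code_def red_rules_def rule_code_def param_rule_def atom_code_def)
  then show ?thesis unfolding computable_def by blast
qed

section \<open>Membership in $\Pi^1_1$\<close>

abbreviation pe :: "nat \<Rightarrow> nat \<Rightarrow> nat" where "pe a b \<equiv> prod_encode (a, b)"
abbreviation pfst :: "nat \<Rightarrow> nat" where "pfst x \<equiv> fst (prod_decode x)"
abbreviation psnd :: "nat \<Rightarrow> nat" where "psnd x \<equiv> snd (prod_decode x)"

text \<open>Unlike \<^const>\<open>prod_encode\<close>, this injective pairing is a term of the language.\<close>

definition tup :: "nat \<Rightarrow> nat \<Rightarrow> nat" where
  "tup a b = (a + b) * (a + b) + a"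

lemma tup_inj [simp]: "tup a b = tup c d \<longleftrightarrow> a = c \<and> b = d"
proof
  assume eq: "tup a b = tup c d"
  have "\<not> a + b < c + d" if "tup a b = tup c d" for a b c d
  proof
    assume "a + b < c + d"
    then have "Suc (a + b) * Suc (a + b) \<le> (c + d) * (c + d)" by (intro mult_le_mono) auto
    then show False using that by (simp add: tup_def)
  qed
  then have "a + b = c + d" using eq by (metis linorder_neqE_nat)
  then show "a = c \<and> b = d" using eq by (simp add: tup_def)
qed simp

definition P2 :: "(nat \<Rightarrow> nat set) \<Rightarrow> nat \<Rightarrow> nat \<Rightarrow> nat \<Rightarrow> bool" where
  "P2 X k a b \<longleftrightarrow> tup a b \<in> X k"

definition P3 :: "(nat \<Rightarrow> nat set) \<Rightarrow> nat \<Rightarrow> nat \<Rightarrow> nat \<Rightarrow> nat \<Rightarrow> bool" where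
  "P3 X k a b c \<longleftrightarrow> tup a (tup b c) \<in> X k"

section \<open>Formulas for relations, pairs and connectives\<close>

abbreviation V :: "nat \<Rightarrow> arith_term" where "V \<equiv> NumVar"

definition Tup :: "arith_term \<Rightarrow> arith_term \<Rightarrow> arith_term" where
  "Tup s t = NumAdd (NumMult (NumAdd s t) (NumAdd s t)) s"

definition Rel2 :: "nat \<Rightarrow> arith_term \<Rightarrow> arith_term \<Rightarrow> arith_form" where
  "Rel2 k s t = Mem (Tup s t) k"

definition Rel3 :: "nat \<Rightarrow> arith_term \<Rightarrow> arith_term \<Rightarrow> arith_term \<Rightarrow> arith_form" where
  "Rel3 k s t u = Mem (Tup s (Tup t u)) k"

text \<open>Both sides are doubled to avoid the division in the triangle numbers.\<close>

definition PE :: "arith_term \<Rightarrow> arith_term \<Rightarrow> arith_term \<Rightarrow> arith_form" where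
  "PE u s t = Eq (NumAdd u u) (NumAdd (NumMult (NumAdd s t) (NumSuc (NumAdd s t))) (NumAdd s s))"

definition Imp :: "arith_form \<Rightarrow> arith_form \<Rightarrow> arith_form" where "Imp \<phi> \<psi> = Neg (Conj \<phi> (Neg \<psi>))"
definition Or :: "arith_form \<Rightarrow> arith_form \<Rightarrow> arith_form" where "Or \<phi> \<psi> = Neg (Conj (Neg \<phi>) (Neg \<psi>))"
definition Iff :: "arith_form \<Rightarrow> arith_form \<Rightarrow> arith_form" where "Iff \<phi> \<psi> = Conj (Imp \<phi> \<psi>) (Imp \<psi> \<phi>)"
definition All :: "nat \<Rightarrow> arith_form \<Rightarrow> arith_form" where "All v \<phi> = Neg (ExNum v (Neg \<phi>))"

primrec Exs :: "nat list \<Rightarrow> arith_form \<Rightarrow> arith_form" where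
  "Exs [] \<phi> = \<phi>" | "Exs (v # vs) \<phi> = ExNum v (Exs vs \<phi>)"

primrec Alls :: "nat list \<Rightarrow> arith_form \<Rightarrow> arith_form" where
  "Alls [] \<phi> = \<phi>" | "Alls (v # vs) \<phi> = All v (Alls vs \<phi>)"

primrec Conjs :: "arith_form list \<Rightarrow> arith_form" where
  "Conjs [] = Eq NumZero NumZero" | "Conjs (\<phi> # \<phi>s) = Conj \<phi> (Conjs \<phi>s)"

lemma holds_Tup: "eval_term e (Tup s t) = tup (eval_term e s) (eval_term e t)"
  by (simp add: Tup_def tup_def)

lemma holds_Rel2: "holds X e (Rel2 k s t) \<longleftrightarrow> P2 X k (eval_term e s) (eval_term e t)"
  by (simp add: Rel2_def P2_def holds_Tup)

lemma holds_Rel3: "holds X e (Rel3 k s t u) \<longleftrightarrow> P3 X k (eval_term e s) (eval_term e t) (eval_term e u)"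
  by (simp add: Rel3_def P3_def holds_Tup)

lemma double_triangle: "2 * triangle n = n * Suc n"
  by (induction n) auto

lemma holds_PE: "holds X e (PE u s t) \<longleftrightarrow> eval_term e u = pe (eval_term e s) (eval_term e t)"
proof -
  have "2 * pe a b = (a + b) * Suc (a + b) + 2 * a" for a b
    using double_triangle[of "a + b"] by (simp add: prod_encode_def)
  then have "u = pe a b \<longleftrightarrow> u + u = (a + b) * Suc (a + b) + (a + a)" for u a b
    by (metis mult_2 mult_left_cancel zero_neq_numeral)
  then show ?thesis by (simp add: PE_def)
qed

lemma holds_connectives:
  "holds X e (Imp \<phi> \<psi>) \<longleftrightarrow> (holds X e \<phi> \<longrightarrow> holds X e \<psi>)"
  "holds X e (Or \<phi> \<psi>) \<longleftrightarrow> holds X e \<phi> \<or> holds X e \<psi>"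
  "holds X e (Iff \<phi> \<psi>) \<longleftrightarrow> (holds X e \<phi> \<longleftrightarrow> holds X e \<psi>)"
  "holds X e (All v \<phi>) \<longleftrightarrow> (\<forall>n. holds X (e(v := n)) \<phi>)"
  by (auto simp: Imp_def Or_def Iff_def All_def)

lemmas holds_simps = holds_Rel2 holds_Rel3 holds_PE holds_connectives

subsection \<open>The chase on codes\<close>

definition nIn :: "nat \<Rightarrow> nat \<Rightarrow> bool" where
  "nIn x l \<longleftrightarrow> x \<in> set (list_decode l)"

text \<open>Tag 0 marks variables. Substitutions are numbers read through \<open>env\<close>; being
  eventually 0 is harmless because a rule has finitely many variables.\<close>

definition nst :: "nat \<Rightarrow> nat \<Rightarrow> nat" where
  "nst s t = (if pfst t = 0 then env s (psnd t) else t)"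

definition nsl :: "nat \<Rightarrow> nat \<Rightarrow> nat" where
  "nsl s l = list_encode (map (nst s) (list_decode l))"

definition nsa :: "nat \<Rightarrow> nat \<Rightarrow> nat" where
  "nsa s a = pe (pfst a) (nsl s (psnd a))"

definition nvar :: "nat \<Rightarrow> nat \<Rightarrow> bool" where
  "nvar l v \<longleftrightarrow> (\<exists>a. nIn a l \<and> nIn (pe 0 v) (psnd a))"

definition nagree :: "nat \<Rightarrow> nat \<Rightarrow> nat \<Rightarrow> bool" where
  "nagree r s s' \<longleftrightarrow> (\<forall>v. nvar (pfst r) v \<longrightarrow> env s' v = env s v)"

definition nall :: "nat set \<Rightarrow> nat \<Rightarrow> nat \<Rightarrow> bool" where
  "nall G l s \<longleftrightarrow> (\<forall>a. nIn a l \<longrightarrow> nsa s a \<in> G)"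

definition nob :: "nat set \<Rightarrow> nat \<Rightarrow> nat \<Rightarrow> bool" where
  "nob G r s \<longleftrightarrow> (\<exists>s'. nagree r s s' \<and> nall G (psnd r) s')"

definition nex :: "nat \<Rightarrow> nat \<Rightarrow> bool" where
  "nex r v \<longleftrightarrow> nvar (psnd r) v \<and> \<not> nvar (pfst r) v"

definition nfresh :: "nat set \<Rightarrow> nat \<Rightarrow> nat \<Rightarrow> bool" where
  "nfresh G r s' \<longleftrightarrow> (\<forall>v. nex r v \<longrightarrow> (\<exists>m. env s' v = pe 2 m) \<and>
     (\<forall>v'. nex r v' \<longrightarrow> env s' v' = env s' v \<longrightarrow> v' = v) \<and> (\<forall>b\<in>G. \<not> nIn (env s' v) (psnd b)))"

definition nstep :: "nat \<Rightarrow> nat set \<Rightarrow> nat set \<Rightarrow> bool" where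
  "nstep n G G' \<longleftrightarrow> (\<exists>r s s'. nIn r n \<and> nall G (pfst r) s \<and> \<not> nob G r s \<and> nagree r s s' \<and> nfresh G r s' \<and>
     (\<forall>b. b \<in> G' \<longleftrightarrow> b \<in> G \<or> (\<exists>a. nIn a (psnd r) \<and> b = nsa s' a)))"

text \<open>Finiteness of a set of numbers is boundedness, and 1 is the tag of constants.\<close>

definition ndatabase :: "nat set \<Rightarrow> bool" where
  "ndatabase G \<longleftrightarrow> (\<exists>m. \<forall>b\<in>G. b < m) \<and> (\<forall>b\<in>G. \<forall>t. nIn t (psnd b) \<longrightarrow> pfst t = 1)"

definition nchase :: "nat \<Rightarrow> (nat \<Rightarrow> nat set) \<Rightarrow> bool" where
  "nchase n F \<longleftrightarrow> ndatabase (F 0) \<and> (\<forall>i. nstep n (F i) (F (Suc i))) \<and>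
     (\<forall>r s i. nIn r n \<longrightarrow> nall (F i) (pfst r) s \<longrightarrow> (\<exists>j\<ge>i. nob (F j) r s))"

text \<open>0 codes the empty list, here an empty head; the tags 0 and 1 exclude nulls as well as
  numbers that code no term.\<close>

definition nwf :: "nat \<Rightarrow> bool" where
  "nwf n \<longleftrightarrow> (\<forall>r. nIn r n \<longrightarrow> psnd r \<noteq> 0 \<and>
     (\<forall>a t. (nIn a (pfst r) \<or> nIn a (psnd r)) \<and> nIn t (psnd a) \<longrightarrow> pfst t = 0 \<or> pfst t = 1))"

text \<open>The form in which \<open>ax_in\<close> states it: such a recursion determines the
  relation because \<open>psnd m\<close> is smaller than \<open>Suc m\<close>.\<close>

lemma nIn_rec: "nIn x l \<longleftrightarrow> (\<exists>m. l = Suc m \<and> (x = pfst m \<or> nIn x (psnd m)))"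
  by (cases l) (auto simp: nIn_def case_prod_beta)

lemma pair_eq: "x = pe a b \<longleftrightarrow> pfst x = a \<and> psnd x = b"
  by (metis fst_conv snd_conv prod.collapse prod_decode_inverse prod_encode_inverse)

lemma env_rec: "env s v = t \<longleftrightarrow> (\<exists>h r. s = pe h r \<and> ((v = 0 \<and> t = h) \<or> (\<exists>u. v = Suc u \<and> env r u = t)))"
  by (cases v) (auto simp: pair_eq)

lemma nsl_rec: "nsl s l = m \<longleftrightarrow> (l = 0 \<and> m = 0) \<or>
   (\<exists>l' m'. l = Suc l' \<and> m = Suc m' \<and> nsl s (psnd l') = psnd m' \<and> nst s (pfst l') = pfst m')"
  by (cases l; cases m) (auto simp: nsl_def pair_eq split: prod.split)

subsection \<open>The defining formula\<close>

text \<open>Set variable 3 holds the chase sequence; the others hold, in this order, the relations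
  \<open>nIn\<close>, \<open>env\<close>, \<open>nsl\<close> (0 to 2), \<open>nsa\<close>, \<open>nvar\<close>, \<open>nagree\<close>, \<open>nall\<close>, \<open>nob\<close>, \<open>nex\<close>, \<open>nfresh\<close> (4 to 10).\<close>

definition ax_in :: arith_form where
  "ax_in = Alls [1, 2] (Iff (Rel2 0 (V 1) (V 2))
     (Exs [3, 4, 5] (Conjs [Eq (V 2) (NumSuc (V 5)), PE (V 5) (V 3) (V 4), Or (Eq (V 1) (V 3)) (Rel2 0 (V 1) (V 4))])))"

definition ax_env :: arith_form where
  "ax_env = Alls [1, 2, 3] (Iff (Rel3 1 (V 1) (V 2) (V 3))
     (Exs [4, 5] (Conjs [PE (V 1) (V 4) (V 5), Or (Conj (Eq (V 2) NumZero) (Eq (V 3) (V 4)))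
        (Exs [6] (Conj (Eq (V 2) (NumSuc (V 6))) (Rel3 1 (V 5) (V 6) (V 3))))])))"

definition ax_list :: arith_form where
  "ax_list = Alls [1, 2, 3] (Iff (Rel3 2 (V 1) (V 2) (V 3))
     (Or (Conj (Eq (V 2) NumZero) (Eq (V 3) NumZero))
       (Exs [8, 9, 4, 5, 6, 7] (Conjs [Eq (V 2) (NumSuc (V 8)), PE (V 8) (V 4) (V 5),
          Eq (V 3) (NumSuc (V 9)), PE (V 9) (V 6) (V 7), Rel3 2 (V 1) (V 5) (V 7),
          Exs [10, 11] (Conjs [PE (V 4) (V 10) (V 11),
            Or (Conj (Eq (V 10) NumZero) (Rel3 1 (V 1) (V 11) (V 6)))
               (Conj (Neg (Eq (V 10) NumZero)) (Eq (V 6) (V 4)))])]))))"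

definition ax_atom :: arith_form where
  "ax_atom = Alls [1, 2, 3] (Iff (Rel3 4 (V 1) (V 2) (V 3))
     (Exs [4, 5, 6] (Conjs [PE (V 2) (V 4) (V 5), PE (V 3) (V 4) (V 6), Rel3 2 (V 1) (V 5) (V 6)])))"

definition ax_var :: arith_form where
  "ax_var = Alls [1, 2] (Iff (Rel2 5 (V 1) (V 2))
     (Exs [3, 4, 5, 6] (Conjs [Rel2 0 (V 3) (V 1), PE (V 3) (V 4) (V 5), PE (V 6) NumZero (V 2), Rel2 0 (V 6) (V 5)])))"

definition ax_agree :: arith_form where
  "ax_agree = Alls [1, 2, 3] (Iff (Rel3 6 (V 1) (V 2) (V 3))
     (Alls [4, 5, 6] (Imp (Conj (PE (V 1) (V 4) (V 5)) (Rel2 5 (V 4) (V 6)))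
        (Exs [7] (Conj (Rel3 1 (V 2) (V 6) (V 7)) (Rel3 1 (V 3) (V 6) (V 7)))))))"

definition ax_all :: arith_form where
  "ax_all = Alls [1, 2, 3] (Iff (Rel3 7 (V 1) (V 2) (V 3))
     (Alls [4] (Imp (Rel2 0 (V 4) (V 1)) (Exs [5] (Conj (Rel3 4 (V 2) (V 4) (V 5)) (Rel2 3 (V 3) (V 5)))))))"

definition ax_ob :: arith_form where
  "ax_ob = Alls [1, 2, 3] (Iff (Rel3 8 (V 1) (V 2) (V 3))
     (Exs [4, 5, 6] (Conjs [PE (V 1) (V 5) (V 6), Rel3 6 (V 1) (V 2) (V 4), Rel3 7 (V 6) (V 4) (V 3)])))"

definition ax_ex :: arith_form where
  "ax_ex = Alls [1, 2] (Iff (Rel2 9 (V 1) (V 2))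
     (Exs [3, 4] (Conjs [PE (V 1) (V 3) (V 4), Rel2 5 (V 4) (V 2), Neg (Rel2 5 (V 3) (V 2))])))"

definition ax_fresh :: arith_form where
  "ax_fresh = Alls [1, 2, 3] (Iff (Rel3 10 (V 1) (V 2) (V 3))
     (Alls [4, 5] (Imp (Conj (Rel2 9 (V 1) (V 4)) (Rel3 1 (V 2) (V 4) (V 5)))
        (Conjs [Exs [6] (PE (V 5) (NumSuc (NumSuc NumZero)) (V 6)),
          Alls [6] (Imp (Conj (Rel2 9 (V 1) (V 6)) (Rel3 1 (V 2) (V 6) (V 5))) (Eq (V 6) (V 4))),
          Alls [6, 7, 8] (Imp (Conj (Rel2 3 (V 3) (V 6)) (PE (V 6) (V 7) (V 8))) (Neg (Rel2 0 (V 5) (V 8))))]))))"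

definition chase_form :: arith_form where
  "chase_form = Conjs [
     Exs [1] (Alls [2] (Imp (Rel2 3 NumZero (V 2)) (Less (V 2) (V 1)))),
     Alls [1, 2, 3, 4] (Imp (Conjs [Rel2 3 NumZero (V 1), PE (V 1) (V 2) (V 3), Rel2 0 (V 4) (V 3)])
       (Exs [5] (PE (V 4) (NumSuc NumZero) (V 5)))),
     Alls [1] (Exs [2, 3, 4, 5, 6] (Conjs [Rel2 0 (V 2) (V 0), PE (V 2) (V 3) (V 4), Rel3 7 (V 3) (V 5) (V 1),
       Neg (Rel3 8 (V 2) (V 5) (V 1)), Rel3 6 (V 2) (V 5) (V 6), Rel3 10 (V 2) (V 6) (V 1),
       Alls [7] (Iff (Rel2 3 (NumSuc (V 1)) (V 7)) (Or (Rel2 3 (V 1) (V 7))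
         (Exs [8] (Conj (Rel2 0 (V 8) (V 4)) (Rel3 4 (V 6) (V 8) (V 7))))))])),
     Alls [1, 2, 3, 4, 5] (Imp (Conjs [Rel2 0 (V 1) (V 0), PE (V 1) (V 2) (V 3), Rel3 7 (V 2) (V 4) (V 5)])
       (Exs [6] (Conj (Less (V 5) (NumSuc (V 6))) (Rel3 8 (V 1) (V 4) (V 6)))))]"

definition wf_form :: arith_form where
  "wf_form = Alls [1, 2, 3] (Imp (Conj (Rel2 0 (V 1) (V 0)) (PE (V 1) (V 2) (V 3)))
     (Conj (Neg (Eq (V 3) NumZero))
       (Alls [4, 5, 6, 7] (Imp (Conjs [Or (Rel2 0 (V 4) (V 2)) (Rel2 0 (V 4) (V 3)), PE (V 4) (V 5) (V 6), Rel2 0 (V 7) (V 6)])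
         (Exs [8] (Or (PE (V 7) NumZero (V 8)) (PE (V 7) (NumSuc NumZero) (V 8))))))))"

text \<open>The axioms fix the relations of all set variables in use except 3, so the quantifier
  over all assignments becomes one over all candidates for a chase sequence.\<close>

definition ct_form :: arith_form where
  "ct_form = Imp (Conjs [ax_in, ax_env, ax_list, ax_atom, ax_var, ax_agree, ax_all, ax_ob, ax_ex, ax_fresh])
     (Conj wf_form (Neg chase_form))"

definition intended :: "(nat \<Rightarrow> nat set) \<Rightarrow> bool" where
  "intended X \<longleftrightarrow> (\<forall>x l. P2 X 0 x l \<longleftrightarrow> nIn x l) \<and> (\<forall>s v t. P3 X 1 s v t \<longleftrightarrow> env s v = t) \<and>
     (\<forall>s l m. P3 X 2 s l m \<longleftrightarrow> nsl s l = m) \<and> (\<forall>s a b. P3 X 4 s a b \<longleftrightarrow> nsa s a = b) \<and>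
     (\<forall>l v. P2 X 5 l v \<longleftrightarrow> nvar l v) \<and> (\<forall>r s s'. P3 X 6 r s s' \<longleftrightarrow> nagree r s s') \<and>
     (\<forall>l s i. P3 X 7 l s i \<longleftrightarrow> nall {b. P2 X 3 i b} l s) \<and> (\<forall>r s i. P3 X 8 r s i \<longleftrightarrow> nob {b. P2 X 3 i b} r s) \<and>
     (\<forall>r v. P2 X 9 r v \<longleftrightarrow> nex r v) \<and> (\<forall>r s i. P3 X 10 r s i \<longleftrightarrow> nfresh {b. P2 X 3 i b} r s)"

lemma holds_ax:
  "holds X e ax_in \<longleftrightarrow> (\<forall>x l. P2 X 0 x l \<longleftrightarrow> (\<exists>m. l = Suc m \<and> (x = pfst m \<or> P2 X 0 x (psnd m))))"
  "holds X e ax_env \<longleftrightarrow> (\<forall>s v t. P3 X 1 s v t \<longleftrightarrow>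
     (\<exists>h r. s = pe h r \<and> ((v = 0 \<and> t = h) \<or> (\<exists>u. v = Suc u \<and> P3 X 1 r u t))))"
  "holds X e ax_list \<longleftrightarrow> (\<forall>s l m. P3 X 2 s l m \<longleftrightarrow> (l = 0 \<and> m = 0) \<or>
     (\<exists>l' m'. l = Suc l' \<and> m = Suc m' \<and> P3 X 2 s (psnd l') (psnd m') \<and>
        (pfst (pfst l') = 0 \<and> P3 X 1 s (psnd (pfst l')) (pfst m') \<or> pfst (pfst l') \<noteq> 0 \<and> pfst m' = pfst l')))"
  "holds X e ax_atom \<longleftrightarrow> (\<forall>s a b. P3 X 4 s a b \<longleftrightarrow> pfst b = pfst a \<and> P3 X 2 s (psnd a) (psnd b))"
  "holds X e ax_var \<longleftrightarrow> (\<forall>l v. P2 X 5 l v \<longleftrightarrow> (\<exists>a. P2 X 0 a l \<and> (\<exists>y. pfst y = 0 \<and> psnd y = v \<and> P2 X 0 y (psnd a))))"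
  "holds X e ax_agree \<longleftrightarrow> (\<forall>r s s'. P3 X 6 r s s' \<longleftrightarrow>
     (\<forall>v. P2 X 5 (pfst r) v \<longrightarrow> (\<exists>t. P3 X 1 s v t \<and> P3 X 1 s' v t)))"
  "holds X e ax_all \<longleftrightarrow> (\<forall>l s i. P3 X 7 l s i \<longleftrightarrow> (\<forall>a. P2 X 0 a l \<longrightarrow> (\<exists>b. P3 X 4 s a b \<and> P2 X 3 i b)))"
  "holds X e ax_ob \<longleftrightarrow> (\<forall>r s i. P3 X 8 r s i \<longleftrightarrow> (\<exists>s'. P3 X 6 r s s' \<and> P3 X 7 (psnd r) s' i))"
  "holds X e ax_ex \<longleftrightarrow> (\<forall>r v. P2 X 9 r v \<longleftrightarrow> P2 X 5 (psnd r) v \<and> \<not> P2 X 5 (pfst r) v)"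
  "holds X e ax_fresh \<longleftrightarrow> (\<forall>r s i. P3 X 10 r s i \<longleftrightarrow> (\<forall>v t. P2 X 9 r v \<and> P3 X 1 s v t \<longrightarrow>
     (\<exists>m. t = pe 2 m) \<and> (\<forall>v'. P2 X 9 r v' \<and> P3 X 1 s v' t \<longrightarrow> v' = v) \<and>
     (\<forall>b. P2 X 3 i b \<longrightarrow> \<not> P2 X 0 t (psnd b))))"
  by (simp_all add: ax_in_def ax_env_def ax_list_def ax_atom_def ax_var_def ax_agree_def ax_all_def ax_ob_def
      ax_ex_def ax_fresh_def holds_simps pair_eq numeral_2_eq_2)

lemma holds_chase_form:
  assumes "intended X"
  shows "holds X e chase_form \<longleftrightarrow> nchase (e 0) (\<lambda>i. {b. P2 X 3 i b})"
proof -
  have ax: "P2 X 0 x l \<longleftrightarrow> nIn x l" "P3 X 1 s v t \<longleftrightarrow> env s v = t" "P3 X 4 s a b \<longleftrightarrow> nsa s a = b"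
    "P3 X 6 r s s' \<longleftrightarrow> nagree r s s'" "P3 X 7 l s i \<longleftrightarrow> nall {b. P2 X 3 i b} l s"
    "P3 X 8 r s i \<longleftrightarrow> nob {b. P2 X 3 i b} r s" "P3 X 10 r s i \<longleftrightarrow> nfresh {b. P2 X 3 i b} r s"
    for x l s v t a b r s' i
    using assms by (simp_all add: intended_def)
  have ex: "(\<exists>c. y = pe 1 c) \<longleftrightarrow> pfst y = 1" for y by (auto simp: pair_eq)
  have "holds X e chase_form \<longleftrightarrow>
     (\<exists>m. \<forall>b. P2 X 3 0 b \<longrightarrow> b < m) \<and> (\<forall>b. P2 X 3 0 b \<longrightarrow> (\<forall>t. nIn t (psnd b) \<longrightarrow> pfst t = 1)) \<and>
     (\<forall>i. \<exists>r s s'. nIn r (e 0) \<and> nall {b. P2 X 3 i b} (pfst r) s \<and> \<not> nob {b. P2 X 3 i b} r s \<and> nagree r s s' \<and>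
        nfresh {b. P2 X 3 i b} r s' \<and>
        (\<forall>b. P2 X 3 (Suc i) b \<longleftrightarrow> P2 X 3 i b \<or> (\<exists>a. nIn a (psnd r) \<and> nsa s' a = b))) \<and>
     (\<forall>r. nIn r (e 0) \<longrightarrow> (\<forall>s i. nall {b. P2 X 3 i b} (pfst r) s \<longrightarrow> (\<exists>j. i < Suc j \<and> nob {b. P2 X 3 j b} r s)))"
    by (simp add: chase_form_def holds_simps ax pair_eq imp_conjL)
  also have "\<dots> \<longleftrightarrow> nchase (e 0) (\<lambda>i. {b. P2 X 3 i b})"
    unfolding nchase_def ndatabase_def nstep_def by (simp add: less_Suc_eq_le eq_commute)
  finally show ?thesis .
qed

lemma holds_wf_form:
  assumes "intended X"
  shows "holds X e wf_form \<longleftrightarrow> nwf (e 0)"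
proof -
  have ax: "P2 X 0 x l \<longleftrightarrow> nIn x l" for x l using assms by (simp add: intended_def)
  show ?thesis by (simp add: wf_form_def nwf_def holds_simps ax pair_eq ex_disj_distrib)
qed

text \<open>The recursive relations are recovered by induction, on the list code for
  \<open>nIn\<close> and \<open>nsl\<close> and on the variable for \<open>env\<close>; the
  remaining axioms are explicit definitions.\<close>

lemma intended_ax:
  "holds X e (Conjs [ax_in, ax_env, ax_list, ax_atom, ax_var, ax_agree, ax_all, ax_ob, ax_ex, ax_fresh]) \<longleftrightarrow> intended X"
  (is "?l \<longleftrightarrow> ?r")
proof
  assume ?l
  then have ax: "holds X e ax_in" "holds X e ax_env" "holds X e ax_list" "holds X e ax_atom" "holds X e ax_var"
    "holds X e ax_agree" "holds X e ax_all" "holds X e ax_ob" "holds X e ax_ex" "holds X e ax_fresh" by simp_all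
  note ax = ax[unfolded holds_ax, rule_format]
  have psnd_less: "psnd m < Suc m" for m
    by (metis le_imp_less_Suc le_prod_encode_2 prod.collapse prod_decode_inverse)
  have In: "P2 X 0 x l \<longleftrightarrow> nIn x l" for x l
  proof (induction l rule: less_induct)
    case (less l)
    show ?case
    proof (cases l)
      case 0
      then show ?thesis using ax(1)[of x l] nIn_rec[of x l] by simp
    next
      case (Suc m)
      then show ?thesis using ax(1)[of x l] nIn_rec[of x l] less[of "psnd m"] psnd_less[of m] by simp
    qed
  qed
  have E: "P3 X 1 s v t \<longleftrightarrow> env s v = t" for s v t
  proof (induction v arbitrary: s)
    case 0
    then show ?case using ax(2)[of s 0 t] env_rec[of s 0 t] by simp
  next
    case (Suc v)
    then show ?case using ax(2)[of s "Suc v" t] env_rec[of s "Suc v" t] by simp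
  qed
  note E' = E[unfolded One_nat_def]
  have L: "P3 X 2 s l m \<longleftrightarrow> nsl s l = m" for s l m
  proof (induction l arbitrary: m rule: less_induct)
    case (less l)
    show ?case
    proof (cases l)
      case 0
      then show ?thesis using ax(3)[of s l m] nsl_rec[of s l m] by simp
    next
      case (Suc l')
      then show ?thesis
        using ax(3)[of s l m] nsl_rec[of s l m] less[of "psnd l'"] psnd_less[of l'] by (auto simp: E' nst_def)
    qed
  qed
  have A: "P3 X 4 s a b \<longleftrightarrow> nsa s a = b" for s a b
    using ax(4)[of s a b] pair_eq[of b "pfst a" "nsl s (psnd a)"] by (auto simp: L nsa_def)
  have Va: "P2 X 5 l v \<longleftrightarrow> nvar l v" for l v
    using ax(5)[of l v] by (simp add: In nvar_def) (metis pair_eq)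
  have Ag: "P3 X 6 r s s' \<longleftrightarrow> nagree r s s'" for r s s'
    using ax(6)[of r s s'] by (simp add: Va E' nagree_def)
  have Al: "P3 X 7 l s i \<longleftrightarrow> nall {b. P2 X 3 i b} l s" for l s i
    using ax(7)[of l s i] by (auto simp: In A nall_def)
  have O: "P3 X 8 r s i \<longleftrightarrow> nob {b. P2 X 3 i b} r s" for r s i
    using ax(8)[of r s i] by (auto simp: Ag Al nob_def)
  have Ex: "P2 X 9 r v \<longleftrightarrow> nex r v" for r v
    using ax(9)[of r v] by (auto simp: Va nex_def)
  have Fr: "P3 X 10 r s i \<longleftrightarrow> nfresh {b. P2 X 3 i b} r s" for r s i
    using ax(10)[of r s i] by (simp add: Ex E' In nfresh_def imp_conjL)
  show ?r unfolding intended_def using In E L A Va Ag Al O Ex Fr by blast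
next
  assume ?r
  then have ax: "P2 X 0 x l \<longleftrightarrow> nIn x l" "P3 X 1 s v t \<longleftrightarrow> env s v = t" "P3 X 2 s l m \<longleftrightarrow> nsl s l = m"
    "P3 X 4 s a b \<longleftrightarrow> nsa s a = b" "P2 X 5 l v \<longleftrightarrow> nvar l v"
    "P3 X 6 r s s' \<longleftrightarrow> nagree r s s'" "P3 X 7 l s i \<longleftrightarrow> nall {b. P2 X 3 i b} l s"
    "P3 X 8 r s i \<longleftrightarrow> nob {b. P2 X 3 i b} r s" "P2 X 9 r v \<longleftrightarrow> nex r v"
    "P3 X 10 r s i \<longleftrightarrow> nfresh {b. P2 X 3 i b} r s"
    for x l s v t a b r s' i m
    by (simp_all add: intended_def)
  have "holds X e ax_in" unfolding holds_ax ax using nIn_rec by blast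
  moreover have "holds X e ax_env" unfolding holds_ax ax using env_rec by blast
  moreover have "holds X e ax_list"
    unfolding holds_ax ax
  proof (intro allI)
    fix s l m
    show "nsl s l = m \<longleftrightarrow> l = 0 \<and> m = 0 \<or> (\<exists>l' m'. l = Suc l' \<and> m = Suc m' \<and> nsl s (psnd l') = psnd m' \<and>
      (pfst (pfst l') = 0 \<and> env s (psnd (pfst l')) = pfst m' \<or> pfst (pfst l') \<noteq> 0 \<and> pfst m' = pfst l'))"
      using nsl_rec[of s l m] by (auto simp: nst_def)
  qed
  moreover have "holds X e ax_atom" 
    unfolding holds_ax ax nsa_def
    by (intro allI, subst eq_commute, subst pair_eq) (simp add: eq_commute)
  moreover have "holds X e ax_var" unfolding holds_ax ax nvar_def by (metis pair_eq)
  moreover have "holds X e ax_agree" unfolding holds_ax ax nagree_def by simp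
  moreover have "holds X e ax_all" unfolding holds_ax ax nall_def by simp
  moreover have "holds X e ax_ob" unfolding holds_ax ax nob_def by simp
  moreover have "holds X e ax_ex" unfolding holds_ax ax nex_def by simp
  moreover have "holds X e ax_fresh" unfolding holds_ax ax nfresh_def by (simp add: imp_conjL)
  ultimately show ?l by simp
qed

text \<open>Guarantees that no sequence is lost by guarding the formula with the axioms, and that
  the guard is satisfiable, from which \<open>nwf\<close> follows.\<close>

lemma ex_intended: "\<exists>X. intended X \<and> (\<forall>i b. P2 X 3 i b \<longleftrightarrow> b \<in> F i)"
proof -
  define X where "X k = (if k = 0 then {tup x l | x l. nIn x l}
    else if k = 1 then {tup s (tup v (env s v)) | s v. True}
    else if k = 2 then {tup s (tup l (nsl s l)) | s l. True}
    else if k = 3 then {tup i b | i b. b \<in> F i}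
    else if k = 4 then {tup s (tup a (nsa s a)) | s a. True}
    else if k = 5 then {tup l v | l v. nvar l v}
    else if k = 6 then {tup r (tup s s') | r s s'. nagree r s s'}
    else if k = 7 then {tup l (tup s i) | l s i. nall (F i) l s}
    else if k = 8 then {tup r (tup s i) | r s i. nob (F i) r s}
    else if k = 9 then {tup r v | r v. nex r v}
    else {tup r (tup s i) | r s i. nfresh (F i) r s})" for k :: nat
  have 3: "P2 X 3 i b \<longleftrightarrow> b \<in> F i" for i b by (auto simp: P2_def X_def)
  then have S: "{b. P2 X 3 i b} = F i" for i by simp
  have "intended X"
    unfolding intended_def S by (auto simp: P2_def P3_def X_def)
  then show ?thesis using 3 by blast
qed

lemma ct_form_iff:
  "(\<forall>X. holds X ((\<lambda>_. 0)(0 := n)) ct_form) \<longleftrightarrow> nwf n \<and> \<not> (\<exists>F. nchase n F)"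
proof -
  have "holds X ((\<lambda>_. 0)(0 := n)) ct_form \<longleftrightarrow> (intended X \<longrightarrow> nwf n \<and> \<not> nchase n (\<lambda>i. {b. P2 X 3 i b}))" for X
    unfolding ct_form_def holds_connectives intended_ax
    using holds_chase_form[of X "(\<lambda>_. 0)(0 := n)"] holds_wf_form[of X "(\<lambda>_. 0)(0 := n)"] by auto
  moreover have "\<exists>X. intended X \<and> (\<lambda>i. {b. P2 X 3 i b}) = F" for F
    using ex_intended[of F] by auto
  ultimately show ?thesis by metis
qed

subsection \<open>Codes of rules and of chase sequences\<close>

lemma ex_env: "\<exists>s. \<forall>v<N. env s v = g v"
proof (induction N arbitrary: g)
  case (Suc N)
  obtain s where s: "\<forall>v<N. env s v = g (Suc v)" using Suc[of "\<lambda>v. g (Suc v)"] by blast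
  have "env (pe (g 0) s) v = g v" if "v < Suc N" for v using that s by (cases v) auto
  then show ?case by blast
qed simp

definition enc_on :: "nat set \<Rightarrow> nat \<Rightarrow> (nat \<Rightarrow> tm) \<Rightarrow> bool" where
  "enc_on U s \<tau> \<longleftrightarrow> (\<forall>v\<in>U. env s v = tm_code (\<tau> v))"

lemma enc_on_mono: "enc_on U s \<tau> \<Longrightarrow> U' \<subseteq> U \<Longrightarrow> enc_on U' s \<tau>"
  by (auto simp: enc_on_def)

lemma ex_enc_on: "finite U \<Longrightarrow> \<exists>s. enc_on U s \<tau>"
proof -
  assume "finite U"
  then obtain N where "\<And>v. v \<in> U \<Longrightarrow> v < N" by (meson finite_nat_set_iff_bounded)
  then show ?thesis using ex_env[of N "\<lambda>v. tm_code (\<tau> v)"] by (auto simp: enc_on_def)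
qed

definition dec :: "nat \<Rightarrow> nat \<Rightarrow> tm" where
  "dec s v = inv tm_code (env s v)"

lemma enc_on_dec: "enc_on U s (dec s) \<longleftrightarrow> (\<forall>v\<in>U. env s v \<in> range tm_code)"
  by (auto simp: enc_on_def dec_def f_inv_into_f)

lemma nst_tm_code:
  assumes "\<And>v. t = Var v \<Longrightarrow> env s v = tm_code (\<tau> v)"
  shows "nst s (tm_code t) = tm_code (inst_tm \<tau> t)"
  using assms by (cases t) (auto simp: nst_def)

lemma nIn_list_encode [simp]: "nIn x (list_encode xs) \<longleftrightarrow> x \<in> set xs"
  by (simp add: nIn_def)

lemma nsa_atom_code:
  assumes "enc_on (atom_vars a) s \<tau>"
  shows "nsa s (atom_code a) = atom_code (inst \<tau> a)"
proof -
  have "nst s (tm_code t) = tm_code (inst_tm \<tau> t)" if "t \<in> set (args a)" for t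
    using assms that by (intro nst_tm_code) (auto simp: enc_on_def atom_vars_def)
  then show ?thesis by (simp add: nsa_def nsl_def atom_code_def inst_def list_encode_eq)
qed

text \<open>An environment may hold numbers that code no term. They would show up as arguments of
  the instantiated atoms, so a trigger loaded for a set of atom codes does not use them.\<close>

lemma nsa_range:
  assumes "nsa s (atom_code a) \<in> range atom_code"
  shows "enc_on (atom_vars a) s (dec s)"
proof -
  obtain b where b: "nsa s (atom_code a) = atom_code b" using assms by blast
  then have "map (\<lambda>t. nst s (tm_code t)) (args a) = map tm_code (args b)"
    by (simp add: nsa_def nsl_def atom_code_def list_encode_eq comp_def)
  then have "nst s (tm_code t) \<in> range tm_code" if "t \<in> set (args a)" for t
  proof -
    have "nst s (tm_code t) \<in> set (map (\<lambda>t. nst s (tm_code t)) (args a))" using that by simp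
    then show ?thesis unfolding \<open>map (\<lambda>t. nst s (tm_code t)) (args a) = map tm_code (args b)\<close> by auto
  qed
  then have "env s v \<in> range tm_code" if "v \<in> atom_vars a" for v
    using that by (force simp: atom_vars_def nst_def)
  then show ?thesis by (simp add: enc_on_dec)
qed

lemma nIn_args_code: "nIn (tm_code t) (psnd (atom_code a)) \<longleftrightarrow> t \<in> set (args a)"
  by (simp add: atom_code_def inj_image_mem_iff[OF inj_tm_code])

lemma nvar_code: "nvar (list_encode (map atom_code as)) v \<longleftrightarrow> v \<in> (\<Union>a\<in>set as. atom_vars a)"
  using nIn_args_code[of "Var v"] by (auto simp: nvar_def atom_vars_def)

lemma rule_code_parts [simp]:
  "pfst (rule_code R) = list_encode (map atom_code (body R))"
  "psnd (rule_code R) = list_encode (map atom_code (head R))"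
  by (simp_all add: rule_code_def)

lemma nex_code: "nex (rule_code R) v \<longleftrightarrow> v \<in> exist_vars R"
  by (simp add: nex_def nvar_code exist_vars_def univ_vars_def)

lemma nagree_code:
  "nagree (rule_code R) s s' \<longleftrightarrow> (\<forall>v\<in>univ_vars R. env s' v = env s v)"
  by (auto simp: nagree_def nvar_code univ_vars_def)

lemma nall_code:
  assumes "enc_on (\<Union>a\<in>set as. atom_vars a) s \<tau>"
  shows "nall (atom_code ` A) (list_encode (map atom_code as)) s \<longleftrightarrow> (\<forall>a\<in>set as. inst \<tau> a \<in> A)"
proof -
  have "nsa s (atom_code a) = atom_code (inst \<tau> a)" if "a \<in> set as" for a
    using assms that by (intro nsa_atom_code) (auto elim: enc_on_mono)
  moreover have "nall (atom_code ` A) (list_encode (map atom_code as)) s \<longleftrightarrow>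
      (\<forall>a\<in>set as. nsa s (atom_code a) \<in> atom_code ` A)"
    by (auto simp: nall_def)
  ultimately show ?thesis by (simp add: inj_image_mem_iff[OF inj_atom_code])
qed

lemma nall_dec:
  assumes "nall (atom_code ` A) (list_encode (map atom_code as)) s"
  shows "enc_on (\<Union>a\<in>set as. atom_vars a) s (dec s)"
proof -
  have "enc_on (atom_vars a) s (dec s)" if "a \<in> set as" for a
    using assms that by (intro nsa_range) (auto simp: nall_def)
  then show ?thesis by (auto simp: enc_on_def)
qed

lemma nld_code: "enc_on (univ_vars R) s \<tau> \<Longrightarrow> nall (atom_code ` A) (pfst (rule_code R)) s \<longleftrightarrow> ld R \<tau> A"
  using nall_code[of "body R" s \<tau> A] by (simp add: ld_def univ_vars_def)

lemma head_vars: "(\<Union>a\<in>set (head R). atom_vars a) \<subseteq> univ_vars R \<union> exist_vars R"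
  by (auto simp: exist_vars_def)

lemma finite_rule_vars: "finite (univ_vars R \<union> exist_vars R)"
proof -
  have "finite (\<Union>a\<in>set (head R). atom_vars a)" using finite_univ_vars[of "Rule (head R) []"] by (simp add: univ_vars_def)
  then show ?thesis using finite_univ_vars by (simp add: exist_vars_def)
qed

lemma nob_code:
  assumes e: "enc_on (univ_vars R) s \<tau>"
  shows "nob (atom_code ` A) (rule_code R) s \<longleftrightarrow> ob R \<tau> A"
proof
  assume "nob (atom_code ` A) (rule_code R) s"
  then obtain s' where s': "\<forall>v\<in>univ_vars R. env s' v = env s v"
    "nall (atom_code ` A) (list_encode (map atom_code (head R))) s'"
    by (auto simp: nob_def nagree_code)
  have "env s' v \<in> range tm_code" if "v \<in> univ_vars R" for v using s'(1) e that by (auto simp: enc_on_def)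
  then have "agree R \<tau> (dec s')"
    using s'(1) e unfolding agree_def enc_on_def dec_def by (auto simp: inv_f_f[OF inj_tm_code])
  moreover have "\<forall>a\<in>set (head R). inst (dec s') a \<in> A"
    using nall_code[OF nall_dec[OF s'(2)]] s'(2) by blast
  ultimately show "ob R \<tau> A" by (auto simp: ob_def)
next
  assume "ob R \<tau> A"
  then obtain \<tau>' where \<tau>': "agree R \<tau> \<tau>'" "\<forall>a\<in>set (head R). inst \<tau>' a \<in> A" by (auto simp: ob_def)
  obtain s' where s': "enc_on (univ_vars R \<union> exist_vars R) s' \<tau>'" using ex_enc_on[OF finite_rule_vars] by blast
  have "nall (atom_code ` A) (psnd (rule_code R)) s'"
    using nall_code[of "head R" s' \<tau>' A] enc_on_mono[OF s' head_vars] \<tau>'(2) by simp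
  moreover have "nagree (rule_code R) s s'"
    using s' e \<tau>'(1) by (auto simp: nagree_code enc_on_def agree_def)
  ultimately show "nob (atom_code ` A) (rule_code R) s" by (auto simp: nob_def)
qed

lemma nfresh_code:
  assumes e: "enc_on (exist_vars R) s' \<tau>'"
  shows "nfresh (atom_code ` A) (rule_code R) s' \<longleftrightarrow> inj_on \<tau>' (exist_vars R) \<and>
     (\<forall>z\<in>exist_vars R. \<exists>n. \<tau>' z = Null n \<and> n \<notin> nulls A)"
proof -
  have v: "env s' v = tm_code (\<tau>' v)" if "v \<in> exist_vars R" for v using e that by (simp add: enc_on_def)
  have null: "(\<exists>m. tm_code t = pe 2 m) \<longleftrightarrow> (\<exists>m. t = Null m)" for t by (cases t) auto
  have "nfresh (atom_code ` A) (rule_code R) s' \<longleftrightarrow> (\<forall>v\<in>exist_vars R. (\<exists>m. \<tau>' v = Null m) \<and>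
     (\<forall>v'\<in>exist_vars R. \<tau>' v' = \<tau>' v \<longrightarrow> v' = v) \<and> (\<forall>a\<in>A. \<tau>' v \<notin> set (args a)))"
    (is "_ \<longleftrightarrow> ?m")
  proof -
    have "nfresh (atom_code ` A) (rule_code R) s' \<longleftrightarrow> (\<forall>v\<in>exist_vars R. (\<exists>m. env s' v = pe 2 m) \<and>
       (\<forall>v'\<in>exist_vars R. env s' v' = env s' v \<longrightarrow> v' = v) \<and> (\<forall>a\<in>A. \<not> nIn (env s' v) (psnd (atom_code a))))"
      unfolding nfresh_def nex_code by blast
    also have "\<dots> \<longleftrightarrow> ?m"
      by (rule ball_cong[OF refl]) (simp add: v null nIn_args_code inj_eq[OF inj_tm_code] cong: ball_cong)
    finally show ?thesis .
  qed
  also have "\<dots> \<longleftrightarrow> inj_on \<tau>' (exist_vars R) \<and> (\<forall>z\<in>exist_vars R. \<exists>n. \<tau>' z = Null n \<and> n \<notin> nulls A)"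
  proof -
    have "(\<forall>a\<in>A. Null m \<notin> set (args a)) \<longleftrightarrow> m \<notin> nulls A" for m by (auto simp: nulls_def atom_nulls_def)
    then have "(\<exists>m. t = Null m) \<and> (\<forall>a\<in>A. t \<notin> set (args a)) \<longleftrightarrow> (\<exists>m. t = Null m \<and> m \<notin> nulls A)" for t by auto
    moreover have "inj_on \<tau>' (exist_vars R) \<longleftrightarrow> (\<forall>v\<in>exist_vars R. \<forall>v'\<in>exist_vars R. \<tau>' v' = \<tau>' v \<longrightarrow> v' = v)"
      unfolding inj_on_def by metis
    ultimately show ?thesis by (simp add: ball_conj_distrib) blast
  qed
  finally show ?thesis .
qed

lemma nIn_rules_code [simp]: "nIn r (rules_code Rs) \<longleftrightarrow> r \<in> rule_code ` set Rs"
  by (auto simp: rules_code_def)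

text \<open>Universal variables decode because the body is loaded, existential ones because
  \<open>nfresh\<close> prescribes tag 2. Hence a step from a set of atom codes leads to such a set
  again.\<close>

lemma nstep_code: "nstep (rules_code Rs) (atom_code ` A) G' \<longleftrightarrow> (\<exists>A'. G' = atom_code ` A' \<and> step (set Rs) A A')"
proof
  assume "nstep (rules_code Rs) (atom_code ` A) G'"
  then obtain R s s' where R: "R \<in> set Rs" and l: "nall (atom_code ` A) (pfst (rule_code R)) s"
    and o: "\<not> nob (atom_code ` A) (rule_code R) s" and ag: "nagree (rule_code R) s s'"
    and fr: "nfresh (atom_code ` A) (rule_code R) s'"
    and G': "\<And>b. b \<in> G' \<longleftrightarrow> b \<in> atom_code ` A \<or> (\<exists>a. nIn a (psnd (rule_code R)) \<and> b = nsa s' a)"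
    unfolding nstep_def nIn_rules_code by blast
  have e: "enc_on (univ_vars R) s (dec s)" using nall_dec[of A "body R" s] l by (simp add: univ_vars_def)
  have eu: "enc_on (univ_vars R) s' (dec s')" and au: "agree R (dec s) (dec s')"
    using e ag by (auto simp: enc_on_dec nagree_code agree_def dec_def)
  have "env s' v \<in> range tm_code" if v: "v \<in> exist_vars R" for v
  proof -
    obtain m where "env s' v = pe 2 m" using fr v unfolding nfresh_def nex_code by blast
    then have "env s' v = tm_code (Null m)" by simp
    then show ?thesis by blast
  qed
  then have ex: "enc_on (exist_vars R) s' (dec s')" by (simp add: enc_on_dec)
  have e': "enc_on (univ_vars R \<union> exist_vars R) s' (dec s')" using eu ex by (auto simp: enc_on_def)
  have h: "nsa s' (atom_code a) = atom_code (inst (dec s') a)" if "a \<in> set (head R)" for a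
    by (rule nsa_atom_code, rule enc_on_mono[OF e']) (use that head_vars[of R] in blast)
  have "step_by R (dec s) (dec s') A (A \<union> inst (dec s') ` set (head R))"
    using l o fr au nld_code[OF e] nob_code[OF e] nfresh_code[OF ex] by (simp add: step_by_def fresh_ext_def)
  moreover have "G' = atom_code ` (A \<union> inst (dec s') ` set (head R))"
    using G' h by (fastforce simp: image_Un image_image)
  ultimately show "\<exists>A'. G' = atom_code ` A' \<and> step (set Rs) A A'" using R unfolding step_def by blast
next
  assume "\<exists>A'. G' = atom_code ` A' \<and> step (set Rs) A A'"
  then obtain R \<tau> \<tau>' where R: "R \<in> set Rs" and l: "ld R \<tau> A" "\<not> ob R \<tau> A" and fr: "fresh_ext R \<tau> A \<tau>'"
    and G': "G' = atom_code ` (A \<union> inst \<tau>' ` set (head R))"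
    by (auto simp: step_def step_by_def)
  obtain s where s: "enc_on (univ_vars R) s \<tau>" using ex_enc_on[OF finite_univ_vars] by blast
  obtain s' where s': "enc_on (univ_vars R \<union> exist_vars R) s' \<tau>'" using ex_enc_on[OF finite_rule_vars] by blast
  have h: "nsa s' (atom_code a) = atom_code (inst \<tau>' a)" if "a \<in> set (head R)" for a
    by (rule nsa_atom_code, rule enc_on_mono[OF s']) (use that head_vars[of R] in blast)
  have "nagree (rule_code R) s s'" using s s' fr by (auto simp: nagree_code enc_on_def fresh_ext_def agree_def)
  moreover have "nfresh (atom_code ` A) (rule_code R) s'"
    using nfresh_code[OF enc_on_mono[OF s']] fr by (auto simp: fresh_ext_def)
  moreover have "b \<in> G' \<longleftrightarrow> b \<in> atom_code ` A \<or> (\<exists>a. nIn a (psnd (rule_code R)) \<and> b = nsa s' a)" for b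
    unfolding G' using h by (fastforce simp: image_Un image_image)
  moreover have "nall (atom_code ` A) (pfst (rule_code R)) s" "\<not> nob (atom_code ` A) (rule_code R) s"
    using nld_code[OF s] nob_code[OF s] l by auto
  ultimately show "nstep (rules_code Rs) (atom_code ` A) G'"
    unfolding nstep_def nIn_rules_code using R by blast
qed

text \<open>Every number is a list code, and every pair with tag 0 or 1 is a term code, so a
  condition on tags guarantees decodability.\<close>

lemma decode_terms:
  assumes "\<And>t. nIn t l \<Longrightarrow> pfst t = 0 \<or> pfst t = 1"
  shows "\<exists>ts. l = list_encode (map tm_code ts) \<and> (\<forall>t\<in>set ts. \<forall>n. t \<noteq> Null n)"
proof -
  have "\<exists>u. t = tm_code u \<and> (\<forall>n. u \<noteq> Null n)" if "pfst t = 0 \<or> pfst t = 1" for t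
  proof (rule disjE[OF that])
    assume "pfst t = 0"
    then have "t = tm_code (Var (psnd t))" by (simp add: pair_eq)
    then show ?thesis by blast
  next
    assume "pfst t = 1"
    then have "t = tm_code (Const (psnd t))" by (simp add: pair_eq)
    then show ?thesis by blast
  qed
  then obtain g where g: "\<And>t. pfst t = 0 \<or> pfst t = 1 \<Longrightarrow> t = tm_code (g t) \<and> (\<forall>n. g t \<noteq> Null n)" by metis
  have "map tm_code (map g (list_decode l)) = list_decode l"
    by (simp add: comp_def, rule map_idI) (metis assms g nIn_def)
  then have "l = list_encode (map tm_code (map g (list_decode l)))" by simp
  moreover have "\<forall>t\<in>set (map g (list_decode l)). \<forall>n. t \<noteq> Null n" using g assms by (auto simp: nIn_def)
  ultimately show ?thesis by blast
qed

lemma ndatabase_code: "ndatabase G \<longleftrightarrow> (\<exists>D. G = atom_code ` D \<and> database D)"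
proof
  assume G: "ndatabase G"
  have "\<exists>a. b = atom_code a \<and> atom_vars a = {} \<and> atom_nulls a = {}" if "b \<in> G" for b
  proof -
    have *: "pfst t = 1" if "nIn t (psnd b)" for t using G \<open>b \<in> G\<close> that by (auto simp: ndatabase_def)
    then obtain ts where ts: "psnd b = list_encode (map tm_code ts)" "\<forall>t\<in>set ts. \<forall>n. t \<noteq> Null n"
      using decode_terms[of "psnd b"] by auto
    have "t \<noteq> Var v" if "t \<in> set ts" for t v
      using *[of "tm_code t"] that ts(1) by auto
    then have "atom_vars (Atom (pfst b) ts) = {}" "atom_nulls (Atom (pfst b) ts) = {}"
      using ts(2) by (auto simp: atom_vars_def atom_nulls_def)
    moreover have "b = atom_code (Atom (pfst b) ts)" by (simp add: atom_code_def pair_eq ts(1))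
    ultimately show ?thesis by blast
  qed
  then obtain g where g: "\<And>b. b \<in> G \<Longrightarrow> b = atom_code (g b) \<and> atom_vars (g b) = {} \<and> atom_nulls (g b) = {}" by metis
  have "finite G" using G by (auto simp: ndatabase_def finite_nat_set_iff_bounded)
  then have "database (g ` G)" using g by (auto simp: database_def)
  moreover have "G = atom_code ` g ` G" using g by (auto simp: image_image)
  ultimately show "\<exists>D. G = atom_code ` D \<and> database D" by blast
next
  assume "\<exists>D. G = atom_code ` D \<and> database D"
  then obtain D where D: "G = atom_code ` D" "database D" by blast
  have "finite G" using D by (simp add: database_def)
  moreover have "pfst t = 1" if a: "a \<in> D" and t: "nIn t (psnd (atom_code a))" for a t
  proof -
    obtain u where u: "u \<in> set (args a)" "t = tm_code u" using t by (auto simp: atom_code_def)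
    show ?thesis by (cases u) (use u D(2) a in \<open>auto simp: database_def atom_vars_def atom_nulls_def\<close>)
  qed
  ultimately show "ndatabase G" by (auto simp: ndatabase_def D(1) finite_nat_set_iff_bounded)
qed

text \<open>From left to right the members of the sequence are sets of atom codes by induction,
  starting from the database.\<close>

lemma nchase_code: "(\<exists>G. nchase (rules_code Rs) G) \<longleftrightarrow> (\<exists>F. inf_chase (set Rs) F)"
proof
  assume "\<exists>G. nchase (rules_code Rs) G"
  then obtain G where G: "nchase (rules_code Rs) G" by blast
  have "\<exists>A. G i = atom_code ` A" for i
  proof (induction i)
    case 0
    then show ?case using G ndatabase_code by (auto simp: nchase_def)
  next
    case (Suc i)
    then show ?case using G nstep_code by (metis nchase_def)
  qed
  then obtain F where F: "\<And>i. G i = atom_code ` F i" by metis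
  have eq: "atom_code ` A = atom_code ` B \<longleftrightarrow> A = B" for A B by (rule inj_image_eq_iff[OF inj_atom_code])
  have "database (F 0)" using G ndatabase_code[of "G 0"] by (auto simp: nchase_def F eq)
  moreover have "step (set Rs) (F i) (F (Suc i))" for i
    using G nstep_code[of Rs "F i" "G (Suc i)"] by (auto simp: nchase_def F eq)
  moreover have "\<exists>j\<ge>i. ob R \<tau> (F j)" if R: "R \<in> set Rs" and l: "ld R \<tau> (F i)" for R \<tau> i
  proof -
    obtain s where s: "enc_on (univ_vars R) s \<tau>" using ex_enc_on[OF finite_univ_vars] by blast
    then have "nall (G i) (pfst (rule_code R)) s" using nld_code[OF s, of "F i"] l unfolding F by blast
    moreover have "nIn (rule_code R) (rules_code Rs)" using R by simp
    ultimately have "\<exists>j\<ge>i. nob (G j) (rule_code R) s" using G unfolding nchase_def by blast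
    then show ?thesis unfolding F nob_code[OF s] .
  qed
  ultimately show "\<exists>F. inf_chase (set Rs) F" by (auto simp: inf_chase_def)
next
  assume "\<exists>F. inf_chase (set Rs) F"
  then obtain F where F: "inf_chase (set Rs) F" by blast
  define G where "G i = atom_code ` F i" for i
  have "ndatabase (G 0)" using F ndatabase_code by (auto simp: inf_chase_def G_def)
  moreover have "nstep (rules_code Rs) (G i) (G (Suc i))" for i
    using F nstep_code[of Rs "F i"] by (auto simp: inf_chase_def G_def)
  moreover have "\<exists>j\<ge>i. nob (G j) (rule_code R) s" if R: "R \<in> set Rs" and l: "nall (G i) (pfst (rule_code R)) s" for R s i
  proof -
    have e: "enc_on (univ_vars R) s (dec s)" using nall_dec[of "F i" "body R" s] l by (simp add: G_def univ_vars_def)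
    then have "ld R (dec s) (F i)" using nld_code l by (simp add: G_def)
    then have "\<exists>j\<ge>i. ob R (dec s) (F j)" using F R unfolding inf_chase_def by blast
    then show ?thesis unfolding G_def nob_code[OF e] by blast
  qed
  ultimately have "nchase (rules_code Rs) G"
    unfolding nchase_def nIn_rules_code by (intro conjI allI impI) (assumption | erule imageE, blast)+
  then show "\<exists>G. nchase (rules_code Rs) G" by blast
qed

lemma decode_list:
  assumes "\<And>a. nIn a l \<Longrightarrow> \<exists>b. a = g b \<and> P b"
  shows "\<exists>bs. l = list_encode (map g bs) \<and> (\<forall>b\<in>set bs. P b)"
proof -
  obtain h where h: "\<And>a. nIn a l \<Longrightarrow> a = g (h a) \<and> P (h a)" using assms by metis
  have "map g (map h (list_decode l)) = list_decode l"
    by (simp add: comp_def, rule map_idI) (metis h nIn_def)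
  then have "l = list_encode (map g (map h (list_decode l)))" by simp
  moreover have "\<forall>b\<in>set (map h (list_decode l)). P b" using h by (auto simp: nIn_def)
  ultimately show ?thesis by blast
qed

lemma nwf_code: "nwf n \<longleftrightarrow> (\<exists>Rs. n = rules_code Rs \<and> rule_set (set Rs))"
proof
  assume n: "nwf n"
  have "\<exists>R. r = rule_code R \<and> wf_rule R" if r: "nIn r n" for r
  proof -
    have atoms: "\<exists>b. a = atom_code b \<and> atom_nulls b = {}" if ar: "nIn a (pfst r) \<or> nIn a (psnd r)" for a
    proof -
      obtain ts where ts: "psnd a = list_encode (map tm_code ts)" "\<forall>t\<in>set ts. \<forall>n. t \<noteq> Null n"
        using decode_terms[of "psnd a"] n r ar unfolding nwf_def by blast
      have "a = atom_code (Atom (pfst a) ts)" by (simp add: atom_code_def pair_eq ts(1))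
      moreover have "atom_nulls (Atom (pfst a) ts) = {}" using ts(2) by (auto simp: atom_nulls_def)
      ultimately show ?thesis by blast
    qed
    obtain B where B: "pfst r = list_encode (map atom_code B)" "\<forall>b\<in>set B. atom_nulls b = {}"
      using decode_list[of "pfst r" atom_code "\<lambda>b. atom_nulls b = {}"] atoms by blast
    obtain H where H: "psnd r = list_encode (map atom_code H)" "\<forall>b\<in>set H. atom_nulls b = {}"
      using decode_list[of "psnd r" atom_code "\<lambda>b. atom_nulls b = {}"] atoms by blast
    have "psnd r \<noteq> 0" using n r by (auto simp: nwf_def)
    then have "wf_rule (Rule B H)" using B H by (auto simp: wf_rule_def)
    moreover have "r = rule_code (Rule B H)" by (simp add: rule_code_def pair_eq B H)
    ultimately show ?thesis by blast
  qed
  then obtain Rs where "n = list_encode (map rule_code Rs)" "\<forall>R\<in>set Rs. wf_rule R"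
    using decode_list[of n rule_code wf_rule] by blast
  then show "\<exists>Rs. n = rules_code Rs \<and> rule_set (set Rs)" by (auto simp: rules_code_def rule_set_def)
next
  assume "\<exists>Rs. n = rules_code Rs \<and> rule_set (set Rs)"
  then obtain Rs where Rs: "n = rules_code Rs" "\<And>R. R \<in> set Rs \<Longrightarrow> wf_rule R" by (auto simp: rule_set_def)
  have "psnd (rule_code R) \<noteq> 0" if "wf_rule R" for R
    using that by (cases "head R") (auto simp: wf_rule_def)
  moreover have "pfst t = 0 \<or> pfst t = 1"
    if R: "wf_rule R" and a: "nIn a (pfst (rule_code R)) \<or> nIn a (psnd (rule_code R))" and t: "nIn t (psnd a)" for R a t
  proof -
    obtain b where b: "b \<in> set (body R) \<union> set (head R)" "a = atom_code b" using a by auto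
    obtain u where u: "u \<in> set (args b)" "t = tm_code u" using t b(2) by (auto simp: atom_code_def)
    show ?thesis by (cases u) (use R b(1) u in \<open>auto simp: wf_rule_def atom_nulls_def\<close>)
  qed
  ultimately show "nwf n" unfolding nwf_def Rs(1) nIn_rules_code using Rs(2) by blast
qed

theorem Pi11_codes_CT: "Pi11 (codes CT_rest_forall_forall)"
proof -
  have "n \<in> codes CT_rest_forall_forall \<longleftrightarrow> nwf n \<and> \<not> (\<exists>F. nchase n F)" for n
    unfolding codes_def CT_rest_forall_forall_iff nwf_code using nchase_code by blast
  then show ?thesis unfolding Pi11_def using ct_form_iff by blast
qed

section \<open>Completeness\<close>

lemma fun_rules_wf: "R \<in> set (fun_rules g k) \<Longrightarrow> wf_rule R"
  by (cases g) (auto simp: wf_rule_def atom_nulls_def split: if_splits nat.splits)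

lemma param_rule_wf: "wf_rule (param_rule n)"
proof -
  have "atom_nulls a = {}" if "a \<in> set (param_body n)" for a
    using that by (induction n) (auto simp: atom_nulls_def)
  then show ?thesis by (auto simp: param_rule_def wf_rule_def) (auto simp: atom_nulls_def)
qed

lemma rule_set_red_rules: "rule_set (set (red_rules f n))"
proof -
  have "wf_rule R" if R: "R \<in> set (red_rules f n)" for R
  proof -
    consider "R = param_rule n" | g k where "R \<in> set (fun_rules g k)"
      | "R \<in> {chain_rule, brake_rule, stage_rule f, eq_zero_rule, eq_suc_rule, value_rule}"
      using R by (auto simp: red_rules_def fixed_rules_def dest!: all_fun_rules_fun_rules)
    then show ?thesis
    proof cases
      case 3
      then show ?thesis
        by (auto simp: wf_rule_def atom_nulls_def chain_rule_def brake_rule_def stage_rule_def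
            eq_zero_rule_def eq_suc_rule_def value_rule_def)
    qed (simp_all add: param_rule_wf fun_rules_wf)
  qed
  then show ?thesis by (simp add: rule_set_def)
qed

lemma Pi11_hard_codes_CT:
  assumes "Pi11 B"
  shows "many_one_reducible B (codes CT_rest_forall_forall)"
proof -
  obtain \<phi> where \<phi>: "\<And>n. n \<in> B \<longleftrightarrow> (\<forall>X. holds X ((\<lambda>_. 0)(0 := n)) \<phi>)"
    using assms by (auto simp: Pi11_def)
  obtain f where f: "no_mu f" "\<And>n x y. computes f [n, x, y] 0 \<longleftrightarrow> descends \<phi> n x y"
    using ex_recf_descends by blast
  have "n \<in> B \<longleftrightarrow> rules_code (red_rules f n) \<in> codes CT_rest_forall_forall" for n
  proof -
    have "n \<notin> B \<longleftrightarrow> (\<exists>s. \<forall>k. computes f [n, s k, s (Suc k)] 0)"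
      unfolding \<phi> f(2) using descent_sound descent_complete by metis
    also have "\<dots> \<longleftrightarrow> (\<exists>F. inf_chase (set (red_rules f n)) F)"
      using inf_chase_descent descent_inf_chase[OF f(1)] by metis
    also have "\<dots> \<longleftrightarrow> set (red_rules f n) \<notin> CT_rest_forall_forall"
      using rule_set_red_rules by (simp add: CT_rest_forall_forall_iff)
    \<comment> \<open>A number codes at most one list, so membership of this code depends on this
      rule set alone.\<close>
    also have "\<dots> \<longleftrightarrow> rules_code (red_rules f n) \<notin> codes CT_rest_forall_forall"
      by (auto simp: codes_def inj_eq[OF inj_rules_code])
    finally show ?thesis by blast
  qed
  then show ?thesis
    using computable_red_rules[of f] unfolding many_one_reducible_def by blast
qed

theorem theorem5p1: "Pi11_complete (codes CT_rest_forall_forall)"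
  unfolding Pi11_complete_def using Pi11_codes_CT Pi11_hard_codes_CT by blast

end
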